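(* Let $\Bbbk$ be a field. Then $R^{h,t}_n:=HH_0(H^n_{h,t})$ and $\overline R^{h,t}_n$ are isomorphic as $\Bbbk[h,t]$-modules.
   Context: Everything is over $\Bbbk[h,t]$. $HH_0(A)=A/[A,A]$, where $[A,A]$ is the span of all commutators. Deformed arc ring. Let $\mathcal{A}_{h,t}=\Bbbk[h,t][X]/(X^2-hX-t)$ with $\Delta(1)=1\otimes X+X\otimes1-h\,1\otimes1$, $\Delta(X)=X\otimes X+t\,1\otimes1$, $\epsilon(1)=0$, $\epsilon(X)=1$, and let $\mathcal{F}$ be the corresponding two-dimensional TQFT: it sends $r$ circles to $\mathcal{A}_{h,t}^{\otimes r}$ (tensor over $\Bbbk[h,t]$), a merge to multiplication, a split to $\Delta$, a birth to the unit, a death to $\epsilon$. Let $B^n$ be the set of crossingless matchings of $2n$ points on a line, $W(b)$ the reflection of $b$. Then $H^n_{h,t}=\bigoplus_{a,b\in B^n}{}_b(H^n_{h,t})_a$ with ${}_b(H^n_{h,t})_a=\mathcal{F}(W(b)a)$, where $W(b)a$ is the collection of circles obtained by gluing. Products ${}_d(\cdot)_c\cdot{}_b(\cdot)_a$ with $b\neq c$ are zero; for $b=c$ the product ${}_d(\cdot)_b\otimes{}_b(\cdot)_a\to{}_d(\cdot)_a$ is $\mathcal{F}$ of the minimal cobordism $W(d)bW(b)a\to W(d)a$ built from the $n$ saddles turning $bW(b)$ into $2n$ vertical lines. Graphical module. $\overline R^{h,t}_n$ is the quotient of the free $\Bbbk[h,t]$-module on crossingless matchings of $2n$ points whose arcs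 carry any finite number of dots by the following local relations. Dot reduction: an arc with two dots equals $h$ times the arc with one dot plus $t$ times the arc with none (all other dots unchanged). For $a<b<c<d$, with a bar marking one dot: Type I: $[\overline{ab},cd]+[ab,\overline{cd}]-h[ab,cd]=[\overline{ad},bc]+[ad,\overline{bc}]-h[ad,bc]$. Type II: $[\overline{ab},\overline{cd}]+t[ab,cd]=[\overline{ad},\overline{bc}]+t[ad,bc]$. In each relation the diagrams are identical away from the arcs shown, and extra dots are allowed on the segments of these arcs near the endpoints $a,b,c,d$, the same number near a given endpoint in all terms. *)

theory Defs
  imports
    "HOL-Library.Poly_Mapping"
    "HOL-Library.Multiset"
    "HOL-Library.Set_Algebras"
    "HOL-Computational_Algebra.Polynomial"
begin

section \<open>Free modules, quotient modules and their isomorphisms\<close>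

text \<open>The free module on the basis \<^term>\<open>B\<close> is the set of all \<^term>\<open>x\<close> of type \<open>'i \<Rightarrow>\<^sub>0 'r\<close>
  with \<^term>\<open>Poly_Mapping.keys x \<subseteq> B\<close>.\<close>

definition scl :: "'r::comm_ring_1 \<Rightarrow> ('i \<Rightarrow>\<^sub>0 'r) \<Rightarrow> ('i \<Rightarrow>\<^sub>0 'r)" (infixr "\<odot>" 75)
  where "r \<odot> x = Poly_Mapping.map ((*) r) x"

lemma lookup_scl [simp]: "Poly_Mapping.lookup (r \<odot> x) i = r * Poly_Mapping.lookup x i"
  by (simp add: scl_def Poly_Mapping.map.rep_eq when_def)

interpretation poly_mapping_module: module scl
  by unfold_locales (auto intro!: poly_mapping_eqI simp: lookup_add algebra_simps)

abbreviation basis_vec :: "'i \<Rightarrow> ('i \<Rightarrow>\<^sub>0 'r::comm_ring_1)"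
  where "basis_vec i \<equiv> Poly_Mapping.single i 1"

definition free_module :: "'i set \<Rightarrow> ('i \<Rightarrow>\<^sub>0 'r::comm_ring_1) set"
  where "free_module B = {x. Poly_Mapping.keys x \<subseteq> B}"

definition linear_extension ::
  "('i \<Rightarrow> ('j \<Rightarrow>\<^sub>0 'r)) \<Rightarrow> ('i \<Rightarrow>\<^sub>0 'r::comm_ring_1) \<Rightarrow> ('j \<Rightarrow>\<^sub>0 'r)"
  where "linear_extension f x =
    (\<Sum>i\<in>Poly_Mapping.keys x. Poly_Mapping.lookup x i \<odot> f i)"

record ('r, 'm) rmodule =
  rcarrier :: "'m set"
  radd :: "'m \<Rightarrow> 'm \<Rightarrow> 'm"
  rscale :: "'r \<Rightarrow> 'm \<Rightarrow> 'm"

text \<open>The module of cosets of a submodule \<^term>\<open>N\<close> in \<^term>\<open>M\<close>. The scalar multiple of a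
  coset is saturated by \<^term>\<open>N\<close> because \<^term>\<open>r \<odot> x\<close> for \<^term>\<open>x\<close> in a coset need not
  run through a full coset when \<^term>\<open>r\<close> is not a unit.\<close>

definition quotient_module ::
  "('i \<Rightarrow>\<^sub>0 'r::comm_ring_1) set \<Rightarrow> ('i \<Rightarrow>\<^sub>0 'r) set \<Rightarrow> ('r, ('i \<Rightarrow>\<^sub>0 'r) set) rmodule"
  where "quotient_module M N =
    \<lparr> rcarrier = (\<lambda>x. x +o N) ` M,
      radd = (\<lambda>A B. A + B),
      rscale = (\<lambda>r A. \<Union>x\<in>A. (r \<odot> x) +o N) \<rparr>"

definition rmodule_isomorphic :: "('r, 'm) rmodule \<Rightarrow> ('r, 'l) rmodule \<Rightarrow> bool"
  where "rmodule_isomorphic M L \<longleftrightarrow>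
    (\<exists>\<phi>. bij_betw \<phi> (rcarrier M) (rcarrier L) \<and>
      (\<forall>x\<in>rcarrier M. \<forall>y\<in>rcarrier M. \<phi> (radd M x y) = radd L (\<phi> x) (\<phi> y)) \<and>
      (\<forall>r. \<forall>x\<in>rcarrier M. \<phi> (rscale M r x) = rscale L r (\<phi> x)))"


section \<open>The ground ring\<close>

text \<open>The polynomial ring in two variables is the iterated polynomial ring
  \<^typ>\<open>'k poly poly\<close>.\<close>

definition hh :: "'k::field poly poly" where "hh = [:[:0, 1:]:]"
definition tt :: "'k::field poly poly" where "tt = [:0, 1:]"


section \<open>Crossingless matchings\<close>

text \<open>An arc joining \<open>i < j\<close> is the pair \<open>(i, j)\<close>.\<close>

type_synonym matching = "(nat \<times> nat) set"

definition crossingless_matchings :: "nat \<Rightarrow> matching set"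
  where "crossingless_matchings n =
    {m. m \<subseteq> {(i, j). 1 \<le> i \<and> i < j \<and> j \<le> 2 * n} \<and>
        (\<forall>p\<in>{1..2 * n}. \<exists>!e. e \<in> m \<and> (p = fst e \<or> p = snd e)) \<and>
        (\<forall>(i, j)\<in>m. \<forall>(k, l)\<in>m. \<not> (i < k \<and> k < j \<and> j < l))}"

definition component :: "('v \<times> 'v) set \<Rightarrow> 'v \<Rightarrow> 'v set"
  where "component E p = (E \<union> E\<inverse>)\<^sup>* `` {p}"

text \<open>The circles of \<open>W(b)a\<close>, each given by the set of boundary points it passes through.
  Reflection does not change the pairing of the endpoints, so \<open>W(b)\<close> is represented by the
  same set of pairs as \<^term>\<open>b\<close>.\<close>

definition circles :: "nat \<Rightarrow> matching \<Rightarrow> matching \<Rightarrow> nat set set"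
  where "circles n b a = component (a \<union> b) ` {1..2 * n}"


section \<open>The two-dimensional TQFT on merges and splits\<close>

text \<open>Let \<open>A\<close> be the Frobenius algebra \<open>R[X]/(X\<^sup>2 - h X - t)\<close>, which is free on \<open>1, X\<close>.
  For a finite set \<open>\<C>\<close> of circles the tensor power of \<open>A\<close> indexed by \<open>\<C>\<close> is free on the
  subsets of \<open>\<C>\<close>: the subset \<open>S\<close> stands for the pure tensor with factor \<open>X\<close> at the circles
  in \<open>S\<close> and factor \<open>1\<close> at all others.

  \<open>merge_map P Q Z\<close> is multiplication from the factors at \<open>P\<close> and \<open>Q\<close> to the factor at \<open>Z\<close>;
  the first case is \<open>X X = h X + t\<close>.\<close>

definition merge_map :: "'c \<Rightarrow> 'c \<Rightarrow> 'c \<Rightarrow> 'c set \<Rightarrow> ('c set \<Rightarrow>\<^sub>0 'k::field poly poly)"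
  where "merge_map P Q Z S =
    (let U = S - {P, Q} in
     if P \<in> S \<and> Q \<in> S then hh \<odot> basis_vec (insert Z U) + tt \<odot> basis_vec U
     else if P \<in> S \<or> Q \<in> S then basis_vec (insert Z U)
     else basis_vec U)"

text \<open>\<open>split_map P Y Z\<close> is the comultiplication from the factor at \<open>P\<close> to those at \<open>Y\<close> and \<open>Z\<close>:
  \<open>\<Delta>(X) = X \<otimes> X + t 1 \<otimes> 1\<close> and \<open>\<Delta>(1) = 1 \<otimes> X + X \<otimes> 1 - h 1 \<otimes> 1\<close>.\<close>

definition split_map :: "'c \<Rightarrow> 'c \<Rightarrow> 'c \<Rightarrow> 'c set \<Rightarrow> ('c set \<Rightarrow>\<^sub>0 'k::field poly poly)"
  where "split_map P Y Z S =
    (let U = S - {P} in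
     if P \<in> S then basis_vec (insert Y (insert Z U)) + tt \<odot> basis_vec U
     else basis_vec (insert Y U) + basis_vec (insert Z U) - hh \<odot> basis_vec U)"


section \<open>The deformed arc ring\<close>

text \<open>\<open>stacked d a rem don\<close> is the closed 1-manifold between \<open>W(d) b W(b) a\<close> and \<open>W(d) a\<close> in
  which the arcs of \<open>b\<close> in \<open>rem\<close> and their mirror images are still present and a saddle has been
  performed at those in \<open>don\<close>. The point \<open>i\<close> on the line of \<open>W(b)a\<close> is \<^term>\<open>Inl i\<close>, the one on
  the line of \<open>W(d)b\<close> is \<^term>\<open>Inr i\<close>. A saddle at an arc joining \<open>i\<close> and \<open>j\<close> replaces the arc and
  its mirror image by the vertical segments at \<open>i\<close> and at \<open>j\<close>.\<close>

definition stacked ::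
  "matching \<Rightarrow> matching \<Rightarrow> matching \<Rightarrow> matching \<Rightarrow> ((nat + nat) \<times> (nat + nat)) set"
  where "stacked d a rem don =
    {(Inl i, Inl j) | i j. (i, j) \<in> a \<union> rem} \<union>
    {(Inr i, Inr j) | i j. (i, j) \<in> d \<union> rem} \<union>
    {(Inl i, Inr i) | i. i \<in> fst ` don \<union> snd ` don}"

text \<open>The value of the TQFT on the composite of the saddles at a list of remaining arcs. A saddle
  splits a circle if both arcs involved lie on the same circle, and merges two circles otherwise.\<close>

fun saddles ::
  "matching \<Rightarrow> matching \<Rightarrow> matching \<Rightarrow> (nat \<times> nat) list \<Rightarrow>
   ((nat + nat) set set \<Rightarrow>\<^sub>0 'k::field poly poly) \<Rightarrow> ((nat + nat) set set \<Rightarrow>\<^sub>0 'k poly poly)"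
  where
    "saddles d a don [] x = x"
  | "saddles d a don ((i, j) # es) x =
      (let E = stacked d a (insert (i, j) (set es)) don;
           E' = stacked d a (set es) (insert (i, j) don);
           P = component E (Inl i);
           Q = component E (Inr i);
           f = (if P = Q
                then split_map P (component E' (Inl i)) (component E' (Inl j))
                else merge_map P Q (component E' (Inl i)))
       in saddles d a (insert (i, j) don) es (linear_extension f x))"

text \<open>Basis elements of the arc ring are triples \<open>(b, a, S)\<close> where \<open>S\<close> is a set of circles of
  \<open>W(b)a\<close> (those labelled \<open>X\<close>).\<close>

type_synonym arc_basis = "matching \<times> matching \<times> nat set set"

definition arc_ring :: "nat \<Rightarrow> (arc_basis \<Rightarrow>\<^sub>0 'k::field poly poly) set"
  where "arc_ring n =
    free_module {(b, a, S). b \<in> crossingless_matchings n \<and> a \<in> crossingless_matchings n \<and>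
                            S \<subseteq> circles n b a}"

text \<open>The saddles are performed in the order of the left endpoints of the arcs. Thus an arc of
  \<open>b\<close> is surgered before the arcs nested inside it, and each saddle joins an arc to its mirror
  image across a region of the plane containing no other part of the diagram. A circle of the
  final diagram is a circle of \<open>W(d)a\<close> after restriction to either of the two lines.\<close>

fun arc_mult_basis :: "arc_basis \<Rightarrow> arc_basis \<Rightarrow> (arc_basis \<Rightarrow>\<^sub>0 'k::field poly poly)"
  where "arc_mult_basis (d, c, T) (b, a, S) =
    (if c = b
     then linear_extension (\<lambda>K. basis_vec (d, a, (\<lambda>C. Inl -` C) ` K))
            (saddles d a {} (sorted_key_list_of_set fst b)
              (basis_vec ((`) Inl ` S \<union> (`) Inr ` T)))
     else 0)"

definition arc_mult ::
  "(arc_basis \<Rightarrow>\<^sub>0 'k::field poly poly) \<Rightarrow> (arc_basis \<Rightarrow>\<^sub>0 'k poly poly) \<Rightarrow>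
   (arc_basis \<Rightarrow>\<^sub>0 'k poly poly)"
  where "arc_mult y x =
    linear_extension (\<lambda>\<beta>. linear_extension (\<lambda>\<alpha>. arc_mult_basis \<beta> \<alpha>) x) y"

definition arc_commutators :: "nat \<Rightarrow> (arc_basis \<Rightarrow>\<^sub>0 'k::field poly poly) set"
  where "arc_commutators n =
    {arc_mult x y - arc_mult y x | x y. x \<in> arc_ring n \<and> y \<in> arc_ring n}"

definition HH0_arc_ring ::
  "nat \<Rightarrow> ('k::field poly poly, (arc_basis \<Rightarrow>\<^sub>0 'k poly poly) set) rmodule"
  where "HH0_arc_ring n =
    quotient_module (arc_ring n) (poly_mapping_module.span (arc_commutators n))"


section \<open>The graphical module\<close>

text \<open>A dotted matching is a matching with the multiset of dots on its arcs.\<close>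

type_synonym dotted = "matching \<times> (nat \<times> nat) multiset"

definition dotted_matchings :: "nat \<Rightarrow> dotted set"
  where "dotted_matchings n = {(m, D). m \<in> crossingless_matchings n \<and> set_mset D \<subseteq> m}"

definition dot_reductions :: "nat \<Rightarrow> (dotted \<Rightarrow>\<^sub>0 'k::field poly poly) set"
  where "dot_reductions n =
    {basis_vec (m, D + {#e, e#}) - (hh \<odot> basis_vec (m, D + {#e#}) + tt \<odot> basis_vec (m, D))
     | m D e. (m, D) \<in> dotted_matchings n \<and> e \<in> m}"

text \<open>The diagram consisting of \<open>C\<close> with dots \<open>D\<close>, the arc \<open>e\<close> with \<open>k\<close> dots and the arc
  \<open>f\<close> with \<open>l\<close> dots.\<close>

definition with_arcs ::
  "matching \<Rightarrow> (nat \<times> nat) multiset \<Rightarrow> (nat \<times> nat) \<Rightarrow> nat \<Rightarrow> (nat \<times> nat) \<Rightarrow> nat \<Rightarrow>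
   (dotted \<Rightarrow>\<^sub>0 'k::field poly poly)"
  where "with_arcs C D e k f l =
    basis_vec (C \<union> {e, f}, D + replicate_mset k e + replicate_mset l f)"

text \<open>In both relations \<open>p, q, r, s\<close> are the numbers of extra dots near \<open>a, b, c, d\<close>.\<close>

definition local_configurations ::
  "nat \<Rightarrow> (matching \<times> (nat \<times> nat) multiset \<times> nat \<times> nat \<times> nat \<times> nat) set"
  where "local_configurations n =
    {(C, D, a, b, c, d). a < b \<and> b < c \<and> c < d \<and> set_mset D \<subseteq> C \<and>
       C \<union> {(a, b), (c, d)} \<in> crossingless_matchings n \<and>
       C \<union> {(a, d), (b, c)} \<in> crossingless_matchings n}"

definition type_I_relations :: "nat \<Rightarrow> (dotted \<Rightarrow>\<^sub>0 'k::field poly poly) set"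
  where "type_I_relations n =
    {(with_arcs C D (a, b) (p + q + 1) (c, d) (r + s)
        + with_arcs C D (a, b) (p + q) (c, d) (r + s + 1)
        - hh \<odot> with_arcs C D (a, b) (p + q) (c, d) (r + s))
     - (with_arcs C D (a, d) (p + s + 1) (b, c) (q + r)
        + with_arcs C D (a, d) (p + s) (b, c) (q + r + 1)
        - hh \<odot> with_arcs C D (a, d) (p + s) (b, c) (q + r))
     | C D a b c d p q r s. (C, D, a, b, c, d) \<in> local_configurations n}"

definition type_II_relations :: "nat \<Rightarrow> (dotted \<Rightarrow>\<^sub>0 'k::field poly poly) set"
  where "type_II_relations n =
    {(with_arcs C D (a, b) (p + q + 1) (c, d) (r + s + 1)
        + tt \<odot> with_arcs C D (a, b) (p + q) (c, d) (r + s))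
     - (with_arcs C D (a, d) (p + s + 1) (b, c) (q + r + 1)
        + tt \<odot> with_arcs C D (a, d) (p + s) (b, c) (q + r))
     | C D a b c d p q r s. (C, D, a, b, c, d) \<in> local_configurations n}"

definition graphical_module ::
  "nat \<Rightarrow> ('k::field poly poly, (dotted \<Rightarrow>\<^sub>0 'k poly poly) set) rmodule"
  where "graphical_module n =
    quotient_module (free_module (dotted_matchings n))
      (poly_mapping_module.span
        (dot_reductions n \<union> type_I_relations n \<union> type_II_relations n))"

end

(*
  The commutators of H^n identify HH_0 with the quotient of the sum over a of F(W(a)a) by the relations
  xy = yx for x in F(W(a)b) and y in F(W(b)a). All these spaces are cyclic over the polynomial ring in
  dots placed at the 2n boundary points, and the saddles act on dots linearly: a merge sends 1 to 1, a
  split along the arc (i, j) sends 1 to X_i + X_j - h. The part of the minimal cobordism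
  W(a)bW(b)a -> W(a)a that meets a given circle of W(b)a has genus 0, so all arcs of b on this circle
  split except for the first one. Hence the relations say that
  f * (product of X_i + X_j - h over the arcs of b that split) in F(W(a)a) equals
  f * (product of X_i + X_j - h over the arcs of a that split) in F(W(b)b), for all f.
  For a and b that differ by one surgery this is the type I relation, and the type II relation is the
  type I relation with an additional dot. The general case follows from these by induction on the
  number of arcs of b not in a: surger a along such an arc with maximal left endpoint.
*)
theory Submission
  imports Defs
begin

subsection \<open>Linear maps between free modules\<close>

text \<open>Genus 0 enters as combinatorics of alternating paths. Flatten the two mirror images in
  W(a)bW(b)a onto one line: a saddle then deletes an arc of \<open>b\<close> from a closed path, and
  the two copies of a path lie on one circle as soon as an earlier saddle has touched it. A parity
  count shows that the first saddle on a circle merges; that a path has at most two ends shows that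
  every later one splits. Dots are attached to boundary points and not to circles, because points
  survive saddles, and X_i + X_j - h is \<Delta>(1) written in this way. The induction has to match
  two products: when surgery along ij replaces the arcs pi, jq of \<open>a\<close> by ij, pq, then
  in general (X_p + X_i - h)(X_j + X_q - h) must agree with (X_p + X_i - h)(X_p + X_q - h) on the
  matching \<open>b\<close>. This holds because X_i = X_j there and (X_p + X_i - h)(X_p - X_i) = 0,
  both dots being roots of X^2 - hX - t.\<close>

abbreviation linear_map :: "(('i \<Rightarrow>\<^sub>0 'r::comm_ring_1) \<Rightarrow> ('j \<Rightarrow>\<^sub>0 'r)) \<Rightarrow> bool"
  where "linear_map \<equiv> module_hom scl scl"

lemma linear_mapI:
  assumes "\<And>x y. T (x + y) = T x + T y" "\<And>r x. T (r \<odot> x) = r \<odot> T x"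
  shows "linear_map T"
  by (rule module_hom.intro) (use assms in \<open>auto intro!: poly_mapping_module.module_axioms module_hom_axioms.intro\<close>)

text \<open>Keys may cancel in a sum, so linearity is proved over a common finite index set instead
  of the keys of each vector.\<close>

lemma linear_extension_superset:
  assumes "finite I" "Poly_Mapping.keys x \<subseteq> I"
  shows "linear_extension f x = (\<Sum>i\<in>I. Poly_Mapping.lookup x i \<odot> f i)"
  unfolding linear_extension_def
  by (rule sum.mono_neutral_left) (use assms in \<open>auto simp: in_keys_iff\<close>)

lemma linear_map_extension [simp, intro]:
  fixes f :: "'i \<Rightarrow> ('j \<Rightarrow>\<^sub>0 'r::comm_ring_1)"
  shows "linear_map (linear_extension f)"
proof (rule linear_mapI)
  fix x y :: "'i \<Rightarrow>\<^sub>0 'r" and r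
  let ?I = "Poly_Mapping.keys x \<union> Poly_Mapping.keys y"
  have "linear_extension f (x + y) = (\<Sum>i\<in>?I. Poly_Mapping.lookup (x + y) i \<odot> f i)"
    using keys_add[of x y] by (intro linear_extension_superset) auto
  also have "\<dots> = linear_extension f x + linear_extension f y"
    by (simp add: linear_extension_superset[of ?I] lookup_add
        poly_mapping_module.scale_left_distrib sum.distrib)
  finally show "linear_extension f (x + y) = linear_extension f x + linear_extension f y" .
  have "linear_extension f (r \<odot> x)
      = (\<Sum>i\<in>Poly_Mapping.keys x. Poly_Mapping.lookup (r \<odot> x) i \<odot> f i)"
    by (rule linear_extension_superset) (auto simp: in_keys_iff)
  also have "\<dots> = r \<odot> linear_extension f x"
    by (simp add: linear_extension_def poly_mapping_module.scale_sum_right)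
  finally show "linear_extension f (r \<odot> x) = r \<odot> linear_extension f x" .
qed

lemma linear_extension_single [simp]: "linear_extension f (Poly_Mapping.single i r) = r \<odot> f i"
  by (cases "r = 0") (simp_all add: linear_extension_def)

lemmas linear_extension_add [simp] = module_hom.add[OF linear_map_extension]
lemmas linear_extension_scale [simp] = module_hom.scale[OF linear_map_extension]
lemmas linear_extension_diff [simp] = module_hom.diff[OF linear_map_extension]
lemmas linear_extension_zero [simp] = module_hom.zero[OF linear_map_extension]

lemma sum_basis_vec:
  "(\<Sum>i\<in>Poly_Mapping.keys x. Poly_Mapping.lookup x i \<odot> basis_vec i) = x"
proof (rule poly_mapping_eqI)
  fix j
  have "Poly_Mapping.lookup (\<Sum>i\<in>Poly_Mapping.keys x. Poly_Mapping.lookup x i \<odot> basis_vec i) j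
      = (\<Sum>i\<in>Poly_Mapping.keys x. if i = j then Poly_Mapping.lookup x i else 0)"
    unfolding Poly_Mapping.lookup_sum by (rule sum.cong) (auto simp: lookup_single when_def)
  then show "Poly_Mapping.lookup
      (\<Sum>i\<in>Poly_Mapping.keys x. Poly_Mapping.lookup x i \<odot> basis_vec i) j = Poly_Mapping.lookup x j"
    by (simp add: in_keys_iff)
qed

lemma linear_map_eq_on_keys:
  assumes "linear_map T" "linear_map U"
    and "\<And>i. i \<in> Poly_Mapping.keys x \<Longrightarrow> T (basis_vec i) = U (basis_vec i)"
  shows "T x = U x"
proof -
  have "T (\<Sum>i\<in>Poly_Mapping.keys x. Poly_Mapping.lookup x i \<odot> basis_vec i)
      = U (\<Sum>i\<in>Poly_Mapping.keys x. Poly_Mapping.lookup x i \<odot> basis_vec i)"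
    using assms by (simp add: module_hom.sum module_hom.scale)
  then show ?thesis by (simp add: sum_basis_vec)
qed

lemma linear_map_eq:
  assumes "linear_map T" "linear_map U" "\<And>i. T (basis_vec i) = U (basis_vec i)"
  shows "T x = U x"
  using assms by (rule linear_map_eq_on_keys)

text \<open>Applied to a difference of two linear maps, this reduces congruences modulo the
  relations to basis vectors.\<close>

lemma linear_map_in_submodule:
  assumes "linear_map T" "poly_mapping_module.subspace N"
    and "\<And>i. i \<in> Poly_Mapping.keys x \<Longrightarrow> T (basis_vec i) \<in> N"
  shows "T x \<in> N"
proof -
  have "T x = T (\<Sum>i\<in>Poly_Mapping.keys x. Poly_Mapping.lookup x i \<odot> basis_vec i)"
    by (simp add: sum_basis_vec)
  also have "\<dots> = (\<Sum>i\<in>Poly_Mapping.keys x. Poly_Mapping.lookup x i \<odot> T (basis_vec i))"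
    using assms(1) by (simp add: module_hom.sum module_hom.scale)
  also have "\<dots> \<in> N"
    using assms(2,3)
    by (intro poly_mapping_module.subspace_sum poly_mapping_module.subspace_scale) auto
  finally show ?thesis .
qed

lemma linear_map_span:
  assumes "linear_map T" "poly_mapping_module.subspace N" "\<And>x. x \<in> B \<Longrightarrow> T x \<in> N"
    and "x \<in> poly_mapping_module.span B"
  shows "T x \<in> N"
  using assms(4)
proof (induction rule: poly_mapping_module.span_induct_alt)
  case base
  then show ?case
    using assms(1,2) by (simp add: module_hom.zero poly_mapping_module.subspace_0)
next
  case (step c x y)
  then show ?case
    using assms(1-3) by (simp add: module_hom.add module_hom.scale
        poly_mapping_module.subspace_add poly_mapping_module.subspace_scale)
qed

lemma linear_map_compose:
  "linear_map T \<Longrightarrow> linear_map U \<Longrightarrow> linear_map (\<lambda>x. U (T x))"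
  using module_hom_compose[of scl scl T scl U] by (simp add: comp_def)

lemma linear_map_add: "linear_map T \<Longrightarrow> linear_map U \<Longrightarrow> linear_map (\<lambda>x. T x + U x)"
  by (rule linear_mapI) (simp_all add: module_hom.add module_hom.scale
      poly_mapping_module.scale_right_distrib)

lemma linear_map_diff: "linear_map T \<Longrightarrow> linear_map U \<Longrightarrow> linear_map (\<lambda>x. T x - U x)"
  by (rule linear_mapI) (simp_all add: module_hom.add module_hom.scale
      poly_mapping_module.scale_right_diff_distrib)

lemma linear_map_scale: "linear_map T \<Longrightarrow> linear_map (\<lambda>x. r \<odot> T x)"
  by (rule linear_mapI) (simp_all add: module_hom.add module_hom.scale mult.commute
      poly_mapping_module.scale_right_distrib)

lemmas linear_map_intros =
  linear_map_compose[OF _ linear_map_extension]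
  poly_mapping_module.module_hom_ident linear_map_add linear_map_diff linear_map_scale

section \<open>Cosets and isomorphisms of quotient modules\<close>

lemma coset_eq_iff:
  fixes x y :: "'i \<Rightarrow>\<^sub>0 'r::comm_ring_1"
  assumes "poly_mapping_module.subspace N"
  shows "x +o N = y +o N \<longleftrightarrow> x - y \<in> N"
proof
  assume "x +o N = y +o N"
  moreover have "x \<in> x +o N"
    using assms by (force simp: elt_set_plus_def poly_mapping_module.subspace_0 intro: bexI[of _ 0])
  ultimately obtain z where "z \<in> N" "x = y + z" by (auto simp: elt_set_plus_def)
  then show "x - y \<in> N" by simp
next
  have *: "u +o N \<subseteq> v +o N" if "u - v \<in> N" for u v :: "'i \<Rightarrow>\<^sub>0 'r"
  proof
    fix w assume "w \<in> u +o N"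
    then obtain z where "z \<in> N" "w = u + z" by (auto simp: elt_set_plus_def)
    then have "(u - v) + z \<in> N" "w = v + ((u - v) + z)"
      using assms that by (auto simp: poly_mapping_module.subspace_add)
    then show "w \<in> v +o N" unfolding elt_set_plus_def by blast
  qed
  assume "x - y \<in> N"
  moreover from this have "y - x \<in> N"
    using poly_mapping_module.subspace_neg[OF assms, of "x - y"] by simp
  ultimately show "x +o N = y +o N" using * by blast
qed

lemma coset_add:
  assumes "poly_mapping_module.subspace N"
  shows "(x +o N) + (y +o N) = (x + y) +o N"
proof -
  have "N + N = N"
    using assms by (force simp: set_plus_def poly_mapping_module.subspace_add
        poly_mapping_module.subspace_0 intro: bexI[of _ 0])
  then show ?thesis by (simp add: set_plus_rearrange)
qed

text \<open>All representatives u of the coset contribute the same coset of r u, since they differ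
  by elements of N and N is closed under scaling.\<close>

lemma coset_scale:
  assumes "poly_mapping_module.subspace N"
  shows "(\<Union>u\<in>x +o N. (r \<odot> u) +o N) = (r \<odot> x) +o N"
proof -
  have "(r \<odot> u) +o N = (r \<odot> x) +o N" if u: "u \<in> x +o N" for u
  proof -
    obtain z where "z \<in> N" "u = x + z" using u unfolding elt_set_plus_def by blast
    then show ?thesis
      using assms by (simp add: coset_eq_iff poly_mapping_module.scale_right_distrib
          poly_mapping_module.subspace_scale)
  qed
  moreover have "x \<in> x +o N"
    using assms by (force simp: elt_set_plus_def poly_mapping_module.subspace_0 intro: bexI[of _ 0])
  ultimately show ?thesis by blast
qed

text \<open>The two maps need to be inverse to each other only modulo the relations, so both can be
  given by formulas on bases.\<close>

lemma quotient_module_isomorphicI: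
  fixes \<Phi> :: "('i \<Rightarrow>\<^sub>0 'r::comm_ring_1) \<Rightarrow> ('j \<Rightarrow>\<^sub>0 'r)"
  assumes lin: "linear_map \<Phi>" "linear_map \<Psi>"
    and sub: "poly_mapping_module.subspace M" "poly_mapping_module.subspace M'"
      "poly_mapping_module.subspace N" "poly_mapping_module.subspace N'"
    and into: "\<And>x. x \<in> M \<Longrightarrow> \<Phi> x \<in> M'" "\<And>y. y \<in> M' \<Longrightarrow> \<Psi> y \<in> M"
    and resp: "\<And>x. x \<in> N \<Longrightarrow> \<Phi> x \<in> N'" "\<And>y. y \<in> N' \<Longrightarrow> \<Psi> y \<in> N"
    and inv: "\<And>x. x \<in> M \<Longrightarrow> \<Psi> (\<Phi> x) - x \<in> N" "\<And>y. y \<in> M' \<Longrightarrow> \<Phi> (\<Psi> y) - y \<in> N'"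
  shows "rmodule_isomorphic (quotient_module M N) (quotient_module M' N')"
proof -
  \<comment> \<open>A coset does not come with a representative, so one is chosen; since \<Phi> maps
    N into N', the choice does not affect the value.\<close>
  define \<phi> where "\<phi> A = \<Phi> (SOME x. x \<in> M \<and> A = x +o N) +o N'" for A
  have \<phi>: "\<phi> (x +o N) = \<Phi> x +o N'" if "x \<in> M" for x
  proof -
    let ?y = "SOME y. y \<in> M \<and> x +o N = y +o N"
    have "?y \<in> M \<and> x +o N = ?y +o N"
      by (rule someI[of _ x]) (use that in auto)
    then have "\<Phi> (?y - x) \<in> N'"
      using resp(1) coset_eq_iff[OF sub(3)] by metis
    then show ?thesis
      unfolding \<phi>_def using coset_eq_iff[OF sub(4)] lin(1) by (simp add: module_hom.diff)
  qed
  have "inj_on \<phi> ((\<lambda>x. x +o N) ` M)"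
  proof (rule inj_onI, clarify)
    fix x y assume "x \<in> M" "y \<in> M" "\<phi> (x +o N) = \<phi> (y +o N)"
    then have "\<Phi> (x - y) \<in> N'"
      using \<phi> coset_eq_iff[OF sub(4)] lin(1) by (simp add: module_hom.diff)
    then have "\<Psi> (\<Phi> (x - y)) \<in> N" by (rule resp)
    moreover have "\<Psi> (\<Phi> (x - y)) - (x - y) \<in> N"
      using \<open>x \<in> M\<close> \<open>y \<in> M\<close> sub(1) inv(1) poly_mapping_module.subspace_diff by blast
    \<comment> \<open>Both \<Psi> (\<Phi> (x - y)) and its deviation from x - y lie in N, hence so
      does their difference x - y.\<close>
    ultimately have "\<Psi> (\<Phi> (x - y)) - (\<Psi> (\<Phi> (x - y)) - (x - y)) \<in> N"
      using sub(3) poly_mapping_module.subspace_diff by blast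
    then show "x +o N = y +o N"
      using coset_eq_iff[OF sub(3)] by simp
  qed
  moreover have "\<phi> ` (\<lambda>x. x +o N) ` M = (\<lambda>x. x +o N') ` M'"
  proof
    show "\<phi> ` (\<lambda>x. x +o N) ` M \<subseteq> (\<lambda>x. x +o N') ` M'" using \<phi> into by auto
    show "(\<lambda>x. x +o N') ` M' \<subseteq> \<phi> ` (\<lambda>x. x +o N) ` M"
    proof clarify
      fix y assume "y \<in> M'"
      then have "y +o N' = \<phi> (\<Psi> y +o N)" "\<Psi> y \<in> M"
        using \<phi> into inv(2) coset_eq_iff[OF sub(4)] by metis+
      then show "y +o N' \<in> \<phi> ` (\<lambda>x. x +o N) ` M" by blast
    qed
  qed
  ultimately have "bij_betw \<phi> ((\<lambda>x. x +o N) ` M) ((\<lambda>x. x +o N') ` M')"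
    by (rule bij_betw_imageI)
  moreover have "\<phi> ((x +o N) + (y +o N)) = \<phi> (x +o N) + \<phi> (y +o N)" if "x \<in> M" "y \<in> M" for x y
    using that \<phi> sub lin(1)
    by (simp add: coset_add poly_mapping_module.subspace_add module_hom.add)
  moreover have "\<phi> (\<Union>u\<in>x +o N. (r \<odot> u) +o N) = (\<Union>u\<in>\<phi> (x +o N). (r \<odot> u) +o N')"
    if "x \<in> M" for x r
    using that \<phi> sub lin(1)
    by (simp add: coset_scale poly_mapping_module.subspace_scale module_hom.scale)
  ultimately show ?thesis
    unfolding rmodule_isomorphic_def quotient_module_def by (intro exI[of _ \<phi>]) auto
qed

lemma subspace_free_module:
  fixes B :: "'a set"
  shows "poly_mapping_module.subspace (free_module B :: ('a \<Rightarrow>\<^sub>0 'b::comm_ring_1) set)"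
proof (unfold poly_mapping_module.subspace_def free_module_def, safe)
  fix x y :: "'a \<Rightarrow>\<^sub>0 'b" and i
  assume "Poly_Mapping.keys x \<subseteq> B" "Poly_Mapping.keys y \<subseteq> B" "i \<in> Poly_Mapping.keys (x + y)"
  then show "i \<in> B" using keys_add[of x y] by blast
qed (auto simp: in_keys_iff subset_iff, metis mult_zero_right)

lemma basis_vec_in_free_module [simp]: "basis_vec i \<in> free_module B \<longleftrightarrow> i \<in> B"
  by (simp add: free_module_def)

subsection \<open>Dots on circles\<close>

text \<open>Multiplication by X in the tensor factor at the circle C, written in the basis of
  subsets.\<close>

definition dot_action ::
  "'c \<Rightarrow> ('c set \<Rightarrow>\<^sub>0 'k::field poly poly) \<Rightarrow> ('c set \<Rightarrow>\<^sub>0 'k poly poly)"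
  where "dot_action C = linear_extension (\<lambda>S.
    if C \<in> S then hh \<odot> basis_vec S + tt \<odot> basis_vec (S - {C}) else basis_vec (insert C S))"

lemma linear_map_dot_action [simp, intro]: "linear_map (dot_action C)"
  unfolding dot_action_def by simp

lemmas linear_map_dot_action_compose = linear_map_compose[OF _ linear_map_dot_action]

lemmas dot_action_add [simp] = module_hom.add[OF linear_map_dot_action]
lemmas dot_action_scale [simp] = module_hom.scale[OF linear_map_dot_action]
lemmas dot_action_diff [simp] = module_hom.diff[OF linear_map_dot_action]

lemma dot_action_basis_in:
  "C \<in> S \<Longrightarrow> dot_action C (basis_vec S) = hh \<odot> basis_vec S + tt \<odot> basis_vec (S - {C})"
  by (simp add: dot_action_def)

lemma dot_action_basis_notin:
  "C \<notin> S \<Longrightarrow> dot_action C (basis_vec S) = basis_vec (insert C S)"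
  by (simp add: dot_action_def)

lemmas dot_action_basis = dot_action_basis_in dot_action_basis_notin

text \<open>The tensor power is a commutative algebra. This is what makes the fold over a multiset
  in \<open>dots\<close> independent of the order.\<close>

lemma dot_action_commute: "dot_action C (dot_action C' x) = dot_action C' (dot_action C x)"
proof (rule linear_map_eq[of "\<lambda>x. dot_action C (dot_action C' x)" "\<lambda>x. dot_action C' (dot_action C x)"])
  show "dot_action C (dot_action C' (basis_vec S)) = dot_action C' (dot_action C (basis_vec S))" for S
  proof (cases "C = C'")
    case False
    moreover have "S - {C'} - {C} = S - {C} - {C'}" by blast
    ultimately show ?thesis
      by (cases "C \<in> S"; cases "C' \<in> S")
        (simp_all add: dot_action_basis insert_commute insert_Diff_if
          poly_mapping_module.scale_right_distrib mult.commute add_ac)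
  qed simp
qed (intro linear_map_dot_action_compose linear_map_intros)+

lemma dot_action_twice: "dot_action C (dot_action C x) = hh \<odot> dot_action C x + tt \<odot> x"
proof (rule linear_map_eq[of "\<lambda>x. dot_action C (dot_action C x)" "\<lambda>x. hh \<odot> dot_action C x + tt \<odot> x"])
  show "dot_action C (dot_action C (basis_vec S)) = hh \<odot> dot_action C (basis_vec S) + tt \<odot> basis_vec S" for S
    by (cases "C \<in> S") (auto simp: dot_action_basis insert_absorb)
qed (intro linear_map_dot_action_compose linear_map_intros)+

lemma dot_action_keys:
  assumes "Poly_Mapping.keys x \<subseteq> Pow \<K>" "C \<in> \<K>"
  shows "Poly_Mapping.keys (dot_action C x) \<subseteq> Pow \<K>"
proof -
  have "dot_action C x \<in> free_module (Pow \<K>)"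
  proof (rule linear_map_in_submodule[OF linear_map_dot_action subspace_free_module])
    fix S assume "S \<in> Poly_Mapping.keys x"
    then have "S \<subseteq> \<K>" using assms by auto
    then show "dot_action C (basis_vec S) \<in> free_module (Pow \<K>)"
      using assms(2) by (cases "C \<in> S")
       (auto simp: dot_action_basis intro!: poly_mapping_module.subspace_add[OF subspace_free_module]
          poly_mapping_module.subspace_scale[OF subspace_free_module])
  qed
  then show ?thesis by (simp add: free_module_def)
qed

text \<open>Dots are indexed by points v, and \<open>\<kappa> v\<close> is the circle through v. A
  saddle changes the circles but not the points, so one and the same monomial can be evaluated
  before and after it.\<close>

definition dots :: "('v \<Rightarrow> 'c) \<Rightarrow> 'v multiset \<Rightarrow> ('c set \<Rightarrow>\<^sub>0 'k::field poly poly)"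
  where "dots \<kappa> m = fold_mset (\<lambda>v. dot_action (\<kappa> v)) (basis_vec {}) m"

lemma dots_empty [simp]: "dots \<kappa> {#} = basis_vec {}"
  by (simp add: dots_def)

lemma dots_add_mset [simp]: "dots \<kappa> (add_mset v m) = dot_action (\<kappa> v) (dots \<kappa> m)"
proof -
  interpret comp_fun_commute "\<lambda>v. dot_action (\<kappa> v)"
    by unfold_locales (simp add: fun_eq_iff dot_action_commute)
  show ?thesis by (simp add: dots_def)
qed

lemma dots_cong: "(\<And>v. v \<in># m \<Longrightarrow> \<kappa> v = \<kappa>' v) \<Longrightarrow> dots \<kappa> m = dots \<kappa>' m"
  by (induction m) simp_all

lemma dots_image_mset: "dots \<kappa> (image_mset \<pi> m) = dots (\<lambda>v. \<kappa> (\<pi> v)) m"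
  by (induction m) simp_all

lemma keys_dots: "set_mset m \<subseteq> V \<Longrightarrow> Poly_Mapping.keys (dots \<kappa> m) \<subseteq> Pow (\<kappa> ` V)"
proof (induction m)
  case (add v m)
  then show ?case unfolding dots_add_mset by (intro dot_action_keys) auto
qed simp

text \<open>With one representative point per circle no circle gets a second dot, so nothing is
  reduced. Basis vectors thereby become values of monomials.\<close>

lemma dots_distinct:
  assumes "finite S" "\<And>C. C \<in> S \<Longrightarrow> \<kappa> (\<rho> C) = C"
  shows "dots \<kappa> (image_mset \<rho> (mset_set S)) = basis_vec S"
  using assms by (induction) (auto simp: dot_action_basis)

subsection \<open>Polynomials in dots\<close>

text \<open>A diagram with dots at the points of the multiset \<open>m\<close> is the monomial \<open>m\<close>; products of
  polynomials are products in the polynomial ring over \<open>R\<close> with a variable for each point.\<close>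

type_synonym ('v, 'r) dot_poly = "'v multiset \<Rightarrow>\<^sub>0 'r"
type_synonym 'k point_poly = "(nat, 'k poly poly) dot_poly"

definition var :: "'v \<Rightarrow> ('v, 'k::field poly poly) dot_poly"
  where "var v = basis_vec {#v#}"

text \<open>This is \<Delta>(1), with its two tensor factors placed at u and v.\<close>

definition dual :: "'v \<Rightarrow> 'v \<Rightarrow> ('v, 'k::field poly poly) dot_poly"
  where "dual u v = var u + var v - hh \<odot> 1"

lemma one_eq_basis_vec: "(1 :: ('v, 'r::comm_ring_1) dot_poly) = basis_vec {#}"
  by simp

text \<open>Scalars become factors, so that identities between polynomials in dots can be left to
  \<open>algebra_simps\<close>.\<close>

lemma scale_eq_times: "r \<odot> f = Poly_Mapping.single {#} r * (f :: ('v, 'r::comm_ring_1) dot_poly)"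
  by (simp add: scl_def mult_map_scale_conv_mult)

lemma single_add_mset: "basis_vec (add_mset v m) = var v * (basis_vec m :: ('v, 'k::field poly poly) dot_poly)"
  by (simp add: var_def mult_single)

abbreviation dot_polys :: "'v set \<Rightarrow> ('v, 'k::field poly poly) dot_poly set"
  where "dot_polys V \<equiv> free_module {m. set_mset m \<subseteq> V}"

lemma dot_polys_times [intro]:
  assumes "f \<in> dot_polys V" "g \<in> dot_polys V"
  shows "f * g \<in> dot_polys V"
  using assms keys_mult[of f g] by (fastforce simp: free_module_def)

lemma dot_polys_var [intro]: "v \<in> V \<Longrightarrow> var v \<in> dot_polys V"
  by (simp add: var_def)

lemma dot_polys_one [intro]: "1 \<in> dot_polys V"
  by (simp add: one_eq_basis_vec del: single_one)

lemma dot_polys_dual [intro]: "u \<in> V \<Longrightarrow> v \<in> V \<Longrightarrow> dual u v \<in> dot_polys V"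
  unfolding dual_def
  by (intro poly_mapping_module.subspace_add poly_mapping_module.subspace_diff
      poly_mapping_module.subspace_scale subspace_free_module dot_polys_var dot_polys_one)

lemma dot_polys_prod: "(\<And>e. e \<in> I \<Longrightarrow> g e \<in> dot_polys V) \<Longrightarrow> prod g I \<in> dot_polys V"
  by (induction I rule: infinite_finite_induct) auto

lemma linear_map_times: "linear_map T \<Longrightarrow> linear_map (\<lambda>f. T f * (g :: ('v, 'r::comm_ring_1) dot_poly))"
  by (rule linear_mapI) (simp_all add: module_hom.add module_hom.scale scale_eq_times algebra_simps)

definition eval_dots ::
  "('v \<Rightarrow> 'c) \<Rightarrow> ('v, 'k::field poly poly) dot_poly \<Rightarrow> ('c set \<Rightarrow>\<^sub>0 'k poly poly)"
  where "eval_dots \<kappa> = linear_extension (dots \<kappa>)"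

lemma linear_map_eval_dots [simp, intro]: "linear_map (eval_dots \<kappa>)"
  by (simp add: eval_dots_def)

lemmas eval_dots_add [simp] = module_hom.add[OF linear_map_eval_dots]
lemmas eval_dots_scale [simp] = module_hom.scale[OF linear_map_eval_dots]
lemmas eval_dots_diff [simp] = module_hom.diff[OF linear_map_eval_dots]

lemma eval_dots_basis_vec [simp]: "eval_dots \<kappa> (basis_vec m) = dots \<kappa> m"
  by (simp add: eval_dots_def)

lemma eval_dots_one [simp]: "eval_dots \<kappa> 1 = basis_vec {}"
  using eval_dots_basis_vec[of \<kappa> "{#}"] by simp

text \<open>The substitute for multiplicativity: the tensor power is given no product here, only the
  operators \<open>dot_action\<close>.\<close>

lemma eval_dots_var: "eval_dots \<kappa> (var v * f) = dot_action (\<kappa> v) (eval_dots \<kappa> f)"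
proof (rule linear_map_eq[of "\<lambda>f. eval_dots \<kappa> (var v * f)" "\<lambda>f. dot_action (\<kappa> v) (eval_dots \<kappa> f)"])
  show "linear_map (\<lambda>f. eval_dots \<kappa> (var v * f))"
    using linear_map_compose[OF linear_map_times[OF poly_mapping_module.module_hom_ident] linear_map_eval_dots]
    by (simp add: mult.commute[of "var v"])
  show "eval_dots \<kappa> (var v * basis_vec m) = dot_action (\<kappa> v) (eval_dots \<kappa> (basis_vec m))" for m
    by (simp add: single_add_mset[symmetric])
qed (intro linear_map_dot_action_compose linear_map_eval_dots)

lemma eval_dots_dual: "eval_dots \<kappa> (dual u v * f)
    = dot_action (\<kappa> u) (eval_dots \<kappa> f) + dot_action (\<kappa> v) (eval_dots \<kappa> f) - hh \<odot> eval_dots \<kappa> f"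
proof -
  have "dual u v * f = var u * f + var v * f - hh \<odot> f"
    by (simp add: dual_def scale_eq_times algebra_simps)
  then show ?thesis by (simp add: eval_dots_var)
qed

lemma eval_dots_cong:
  assumes "f \<in> dot_polys V" "\<And>v. v \<in> V \<Longrightarrow> \<kappa> v = \<kappa>' v"
  shows "eval_dots \<kappa> f = eval_dots \<kappa>' f"
  by (rule linear_map_eq_on_keys)
    (use assms in \<open>auto simp: free_module_def intro!: dots_cong\<close>)

text \<open>The values of polynomials form a cyclic module over the ring of dots, generated by
  \<open>basis_vec {}\<close>. A map that commutes with dots is therefore determined by the image of
  this generator, which contributes the factor \<open>g\<close>. Commutation matters only on circles
  that some point of \<open>V\<close> meets.\<close>

lemma linear_map_eval_dots_intertwine:
  assumes "linear_map T" "f \<in> dot_polys V"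
    and "T (basis_vec {}) = eval_dots \<kappa>' g"
    and "\<And>v S. v \<in> V \<Longrightarrow> S \<subseteq> \<kappa> ` V \<Longrightarrow>
      T (dot_action (\<kappa> v) (basis_vec S)) = dot_action (\<kappa>' v) (T (basis_vec S))"
  shows "T (eval_dots \<kappa> f) = eval_dots \<kappa>' (f * g)"
proof (rule linear_map_eq_on_keys[of "\<lambda>f. T (eval_dots \<kappa> f)" "\<lambda>f. eval_dots \<kappa>' (f * g)"])
  show "linear_map (\<lambda>f. eval_dots \<kappa>' (f * g))"
    by (intro linear_map_compose[OF _ linear_map_eval_dots] linear_map_times
        poly_mapping_module.module_hom_ident)
  show "linear_map (\<lambda>f. T (eval_dots \<kappa> f))"
    by (rule linear_map_compose) (use assms(1) in auto)
  fix m assume "m \<in> Poly_Mapping.keys f"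
  then have "set_mset m \<subseteq> V" using assms(2) by (auto simp: free_module_def)
  then show "T (eval_dots \<kappa> (basis_vec m)) = eval_dots \<kappa>' (basis_vec m * g)"
  proof (induction m)
    case empty
    then show ?case using assms(3) by simp
  next
    case (add v m)
    have "T (dot_action (\<kappa> v) (dots \<kappa> m)) = dot_action (\<kappa>' v) (T (dots \<kappa> m))"
    proof (rule linear_map_eq_on_keys[of "\<lambda>x. T (dot_action (\<kappa> v) x)" "\<lambda>x. dot_action (\<kappa>' v) (T x)"])
      fix S assume "S \<in> Poly_Mapping.keys (dots \<kappa> m)"
      then have "S \<subseteq> \<kappa> ` V" using keys_dots[of m V \<kappa>] add.prems by auto
      then show "T (dot_action (\<kappa> v) (basis_vec S)) = dot_action (\<kappa>' v) (T (basis_vec S))"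
        using add.prems assms(4) by auto
    qed (use assms(1) in \<open>auto intro: linear_map_compose[OF linear_map_dot_action] linear_map_dot_action_compose\<close>)
    then show ?case
      using add.IH add.prems by (simp add: single_add_mset mult.assoc eval_dots_var)
  qed
qed

text \<open>Injectivity keeps dots on different circles apart; if two circles were identified, their
  two labels X would collapse to a single one.\<close>

lemma eval_dots_rename_circles:
  assumes "f \<in> dot_polys V" "inj_on \<rho> (\<kappa> ` V)"
  shows "linear_extension (\<lambda>S. basis_vec (\<rho> ` S)) (eval_dots \<kappa> f) = eval_dots (\<lambda>v. \<rho> (\<kappa> v)) f"
proof -
  have "linear_extension (\<lambda>S. basis_vec (\<rho> ` S)) (eval_dots \<kappa> f)
      = eval_dots (\<lambda>v. \<rho> (\<kappa> v)) (f * 1)"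
  proof (rule linear_map_eval_dots_intertwine[OF linear_map_extension assms(1)])
    fix v S assume vS: "v \<in> V" "S \<subseteq> \<kappa> ` V"
    then have "\<rho> (\<kappa> v) \<in> \<rho> ` S \<longleftrightarrow> \<kappa> v \<in> S"
      using assms(2) by (meson image_eqI inj_on_image_mem_iff)
    moreover have "\<rho> ` (S - {\<kappa> v}) = \<rho> ` S - {\<rho> (\<kappa> v)}" if "\<kappa> v \<in> S"
      using inj_on_image_set_diff[OF assms(2), of S "{\<kappa> v}"] vS by auto
    ultimately show "linear_extension (\<lambda>S. basis_vec (\<rho> ` S)) (dot_action (\<kappa> v) (basis_vec S))
        = dot_action (\<rho> (\<kappa> v)) (linear_extension (\<lambda>S. basis_vec (\<rho> ` S)) (basis_vec S))"
      by (cases "\<kappa> v \<in> S") (simp_all add: dot_action_basis)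
  qed (simp add: one_eq_basis_vec del: single_one)
  then show ?thesis by simp
qed

text \<open>A substitution of variables, applied later to forget on which of the two lines a point
  lies.\<close>

definition rename_points :: "('u \<Rightarrow> 'v) \<Rightarrow> ('u, 'k::field poly poly) dot_poly \<Rightarrow> ('v, 'k poly poly) dot_poly"
  where "rename_points \<pi> = linear_extension (\<lambda>m. basis_vec (image_mset \<pi> m))"

lemma linear_map_rename_points [simp, intro]: "linear_map (rename_points \<pi>)"
  by (simp add: rename_points_def)

lemma rename_points_times: "rename_points \<pi> (f * g) = rename_points \<pi> f * rename_points \<pi> g"
proof (rule linear_map_eq[of "\<lambda>f. rename_points \<pi> (f * g)" "\<lambda>f. rename_points \<pi> f * rename_points \<pi> g"])
  fix m
  show "rename_points \<pi> (basis_vec m * g) = rename_points \<pi> (basis_vec m) * rename_points \<pi> g"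
  proof (rule linear_map_eq[of "\<lambda>g. rename_points \<pi> (basis_vec m * g)" "\<lambda>g. rename_points \<pi> (basis_vec m) * rename_points \<pi> g"])
    show "linear_map (\<lambda>g. rename_points \<pi> (basis_vec m * g))"
      using linear_map_compose[OF linear_map_times[OF poly_mapping_module.module_hom_ident] linear_map_rename_points]
      by (simp add: mult.commute[of "basis_vec m"])
    show "linear_map (\<lambda>g. rename_points \<pi> (basis_vec m) * rename_points \<pi> g)"
      using linear_map_times[OF linear_map_rename_points]
      by (simp add: mult.commute[of "rename_points \<pi> (basis_vec m)"])
  qed (simp add: rename_points_def mult_single)
qed (intro linear_map_compose[OF linear_map_times linear_map_rename_points]
      linear_map_times linear_map_rename_points poly_mapping_module.module_hom_ident)+

lemma rename_points_one [simp]: "rename_points \<pi> 1 = 1"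
  by (simp add: rename_points_def one_eq_basis_vec del: single_one)

lemma rename_points_dual [simp]: "rename_points \<pi> (dual u v) = dual (\<pi> u) (\<pi> v)"
  by (simp add: dual_def module_hom.add[OF linear_map_rename_points]
      module_hom.diff[OF linear_map_rename_points] module_hom.scale[OF linear_map_rename_points])
    (simp add: rename_points_def var_def)

lemma rename_points_prod: "rename_points \<pi> (prod g I) = (\<Prod>e\<in>I. rename_points \<pi> (g e))"
  by (induction I rule: infinite_finite_induct) (simp_all add: rename_points_times)

lemma eval_dots_rename_points: "eval_dots \<kappa> (rename_points \<pi> f) = eval_dots (\<lambda>v. \<kappa> (\<pi> v)) f"
  by (rule linear_map_eq[of "\<lambda>f. eval_dots \<kappa> (rename_points \<pi> f)"])
    (auto simp: rename_points_def dots_image_mset intro: linear_map_compose)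

subsection \<open>Saddles act on dots\<close>

lemma merge_map_basis:
  assumes "P \<noteq> Q" "P \<notin> U" "Q \<notin> U"
  shows "merge_map P Q Z U = basis_vec U"
    and "merge_map P Q Z (insert P U) = basis_vec (insert Z U)"
    and "merge_map P Q Z (insert Q U) = basis_vec (insert Z U)"
    and "merge_map P Q Z (insert P (insert Q U)) = hh \<odot> basis_vec (insert Z U) + tt \<odot> basis_vec U"
  using assms by (simp_all add: merge_map_def insert_Diff_if)

lemma split_map_basis:
  assumes "P \<notin> U"
  shows "split_map P Y Z U = basis_vec (insert Y U) + basis_vec (insert Z U) - hh \<odot> basis_vec U"
    and "split_map P Y Z (insert P U) = basis_vec (insert Y (insert Z U)) + tt \<odot> basis_vec U"
  using assms by (simp_all add: split_map_def)

text \<open>Multiplication sends 1 to 1 and is linear over dots on either factor. The name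
  \<open>Z\<close> has to be new: otherwise the label of the merged circle would be confused with
  that of an old one.\<close>

lemma eval_dots_merge:
  assumes "P \<noteq> Q" "Z \<notin> range \<kappa>"
    and "\<And>v. \<kappa> v \<in> {P, Q} \<Longrightarrow> \<kappa>' v = Z"
    and "\<And>v. \<kappa> v \<notin> {P, Q} \<Longrightarrow> \<kappa>' v = \<kappa> v"
  shows "linear_extension (merge_map P Q Z) (eval_dots \<kappa> f) = eval_dots \<kappa>' f"
proof -
  have "linear_extension (merge_map P Q Z) (eval_dots \<kappa> f) = eval_dots \<kappa>' (f * 1)"
  proof (rule linear_map_eval_dots_intertwine[where V = UNIV])
    fix v S assume "S \<subseteq> \<kappa> ` UNIV"
    then have Z: "Z \<notin> S" "Z \<noteq> \<kappa> v" using assms(2) by auto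
    show "linear_extension (merge_map P Q Z) (dot_action (\<kappa> v) (basis_vec S))
        = dot_action (\<kappa>' v) (linear_extension (merge_map P Q Z) (basis_vec S))"
    proof -
      let ?C = "\<kappa> v"
      \<comment> \<open>\<open>U\<close> collects the labels on circles that do not take part in the
        merge, which leaves four possibilities for S.\<close>
      define U where "U = S - {P, Q}"
      have U: "P \<notin> U" "Q \<notin> U" "Z \<notin> U" using Z by (auto simp: U_def)
      have S: "S = U \<or> S = insert P U \<or> S = insert Q U \<or> S = insert P (insert Q U)"
        by (auto simp: U_def)
      note simps = merge_map_basis[OF assms(1) U(1,2)] dot_action_basis insert_Diff_if
        poly_mapping_module.scale_right_distrib add_ac mult.commute[of hh tt]
      consider "?C = P" | "?C = Q" | "?C \<noteq> P" "?C \<noteq> Q" "?C \<in> U" | "?C \<noteq> P" "?C \<noteq> Q" "?C \<notin> U"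
        by blast
      then show ?thesis
      proof cases
        case 1
        then have "\<kappa>' v = Z" using assms(3) by simp
        with 1 S U assms(1) show ?thesis by (elim disjE) (simp_all add: simps insert_commute[of Q P])
      next
        case 2
        then have "\<kappa>' v = Z" using assms(3) by simp
        with 2 S U assms(1) show ?thesis by (elim disjE) (simp_all add: simps insert_commute[of Q P])
      next
        case 3
        then have \<kappa>': "\<kappa>' v = ?C" using assms(4) by simp
        have V: "P \<notin> U - {?C}" "Q \<notin> U - {?C}" using U by auto
        from 3 S U assms(1) Z(2) \<kappa>' show ?thesis
          by (elim disjE) (simp_all add: simps merge_map_basis[OF assms(1) V] insert_absorb)
      next
        case 4
        then have \<kappa>': "\<kappa>' v = ?C" using assms(4) by simp
        have V: "P \<notin> insert ?C U" "Q \<notin> insert ?C U" using U 4 by auto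
        from 4 S U assms(1) Z(2) \<kappa>' show ?thesis
          by (elim disjE) (simp_all add: simps merge_map_basis[OF assms(1) V] insert_commute[of ?C])
      qed
    qed
  qed (use assms(1) in \<open>simp_all add: one_eq_basis_vec merge_map_def free_module_def del: single_one\<close>)
  then show ?thesis by simp
qed

text \<open>Comultiplication is a map of modules over the algebra, so a dot on \<open>P\<close> may
  go to either new circle, and \<open>\<kappa>'\<close> tells to which. The unit goes to
  \<Delta>(1), expressed by any point u on \<open>Y\<close> and any point w on
  \<open>Z\<close>.\<close>

lemma eval_dots_split:
  assumes "Y \<noteq> Z" "Y \<notin> range \<kappa>" "Z \<notin> range \<kappa>" "\<kappa>' u = Y" "\<kappa>' w = Z"
    and "\<And>v. \<kappa> v = P \<Longrightarrow> \<kappa>' v \<in> {Y, Z}"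
    and "\<And>v. \<kappa> v \<noteq> P \<Longrightarrow> \<kappa>' v = \<kappa> v"
  shows "linear_extension (split_map P Y Z) (eval_dots \<kappa> f) = eval_dots \<kappa>' (f * dual u w)"
proof (rule linear_map_eval_dots_intertwine[where V = UNIV])
  show "linear_extension (split_map P Y Z) (basis_vec {}) = eval_dots \<kappa>' (dual u w)"
    by (subst mult_1_right[of "dual u w", symmetric], subst eval_dots_dual)
      (use assms(4,5) in \<open>simp add: split_map_def dot_action_basis add_ac\<close>)
  fix v S assume "S \<subseteq> \<kappa> ` UNIV"
  then have Z: "Z \<notin> S" "Y \<notin> S" "Z \<noteq> \<kappa> v" "Y \<noteq> \<kappa> v" using assms(2,3) by auto
  define U where "U = S - {P}"
  have U: "P \<notin> U" "Y \<notin> U" "Z \<notin> U" using Z by (auto simp: U_def)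
  have S: "S = U \<or> S = insert P U" by (auto simp: U_def)
  let ?C = "\<kappa> v"
  note simps = split_map_basis[OF U(1)] dot_action_basis insert_Diff_if
    poly_mapping_module.scale_right_distrib poly_mapping_module.scale_right_diff_distrib
    add_ac mult.commute[of hh tt]
  consider "?C = P" | "?C \<noteq> P" "?C \<in> U" | "?C \<noteq> P" "?C \<notin> U" by blast
  then show "linear_extension (split_map P Y Z) (dot_action ?C (basis_vec S))
      = dot_action (\<kappa>' v) (linear_extension (split_map P Y Z) (basis_vec S))"
  proof cases
    case 1
    have YZ: "insert Y (insert Z U) - {Y} = insert Z U" "insert Z (insert Y U) - {Y} = insert Z U"
      "insert Y (insert Z U) - {Z} = insert Y U" "insert Z U - {Z} = U" "insert Y U - {Y} = U"
      "Y \<in> insert Y (insert Z U)" "Z \<in> insert Y (insert Z U)" "insert Z (insert Y U) = insert Y (insert Z U)"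
      using assms(1) U by auto
    from 1 assms(6) consider "\<kappa>' v = Y" | "\<kappa>' v = Z" by blast
    then show ?thesis
      using 1 S U assms(1)
      by cases (elim disjE; simp add: simps YZ)+
  next
    case 2
    then have \<kappa>': "\<kappa>' v = ?C" using assms(7) by simp
    have V: "P \<notin> U - {?C}" using U by auto
    from 2 S U Z(3,4) \<kappa>' show ?thesis
      by (elim disjE) (simp_all add: simps split_map_basis[OF V] insert_absorb)
  next
    case 3
    then have \<kappa>': "\<kappa>' v = ?C" using assms(7) by simp
    have V: "P \<notin> insert ?C U" using U 3 by auto
    from 3 S U Z(3,4) \<kappa>' show ?thesis
      by (elim disjE) (simp_all add: simps split_map_basis[OF V] insert_commute[of ?C])
  qed
qed (simp_all add: free_module_def)

subsection \<open>Components\<close>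

lemma component_refl [simp, intro]: "p \<in> component E p"
  by (simp add: component_def)

lemma component_edge_iff: "(x, y) \<in> E \<Longrightarrow> x \<in> component E p \<longleftrightarrow> y \<in> component E p"
  unfolding component_def
  by (auto intro: rtrancl_into_rtrancl)

lemma component_least:
  assumes "p \<in> K" "\<And>x y. (x, y) \<in> E \<Longrightarrow> x \<in> K \<longleftrightarrow> y \<in> K"
  shows "component E p \<subseteq> K"
proof
  fix q assume "q \<in> component E p"
  then have "(p, q) \<in> (E \<union> E\<inverse>)\<^sup>*" by (simp add: component_def)
  then show "q \<in> K" by induction (use assms in auto)
qed

lemma component_subset:
  assumes "q \<in> component E p" shows "component E q \<subseteq> component E p"
  by (rule component_least[OF assms component_edge_iff])

lemma component_sym: "q \<in> component E p \<longleftrightarrow> p \<in> component E q"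
proof -
  have "sym ((E \<union> E\<inverse>)\<^sup>*)" by (intro sym_rtrancl sym_Un_converse)
  then show ?thesis by (auto simp: component_def dest: symD)
qed

lemma component_eq_iff: "component E p = component E q \<longleftrightarrow> q \<in> component E p"
proof
  show "component E p = component E q" if "q \<in> component E p"
    using component_subset[OF that] component_subset[of p E q] that component_sym[of q E p] by auto
qed (use component_refl[of q E] in simp)

lemma component_eq: "q \<in> component E p \<Longrightarrow> component E q = component E p"
  by (metis component_eq_iff)

lemma component_disjoint: "q \<notin> component E p \<Longrightarrow> component E p \<inter> component E q = {}"
  using component_eq[of _ E p] component_eq[of _ E q] component_refl[of q E] by blast

lemma component_edge: "(x, y) \<in> E \<Longrightarrow> component E x = component E y"
  using component_edge_iff[of x y E x] by (simp add: component_eq_iff)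

lemma component_mono: "E \<subseteq> F \<Longrightarrow> component E p \<subseteq> component F p"
  by (rule component_least[OF component_refl component_edge_iff]) blast

lemma component_image:
  assumes "\<And>x y. (x, y) \<in> E \<Longrightarrow> f x = f y \<or> (f x, f y) \<in> F \<or> (f y, f x) \<in> F"
  shows "f ` component E p \<subseteq> component F (f p)"
proof -
  have "component E p \<subseteq> f -` component F (f p)"
  proof (rule component_least)
    fix x y assume "(x, y) \<in> E"
    from assms[OF this] show "x \<in> f -` component F (f p) \<longleftrightarrow> y \<in> f -` component F (f p)"
      unfolding vimage_eq by (elim disjE) (simp_all add: component_edge_iff)
  qed simp
  then show ?thesis by auto
qed

lemma component_insert:
  "component (insert (i, j) E) x =
    (if x \<in> component E i \<union> component E j then component E i \<union> component E j else component E x)"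
proof (cases "x \<in> component E i \<union> component E j")
  case True
  let ?F = "insert (i, j) E"
  have "component ?F x \<subseteq> component E i \<union> component E j"
  proof (rule component_least[OF True])
    fix y z assume "(y, z) \<in> ?F"
    then show "y \<in> component E i \<union> component E j \<longleftrightarrow> z \<in> component E i \<union> component E j"
      using component_edge_iff[of y z E i] component_edge_iff[of y z E j] by auto
  qed
  moreover have sub: "component E y \<subseteq> component ?F y" for y
    by (rule component_mono) auto
  moreover have "component ?F i = component ?F j" by (rule component_edge) simp
  moreover from this have "component ?F x = component ?F i"
    using True sub[of i] sub[of j] component_eq[of x ?F i] component_eq[of x ?F j] by auto
  ultimately show ?thesis using True sub[of i] sub[of j] by auto
next
  case False
  have "i \<notin> component E x" "j \<notin> component E x"
    using False component_sym[of x E i] component_sym[of x E j] by auto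
  have "component (insert (i, j) E) x \<subseteq> component E x"
  proof (rule component_least)
    fix y z assume "(y, z) \<in> insert (i, j) E"
    then show "y \<in> component E x \<longleftrightarrow> z \<in> component E x"
      using component_edge_iff[of y z E x] \<open>i \<notin> component E x\<close> \<open>j \<notin> component E x\<close> by auto
  qed simp
  then show ?thesis using False component_mono[of E "insert (i, j) E" x] by auto
qed

subsection \<open>Alternating paths\<close>

text \<open>Remove a point together with its partner: symmetry and uniqueness keep the remaining
  points matched among themselves.\<close>

lemma even_card_if_matched:
  assumes "finite K" "symp A" "\<And>x y z. A x y \<Longrightarrow> A x z \<Longrightarrow> y = z" "\<And>x. \<not> A x x"
    and "\<And>x. x \<in> K \<Longrightarrow> \<exists>y\<in>K. A x y"
  shows "even (card K)"
  using assms(1,5)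
proof (induction K rule: finite_psubset_induct)
  case (psubset K)
  show ?case
  proof (cases "K = {}")
    case False
    then obtain x y where xy: "x \<in> K" "y \<in> K" "A x y" using psubset.prems by blast
    then have "x \<noteq> y" using assms(4) by auto
    have "\<exists>w\<in>K - {x, y}. A z w" if "z \<in> K - {x, y}" for z
    proof -
      obtain w where "w \<in> K" "A z w" using psubset.prems \<open>z \<in> K - {x, y}\<close> by blast
      moreover have "w \<noteq> x" "w \<noteq> y"
        using \<open>A z w\<close> xy(3) \<open>z \<in> K - {x, y}\<close> assms(2,3) by (metis Diff_iff insertCI sympE)+
      ultimately show ?thesis by blast
    qed
    then have "even (card (K - {x, y}))" using psubset.IH[of "K - {x, y}"] xy by blast
    moreover have "card K = card (K - {x, y}) + 2"
      using card_mono[of K "{x, y}"] psubset.hyps xy \<open>x \<noteq> y\<close> by (simp add: card_Diff_subset)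
    ultimately show ?thesis by simp
  qed simp
qed

text \<open>Walking from \<open>u\<close> along \<open>A\<close> and \<open>R\<close> alternately is deterministic in both directions, so the
  walk visits the whole component of \<open>u\<close> and can only stop at one further point.\<close>

lemma at_most_two_ends:
  fixes u v w :: 'v
  assumes A: "symp A" "\<And>x y z. A x y \<Longrightarrow> A x z \<Longrightarrow> y = z"
    and R: "symp R" "\<And>x y z. R x y \<Longrightarrow> R x z \<Longrightarrow> y = z"
    and E: "\<And>x y. (x, y) \<in> E \<Longrightarrow> A x y \<or> R x y"
    and ends: "\<And>x. \<not> R u x" "\<And>x. \<not> R v x" "\<And>x. \<not> R w x"
    and conn: "v \<in> component E u" "w \<in> component E u"
    and "u \<noteq> v" "u \<noteq> w"
  shows "v = w"
proof -
  \<comment> \<open>The flag in a state is the relation to be followed next, \<open>A\<close> for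
    \<open>True\<close> and \<open>R\<close> for \<open>False\<close>. The walk starts with
    \<open>A\<close> because u has no partner under \<open>R\<close>.\<close>
  define W where "W = {((x, True), (y, False)) | x y. A x y} \<union> {((x, False), (y, True)) | x y. R x y}"
  define K where "K = {x. \<exists>s. ((u, True), (x, s)) \<in> W\<^sup>*}"
  have W_iff: "((x, s), (y, s')) \<in> W \<longleftrightarrow> s' = (\<not> s) \<and> (if s then A x y else R x y)" for x y s s'
    by (auto simp: W_def)
  have closed: "x \<in> K \<Longrightarrow> y \<in> K" if "A x y \<or> R x y" for x y
  proof -
    assume "x \<in> K"
    then obtain s where s: "((u, True), (x, s)) \<in> W\<^sup>*" by (auto simp: K_def)
    show "y \<in> K"
    proof (cases "if s then A x y else R x y")
      case True
      then have "((x, s), (y, \<not> s)) \<in> W" by (auto simp: W_iff split: if_splits)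
      then show ?thesis using s unfolding K_def by (blast intro: rtrancl_into_rtrancl)
    next
      case False
      \<comment> \<open>The edge is not the one due next, so it is the one by which the walk
        arrived, and y is the previous point. At the start this is impossible, as u has no partner
        under \<open>R\<close>.\<close>
      then have xy: "if s then R x y else A x y" using that by (auto split: if_splits)
      from s show ?thesis
      proof (cases rule: rtranclE)
        case base
        then show ?thesis using xy ends by simp
      next
        case (step p)
        then obtain z s' where p: "p = (z, s')" by (cases p)
        with step have "s' = (\<not> s)" "if s then R z x else A z x" by (auto simp: W_iff split: if_splits)
        then have "z = y" using xy A R by (metis sympE)
        then show ?thesis using step p by (auto simp: K_def)
      qed
    qed
  qed
  have comp: "component E u \<subseteq> K"
  proof (rule component_least)
    show "u \<in> K" by (auto simp: K_def)
    show "x \<in> K \<longleftrightarrow> y \<in> K" if "(x, y) \<in> E" for x y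
      using closed[of x y] closed[of y x] E[OF that] sympD[OF A(1)] sympD[OF R(1)] by blast
  qed
  \<comment> \<open>A further end cannot be entered along \<open>R\<close>. It is therefore always
    entered along \<open>A\<close>, that is, with flag \<open>False\<close>.\<close>
  have sink: "((u, True), (x, False)) \<in> W\<^sup>*" if x: "x \<in> component E u" "x \<noteq> u" "\<And>y. \<not> R x y" for x
  proof -
    obtain s where s: "((u, True), (x, s)) \<in> W\<^sup>*"
      using comp x(1) by (auto simp: K_def)
    have "\<not> s"
    proof
      assume s
      with s x(2) obtain z s' where "((z, s'), (x, True)) \<in> W" by (auto elim: rtranclE)
      then show False using x(3) R(1) by (auto simp: W_iff dest: sympD split: if_splits)
    qed
    then show ?thesis using s by simp
  qed
  \<comment> \<open>Determinism makes the walks from u to v and to w comparable: one continues the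
    other. But a state with flag \<open>False\<close> at an end has no successor, so the two ends
    coincide.\<close>
  have "single_valued W"
    using A(2) R(2) by (auto simp: single_valued_def W_iff split: if_splits)
  then have "((v, False), (w, False)) \<in> W\<^sup>* \<or> ((w, False), (v, False)) \<in> W\<^sup>*"
    using single_valued_confluent sink[of v] sink[of w] assms by metis
  moreover have "x = y" if "((x, False), (y, False)) \<in> W\<^sup>*" "\<And>z. \<not> R x z" for x y
    using that(1)
  proof (cases rule: converse_rtranclE)
    case (step p)
    then show ?thesis using that(2) by (cases p) (auto simp: W_iff)
  qed simp
  ultimately show ?thesis using ends by blast
qed

subsection \<open>Crossingless matchings\<close>

definition mate :: "matching \<Rightarrow> nat \<Rightarrow> nat \<Rightarrow> bool"
  where "mate m p q \<longleftrightarrow> (p, q) \<in> m \<or> (q, p) \<in> m"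

lemma mate_sym: "mate m p q \<longleftrightarrow> mate m q p"
  by (auto simp: mate_def)

lemma symp_mate: "symp (mate m)"
  by (auto intro: sympI simp: mate_sym)

lemma crossinglessD:
  assumes "m \<in> crossingless_matchings n"
  shows "(i, j) \<in> m \<Longrightarrow> 1 \<le> i \<and> i < j \<and> j \<le> 2 * n"
    and "p \<in> {1..2 * n} \<Longrightarrow> \<exists>q. mate m p q"
    and "mate m p q \<Longrightarrow> mate m p q' \<Longrightarrow> q = q'"
    and "(i, j) \<in> m \<Longrightarrow> (k, l) \<in> m \<Longrightarrow> \<not> (i < k \<and> k < j \<and> j < l)"
    and "finite m"
    and "mate m p q \<Longrightarrow> p \<in> {1..2 * n} \<and> q \<in> {1..2 * n}"
proof -
  show arc: "1 \<le> i \<and> i < j \<and> j \<le> 2 * n" if "(i, j) \<in> m" for i j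
    using assms that by (auto simp: crossingless_matchings_def)
  then show in_range: "p \<in> {1..2 * n} \<and> q \<in> {1..2 * n}" if "mate m p q" for p q
    using that by (force simp: mate_def)
  have ex1: "\<exists>!e. e \<in> m \<and> (p = fst e \<or> p = snd e)" if "p \<in> {1..2 * n}" for p
    using assms that by (auto simp: crossingless_matchings_def)
  then show "\<exists>q. mate m p q" if "p \<in> {1..2 * n}"
    using that unfolding mate_def by (metis prod.collapse)
  show "q = q'" if q: "mate m p q" "mate m p q'"
  proof -
    have p: "p \<in> {1..2 * n}" using in_range q by blast
    obtain e e' where e: "e \<in> m" "p = fst e \<or> p = snd e" "e = (p, q) \<or> e = (q, p)"
      "e' \<in> m" "p = fst e' \<or> p = snd e'" "e' = (p, q') \<or> e' = (q', p)"
      using q unfolding mate_def by fastforce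
    then have "e = e'" using ex1[OF p] by blast
    then show ?thesis using e arc by (cases e) fastforce
  qed
  show "\<not> (i < k \<and> k < j \<and> j < l)" if "(i, j) \<in> m" "(k, l) \<in> m"
  proof -
    have "\<forall>(i, j)\<in>m. \<forall>(k, l)\<in>m. \<not> (i < k \<and> k < j \<and> j < l)"
      using assms by (simp add: crossingless_matchings_def)
    then show ?thesis using that by blast
  qed
  have "m \<subseteq> {1..2 * n} \<times> {1..2 * n}" using arc by force
  then show "finite m" by (rule finite_subset) simp
qed

lemma crossinglessI:
  assumes "\<And>i j. (i, j) \<in> m \<Longrightarrow> 1 \<le> i \<and> i < j \<and> j \<le> 2 * n"
    and "\<And>p. p \<in> {1..2 * n} \<Longrightarrow> \<exists>q. mate m p q"
    and "\<And>p q q'. mate m p q \<Longrightarrow> mate m p q' \<Longrightarrow> q = q'"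
    and "\<And>i j k l. (i, j) \<in> m \<Longrightarrow> (k, l) \<in> m \<Longrightarrow> \<not> (i < k \<and> k < j \<and> j < l)"
  shows "m \<in> crossingless_matchings n"
proof -
  have "\<exists>!e. e \<in> m \<and> (p = fst e \<or> p = snd e)" if p: "p \<in> {1..2 * n}" for p
  proof -
    obtain q where "mate m p q" using assms(2) p by blast
    then obtain e where e: "e \<in> m" "p = fst e \<or> p = snd e" "e = (p, q) \<or> e = (q, p)"
      by (auto simp: mate_def)
    show ?thesis
    proof (rule ex1I[of _ e])
      fix e' assume e': "e' \<in> m \<and> (p = fst e' \<or> p = snd e')"
      then obtain q' where q': "e' = (p, q') \<or> e' = (q', p)" by (metis prod.collapse)
      then have "mate m p q'" using e' by (auto simp: mate_def)
      then have "q' = q" using assms(3) \<open>mate m p q\<close> by blast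
      then show "e' = e" using q' e e' assms(1) by (metis less_asym)
    qed (use e in simp)
  qed
  moreover have "m \<subseteq> {(i, j). 1 \<le> i \<and> i < j \<and> j \<le> 2 * n}" using assms(1) by blast
  moreover have "\<forall>(i, j)\<in>m. \<forall>(k, l)\<in>m. \<not> (i < k \<and> k < j \<and> j < l)" using assms(4) by blast
  ultimately show ?thesis unfolding crossingless_matchings_def by simp
qed

lemma component_matching:
  assumes "m \<in> crossingless_matchings n" "mate m p q"
  shows "component m p = {p, q}"
proof
  show "component m p \<subseteq> {p, q}"
  proof (rule component_least)
    fix x y assume "(x, y) \<in> m"
    then have "mate m x y" "mate m y x" by (auto simp: mate_def)
    then show "x \<in> {p, q} \<longleftrightarrow> y \<in> {p, q}"
      using crossinglessD(3)[OF assms(1)] assms(2) mate_sym by blast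
  qed simp
  show "{p, q} \<subseteq> component m p"
    using assms(2) component_edge_iff[of p q m p] component_edge_iff[of q p m p] by (auto simp: mate_def)
qed

lemma component_in_range:
  assumes "a \<in> crossingless_matchings n" "b \<in> crossingless_matchings n" "p \<in> {1..2 * n}"
  shows "component (a \<union> b) p \<subseteq> {1..2 * n}"
proof (rule component_least[OF assms(3)])
  fix x y assume "(x, y) \<in> a \<union> b"
  then have "mate a x y \<or> mate b x y" by (auto simp: mate_def)
  then show "x \<in> {1..2 * n} \<longleftrightarrow> y \<in> {1..2 * n}"
    using crossinglessD(6)[OF assms(1)] crossinglessD(6)[OF assms(2)] by blast
qed

subsection \<open>Saddles between mirror images\<close>

abbreviation endpoints :: "matching \<Rightarrow> nat set"
  where "endpoints m \<equiv> fst ` m \<union> snd ` m"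

lemma endpoints_iff_mate: "p \<in> endpoints m \<longleftrightarrow> (\<exists>q. mate m p q)"
  by (force simp: mate_def)

lemma stacked_edges [simp]:
  "(Inl x, Inl y) \<in> stacked d a rem don \<longleftrightarrow> (x, y) \<in> a \<union> rem"
  "(Inr x, Inr y) \<in> stacked d a rem don \<longleftrightarrow> (x, y) \<in> d \<union> rem"
  "(Inl x, Inr y) \<in> stacked d a rem don \<longleftrightarrow> x = y \<and> x \<in> endpoints don"
  "(Inr x, Inl y) \<notin> stacked d a rem don"
  by (auto simp: stacked_def)

definition mirror_component :: "matching \<Rightarrow> nat set \<Rightarrow> nat + nat \<Rightarrow> (nat + nat) set"
  where "mirror_component G W v = (case v of
      Inl x \<Rightarrow> Inl ` component G x \<union> (if component G x \<inter> W = {} then {} else Inr ` component G x)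
    | Inr x \<Rightarrow> Inr ` component G x \<union> (if component G x \<inter> W = {} then {} else Inl ` component G x))"

text \<open>Edges within a line project to edges of \<open>a \<union> rem\<close> and vertical
  segments project to points, so every circle projects onto one component. Each copy of that
  component is connected, hence a single vertical segment suffices to join the two.\<close>

lemma component_stacked_mirror:
  "component (stacked a a rem don) = mirror_component (a \<union> rem) (endpoints don)"
proof
  fix v
  let ?E = "stacked a a rem don" and ?G = "a \<union> rem" and ?W = "endpoints don"
  have inl: "Inl ` component ?G x \<subseteq> component ?E (Inl x)" for x
    by (rule component_image) simp
  have inr: "Inr ` component ?G x \<subseteq> component ?E (Inr x)" for x
    by (rule component_image) simp
  have vert: "component ?E (Inl w) = component ?E (Inr w)" if "w \<in> ?W" for w
    by (rule component_edge) (use that in simp)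
  have sub: "component ?E (f x) \<subseteq> Inl ` component ?G x \<union> Inr ` component ?G x"
    if "f = Inl \<or> f = Inr" for x and f :: "nat \<Rightarrow> nat + nat"
  proof (rule component_least)
    fix y z assume "(y, z) \<in> ?E"
    then show "y \<in> Inl ` component ?G x \<union> Inr ` component ?G x
        \<longleftrightarrow> z \<in> Inl ` component ?G x \<union> Inr ` component ?G x"
      using component_edge_iff[of _ _ ?G x]
      by (cases y; cases z) (auto simp: image_iff)
  qed (use that in auto)
  have sub_l: "component ?E (Inl x) \<subseteq> Inl ` component ?G x" if "component ?G x \<inter> ?W = {}" for x
  proof (rule component_least)
    fix y z assume "(y, z) \<in> ?E"
    then show "y \<in> Inl ` component ?G x \<longleftrightarrow> z \<in> Inl ` component ?G x"
      using component_edge_iff[of _ _ ?G x] that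
      by (cases y; cases z) (auto simp: image_iff disjoint_iff)
  qed simp
  have sub_r: "component ?E (Inr x) \<subseteq> Inr ` component ?G x" if "component ?G x \<inter> ?W = {}" for x
  proof (rule component_least)
    fix y z assume "(y, z) \<in> ?E"
    then show "y \<in> Inr ` component ?G x \<longleftrightarrow> z \<in> Inr ` component ?G x"
      using component_edge_iff[of _ _ ?G x] that
      by (cases y; cases z) (auto simp: image_iff disjoint_iff)
  qed simp
  have both: "component ?E (Inl x) = component ?E (Inr x)" if "component ?G x \<inter> ?W \<noteq> {}" for x
  proof -
    obtain w where w: "w \<in> component ?G x" "w \<in> ?W" using \<open>component ?G x \<inter> ?W \<noteq> {}\<close> by blast
    then have "component ?E (Inl x) = component ?E (Inl w)" "component ?E (Inr x) = component ?E (Inr w)"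
      using inl[of x] inr[of x] by (auto simp: component_eq_iff)
    then show ?thesis using vert w by simp
  qed
  show "component ?E v = mirror_component ?G ?W v"
  proof (cases v)
    case (Inl x)
    show ?thesis
    proof (cases "component ?G x \<inter> ?W = {}")
      case True
      then have "component ?E (Inl x) = Inl ` component ?G x" using inl sub_l by blast
      with True Inl show ?thesis by (simp add: mirror_component_def)
    next
      case False
      then have "component ?E (Inl x) = Inl ` component ?G x \<union> Inr ` component ?G x"
        using inl[of x] inr[of x] sub[of Inl x] both[of x] by blast
      with False Inl show ?thesis by (simp add: mirror_component_def)
    qed
  next
    case (Inr x)
    show ?thesis
    proof (cases "component ?G x \<inter> ?W = {}")
      case True
      then have "component ?E (Inr x) = Inr ` component ?G x" using inr sub_r by blast
      with True Inr show ?thesis by (simp add: mirror_component_def)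
    next
      case False
      then have "component ?E (Inr x) = Inr ` component ?G x \<union> Inl ` component ?G x"
        using inl[of x] inr[of x] sub[of Inr x] both[of x] by blast
      with False Inr show ?thesis by (simp add: mirror_component_def)
    qed
  qed
qed

lemma mirror_component_both:
  "component G (case_sum id id v) \<inter> W \<noteq> {} \<Longrightarrow> mirror_component G W v =
    Inl ` component G (case_sum id id v) \<union> Inr ` component G (case_sum id id v)"
  by (cases v) (simp_all add: mirror_component_def Un_commute)

lemma mirror_component_single:
  "component G x \<inter> W = {} \<Longrightarrow> mirror_component G W (Inl x) = Inl ` component G x"
  "component G x \<inter> W = {} \<Longrightarrow> mirror_component G W (Inr x) = Inr ` component G x"
  by (simp_all add: mirror_component_def)

lemma mirror_component_cong:
  "component G (case_sum id id v) = component G' (case_sum id id v) \<Longrightarrow>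
    component G (case_sum id id v) \<inter> W = component G (case_sum id id v) \<inter> W' \<Longrightarrow>
    mirror_component G W v = mirror_component G' W' v"
  by (cases v) (simp_all add: mirror_component_def)

text \<open>A stage of the minimal cobordism: the arcs \<open>don\<close> of \<open>b\<close> have
  been surgered, (i, j) is next and \<open>rem\<close> follows. The map
  \<open>case_sum id id\<close> flattens both lines onto one.\<close>

locale mirror_saddle =
  fixes n :: nat and a b rem don :: matching and i j :: nat
  assumes a: "a \<in> crossingless_matchings n" and b: "b \<in> crossingless_matchings n"
    and b_eq: "b = insert (i, j) (rem \<union> don)"
    and notin: "(i, j) \<notin> rem \<union> don" and disj: "rem \<inter> don = {}"
begin

definition "W = endpoints don"
text \<open>The flattened circle through (i, j) before the saddle; \<open>Ki\<close> and
  \<open>Kj\<close> are the pieces at its two ends afterwards, which may coincide.\<close>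

definition "K = component (insert (i, j) (a \<union> rem)) i"
definition "Ki = component (a \<union> rem) i"
definition "Kj = component (a \<union> rem) j"
abbreviation "\<kappa> \<equiv> component (stacked a a (insert (i, j) rem) don)"
abbreviation "\<kappa>' \<equiv> component (stacked a a rem (insert (i, j) don))"

lemma \<kappa>: "\<kappa> = mirror_component (insert (i, j) (a \<union> rem)) W"
  by (simp add: component_stacked_mirror W_def)

lemma \<kappa>': "\<kappa>' = mirror_component (a \<union> rem) (insert i (insert j W))"
  by (simp add: component_stacked_mirror W_def insert_commute)

lemma in_b: "(i, j) \<in> b" using b_eq by simp

lemma ij: "1 \<le> i" "i < j" "j \<le> 2 * n"
  using crossinglessD(1)[OF b in_b] by auto

lemma b_fst_snd:
  assumes "e \<in> b" "e' \<in> b" "{fst e, snd e} \<inter> {fst e', snd e'} \<noteq> {}" shows "e = e'"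
proof -
  have "mate b (fst e) (snd e)" "mate b (fst e') (snd e')" using assms by (auto simp: mate_def)
  then have "fst e' = fst e \<and> snd e' = snd e \<or> fst e' = snd e \<and> snd e' = fst e"
    using assms(3) crossinglessD(3)[OF b] mate_sym[of b] by auto metis+
  moreover have "fst e < snd e" "fst e' < snd e'"
    using crossinglessD(1)[OF b, of "fst e" "snd e"] crossinglessD(1)[OF b, of "fst e'" "snd e'"] assms by auto
  ultimately show ?thesis by (auto simp: prod_eq_iff)
qed

lemma ij_notin_W: "i \<notin> W" "j \<notin> W"
proof -
  have "i \<notin> {fst e, snd e} \<and> j \<notin> {fst e, snd e}" if "e \<in> don" for e
    using b_fst_snd[of "(i, j)" e] that b_eq notin by auto
  then show "i \<notin> W" "j \<notin> W" unfolding W_def by blast+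
qed

lemma no_mate_rem:
  assumes "x \<in> insert i (insert j W)" shows "\<not> mate rem x y"
proof
  assume "mate rem x y"
  then obtain e where e: "e \<in> rem" "x \<in> {fst e, snd e}" by (force simp: mate_def)
  from assms obtain e' where e': "e' \<in> insert (i, j) don" "x \<in> {fst e', snd e'}"
    unfolding W_def by force
  then have "e = e'" using b_fst_snd[of e e'] e b_eq by blast
  then show False using e e' notin disj by auto
qed

lemma mate_rem_unique: "mate rem x y \<Longrightarrow> mate rem x z \<Longrightarrow> y = z"
  using crossinglessD(3)[OF b, of x y z] b_eq by (auto simp: mate_def)

lemma K_eq: "K = Ki \<union> Kj"
  unfolding K_def Ki_def Kj_def by (subst component_insert) auto

lemma component_outside:
  "x \<notin> K \<Longrightarrow> component (insert (i, j) (a \<union> rem)) x = component (a \<union> rem) x"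
  unfolding K_eq unfolding Ki_def Kj_def by (subst component_insert) auto

lemma component_inside: "x \<in> K \<Longrightarrow> component (insert (i, j) (a \<union> rem)) x = K"
  unfolding K_def by (rule component_eq)

lemma in_K: "i \<in> K" "j \<in> K" "i \<in> Ki" "j \<in> Kj"
  by (auto simp: K_eq Ki_def Kj_def)

lemma outside:
  assumes "case_sum id id v \<notin> K" shows "\<kappa>' v = \<kappa> v"
proof -
  let ?x = "case_sum id id v"
  have "i \<notin> component (a \<union> rem) ?x" "j \<notin> component (a \<union> rem) ?x"
    using assms component_sym[of ?x "a \<union> rem" i] component_sym[of ?x "a \<union> rem" j]
    unfolding K_eq Ki_def Kj_def by auto
  then show ?thesis
    unfolding \<kappa> \<kappa>' by (intro mirror_component_cong) (simp_all add: component_outside[OF assms])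
qed

lemma K_in_range: "K \<subseteq> {1..2 * n}"
proof -
  have "K \<subseteq> component (a \<union> b) i"
    unfolding K_def by (rule component_mono) (use b_eq in auto)
  then show ?thesis using component_in_range[OF a b, of i] ij by auto
qed

lemma \<kappa>_inside:
  assumes "case_sum id id v \<in> K" "K \<inter> W \<noteq> {}" shows "\<kappa> v = Inl ` K \<union> Inr ` K"
  unfolding \<kappa> by (subst mirror_component_both) (simp_all add: component_inside assms)

lemma \<kappa>_inside_single:
  assumes "x \<in> K" "K \<inter> W = {}" shows "\<kappa> (Inl x) = Inl ` K" "\<kappa> (Inr x) = Inr ` K"
  unfolding \<kappa> by (simp_all add: mirror_component_single component_inside assms)

lemma same_circle_iff: "\<kappa> (Inl i) = \<kappa> (Inr i) \<longleftrightarrow> K \<inter> W \<noteq> {}"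
proof (cases "K \<inter> W = {}")
  case True
  have "Inl i \<in> Inl ` K" "Inl i \<notin> Inr ` K" using in_K by auto
  with True show ?thesis using \<kappa>_inside_single[of i] in_K by metis
next
  case False
  then show ?thesis using \<kappa>_inside[of "Inl i"] \<kappa>_inside[of "Inr i"] in_K by simp
qed

lemma inside_iff: "\<kappa> v = \<kappa> (Inl i) \<or> \<kappa> v = \<kappa> (Inr i) \<longleftrightarrow> case_sum id id v \<in> K"
proof
  assume "\<kappa> v = \<kappa> (Inl i) \<or> \<kappa> v = \<kappa> (Inr i)"
  then have "v \<in> \<kappa> (Inl i) \<union> \<kappa> (Inr i)" using component_refl[of v] by blast
  then have "v \<in> Inl ` K \<union> Inr ` K"
    using \<kappa>_inside[of "Inl i"] \<kappa>_inside[of "Inr i"] \<kappa>_inside_single[of i] in_K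
    by (cases "K \<inter> W = {}") auto
  then show "case_sum id id v \<in> K" by auto
next
  assume *: "case_sum id id v \<in> K"
  show "\<kappa> v = \<kappa> (Inl i) \<or> \<kappa> v = \<kappa> (Inr i)"
  proof (cases "K \<inter> W = {}")
    case True
    then show ?thesis
      using * \<kappa>_inside_single[of i] \<kappa>_inside_single[of "case_sum id id v"] in_K by (cases v) simp_all
  next
    case False
    then show ?thesis using * \<kappa>_inside[of v] \<kappa>_inside[of "Inl i"] in_K by simp
  qed
qed

lemma \<kappa>'_inside:
  assumes "case_sum id id v \<in> component (a \<union> rem) u" "u = i \<or> u = j"
  shows "\<kappa>' v = Inl ` component (a \<union> rem) u \<union> Inr ` component (a \<union> rem) u"
proof -
  have "component (a \<union> rem) (case_sum id id v) = component (a \<union> rem) u"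
    using assms(1) by (rule component_eq)
  moreover have "component (a \<union> rem) u \<inter> insert i (insert j W) \<noteq> {}"
    using assms(2) component_refl[of u "a \<union> rem"] by blast
  ultimately show ?thesis unfolding \<kappa>' by (subst mirror_component_both) simp_all
qed

lemma mate_rem_if:
  assumes "x \<in> K" "x \<notin> insert i (insert j W)" shows "\<exists>y. mate rem x y"
proof -
  obtain y where "mate b x y" using crossinglessD(2)[OF b] K_in_range assms(1) by blast
  moreover from this have "\<not> mate don x y" "{x, y} \<noteq> {i, j}"
    using assms(2) endpoints_iff_mate[of x don] unfolding W_def by auto
  ultimately show ?thesis using b_eq by (auto simp: mate_def doubleton_eq_iff)
qed

text \<open>If i and j were still joined after the saddle, the path of \<open>a\<close> and
  \<open>rem\<close> through i would have three ends: i, j and a point w of \<open>W\<close>, none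
  of which has an arc of \<open>rem\<close>. So the saddle really produces two circles.\<close>

lemma split:
  assumes "K \<inter> W \<noteq> {}"
  shows "linear_extension (split_map (\<kappa> (Inl i)) (\<kappa>' (Inl i)) (\<kappa>' (Inl j))) (eval_dots \<kappa> f)
    = eval_dots \<kappa>' (f * dual (Inl i) (Inl j))"
proof -
  obtain w where w: "w \<in> K" "w \<in> W" using assms by blast
  have "Ki \<noteq> Kj"
  proof
    assume eq: "Ki = Kj"
    have "j = w"
    proof (rule at_most_two_ends[where A = "mate a" and R = "mate rem" and E = "a \<union> rem" and u = i])
      show "j \<in> component (a \<union> rem) i" "w \<in> component (a \<union> rem) i"
        using eq in_K w K_eq by (auto simp: Ki_def)
      show "i \<noteq> j" "i \<noteq> w" using ij w ij_notin_W by auto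
      show "\<And>x. \<not> mate rem i x" "\<And>x. \<not> mate rem j x" "\<And>x. \<not> mate rem w x"
        using no_mate_rem w by auto
    qed (use symp_mate crossinglessD(3)[OF a] mate_rem_unique in \<open>auto simp: mate_def\<close>)
    then show False using w ij_notin_W by simp
  qed
  then have disj: "Ki \<inter> Kj = {}"
    unfolding Ki_def Kj_def component_eq_iff by (rule component_disjoint)
  note \<kappa>K = \<kappa>_inside[OF _ assms]
  have \<kappa>'i: "\<kappa>' v = Inl ` Ki \<union> Inr ` Ki" if "case_sum id id v \<in> Ki" for v
    using \<kappa>'_inside[of v i] that by (simp add: Ki_def)
  have \<kappa>'j: "\<kappa>' v = Inl ` Kj \<union> Inr ` Kj" if "case_sum id id v \<in> Kj" for v
    using \<kappa>'_inside[of v j] that by (simp add: Kj_def)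
  have new: "\<kappa>' (Inl i) = Inl ` Ki \<union> Inr ` Ki" "\<kappa>' (Inl j) = Inl ` Kj \<union> Inr ` Kj"
    "\<kappa> (Inl i) = Inl ` K \<union> Inr ` K"
    using \<kappa>'i[of "Inl i"] \<kappa>'j[of "Inl j"] \<kappa>K[of "Inl i"] in_K by auto
  \<comment> \<open>An old circle contains both of \<open>Inl i\<close> and \<open>Inl j\<close> or
    neither, a new one exactly one of them. This gives the freshness that
    \<open>eval_dots_split\<close> asks for.\<close>
  have old: "Inl i \<in> \<kappa> v \<longleftrightarrow> Inl j \<in> \<kappa> v" for v
  proof -
    have "\<kappa> (Inl i) = \<kappa> (Inl j)" using \<kappa>K[of "Inl i"] \<kappa>K[of "Inl j"] in_K by simp
    then show ?thesis by (metis component_eq_iff component_sym)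
  qed
  show ?thesis
  proof (rule eval_dots_split)
    show "\<kappa>' (Inl i) \<noteq> \<kappa>' (Inl j)" unfolding new using disj in_K by blast
    show "\<kappa>' (Inl i) \<notin> range \<kappa>"
    proof
      assume "\<kappa>' (Inl i) \<in> range \<kappa>"
      then have "Inl j \<in> \<kappa>' (Inl i)" using old component_refl by (metis imageE)
      then show False unfolding new using disj in_K by blast
    qed
    show "\<kappa>' (Inl j) \<notin> range \<kappa>"
    proof
      assume "\<kappa>' (Inl j) \<in> range \<kappa>"
      then have "Inl i \<in> \<kappa>' (Inl j)" using old component_refl by (metis imageE)
      then show False unfolding new using disj in_K by blast
    qed
    show "\<kappa>' v \<in> {\<kappa>' (Inl i), \<kappa>' (Inl j)}" if "\<kappa> v = \<kappa> (Inl i)" for v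
      using \<kappa>'i[of v] \<kappa>'j[of v] inside_iff[of v] that unfolding new K_eq by blast
    show "\<kappa>' v = \<kappa> v" if "\<kappa> v \<noteq> \<kappa> (Inl i)" for v
      using outside[of v] \<kappa>K[of v] that unfolding new by blast
  qed simp_all
qed

text \<open>As K avoids \<open>W\<close>, only i and j can be points of \<open>Ki\<close> without an
  arc of \<open>rem\<close>. The arcs of \<open>a\<close> pair off \<open>Ki\<close>, those of
  \<open>rem\<close> pair off its other points; by parity i and j lie in \<open>Ki\<close> together.
  The path stays in one piece and its two copies become one circle.\<close>

lemma merge:
  assumes "K \<inter> W = {}"
  shows "linear_extension (merge_map (\<kappa> (Inl i)) (\<kappa> (Inr i)) (\<kappa>' (Inl i))) (eval_dots \<kappa> f)
    = eval_dots \<kappa>' f"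
proof -
  let ?T = "insert i (insert j W)"
  have "finite Ki" using finite_subset[OF K_in_range] by (simp add: K_eq)
  have closed: "y \<in> Ki" if "mate a x y \<or> mate rem x y" "x \<in> Ki" for x y
    using that component_edge_iff[of x y "a \<union> rem" i] component_edge_iff[of y x "a \<union> rem" i]
    by (auto simp: mate_def Ki_def)
  have "even (card Ki)"
  proof (rule even_card_if_matched[where A = "mate a"])
    fix x assume "x \<in> Ki"
    then obtain y where "mate a x y" using crossinglessD(2)[OF a] K_in_range K_eq by blast
    then show "\<exists>y\<in>Ki. mate a x y" using closed \<open>x \<in> Ki\<close> by blast
  next
    show "\<not> mate a x x" for x using crossinglessD(1)[OF a, of x x] by (auto simp: mate_def)
  qed (use \<open>finite Ki\<close> symp_mate crossinglessD(3)[OF a] in auto)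
  moreover have "even (card (Ki - ?T))"
  proof (rule even_card_if_matched[where A = "mate rem"])
    fix x assume x: "x \<in> Ki - ?T"
    then obtain y where y: "mate rem x y" using mate_rem_if K_eq by blast
    then have "y \<notin> ?T" using no_mate_rem[of y x] mate_sym[of rem] by blast
    then show "\<exists>y\<in>Ki - ?T. mate rem x y" using closed x y by blast
  next
    show "\<not> mate rem x x" for x
      using crossinglessD(1)[OF b, of x x] b_eq by (auto simp: mate_def)
  qed (use \<open>finite Ki\<close> symp_mate mate_rem_unique in auto)
  moreover have "card Ki = card (Ki - ?T) + card (Ki \<inter> ?T)"
    using card_Int_Diff[OF \<open>finite Ki\<close>, of ?T] by simp
  ultimately have "even (card (Ki \<inter> ?T))" by simp
  moreover have "Ki \<inter> ?T = {i}" if "j \<notin> Ki"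
    using that assms in_K K_eq by blast
  ultimately have "j \<in> Ki" by (cases "j \<in> Ki") auto
  then have Kj: "Kj = Ki" unfolding Ki_def Kj_def by (rule component_eq)
  then have K: "K = Ki" by (simp add: K_eq)
  note new = \<kappa>_inside_single[OF in_K(1) assms]
  have \<kappa>'K: "\<kappa>' v = Inl ` K \<union> Inr ` K" if "case_sum id id v \<in> K" for v
    using \<kappa>'_inside[of v i] that by (simp add: K Ki_def)
  show ?thesis
  proof (rule eval_dots_merge)
    show "\<kappa> (Inl i) \<noteq> \<kappa> (Inr i)" unfolding new using in_K by blast
    show "\<kappa>' (Inl i) \<notin> range \<kappa>"
    proof
      assume "\<kappa>' (Inl i) \<in> range \<kappa>"
      then obtain v where "\<kappa>' (Inl i) = \<kappa> v" by blast
      then have "Inl i \<in> \<kappa> v" "Inr i \<in> \<kappa> v" using \<kappa>'K[of "Inl i"] in_K by auto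
      then have "\<kappa> (Inl i) = \<kappa> (Inr i)" using component_eq by metis
      then show False unfolding new using in_K by blast
    qed
    show "\<kappa>' v = \<kappa>' (Inl i)" if "\<kappa> v \<in> {\<kappa> (Inl i), \<kappa> (Inr i)}" for v
      using \<kappa>'K[of v] \<kappa>'K[of "Inl i"] in_K inside_iff[of v] that by auto
    show "\<kappa>' v = \<kappa> v" if "\<kappa> v \<notin> {\<kappa> (Inl i), \<kappa> (Inr i)}" for v
      using outside[of v] inside_iff[of v] that by blast
  qed
qed

text \<open>The criterion becomes independent of the stage: it asks whether i is the first point of
  its circle in W(b)a. If K avoids \<open>W\<close>, it is closed under the surgered arcs too and
  hence is this whole circle; an earlier point on it would belong to an arc that has already been
  surgered.\<close>

lemma split_iff:
  assumes "\<And>e. e \<in> don \<Longrightarrow> fst e < i" "\<And>e. e \<in> rem \<Longrightarrow> i < fst e"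
  shows "K \<inter> W \<noteq> {} \<longleftrightarrow> (\<exists>v<i. v \<in> component (a \<union> b) i)"
proof
  assume "K \<inter> W \<noteq> {}"
  then obtain w where w: "w \<in> K" "w \<in> W" by blast
  then obtain e where e: "e \<in> don" "w \<in> {fst e, snd e}" unfolding W_def by blast
  have "K \<subseteq> component (a \<union> b) i"
    unfolding K_def by (rule component_mono) (use b_eq in auto)
  then have "fst e \<in> component (a \<union> b) i"
    using w e component_edge_iff[of "fst e" "snd e" "a \<union> b" i] b_eq by auto
  then show "\<exists>v<i. v \<in> component (a \<union> b) i" using assms(1) e by blast
next
  assume "\<exists>v<i. v \<in> component (a \<union> b) i"
  then obtain v where v: "v < i" "v \<in> component (a \<union> b) i" by blast
  show "K \<inter> W \<noteq> {}"
  proof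
    assume KW: "K \<inter> W = {}"
    have "component (a \<union> b) i \<subseteq> K"
    proof (rule component_least)
      fix x y assume xy: "(x, y) \<in> a \<union> b"
      show "x \<in> K \<longleftrightarrow> y \<in> K"
      proof (cases "(x, y) \<in> don")
        case True
        then have "x \<in> W" "y \<in> W" by (force simp: W_def)+
        then show ?thesis using KW by blast
      next
        case False
        then show ?thesis unfolding K_def by (intro component_edge_iff) (use xy b_eq in auto)
      qed
    qed (rule in_K)
    then have "v \<in> K" "v \<in> {1..2 * n}" using v K_in_range by auto
    then obtain q where "mate b v q" using crossinglessD(2)[OF b] by blast
    then obtain e where e: "e \<in> b" "e = (v, q) \<or> e = (q, v)" by (auto simp: mate_def)
    then have "fst e \<le> v" using crossinglessD(1)[OF b] by fastforce
    then have "e \<in> don" using e b_eq v(1) assms(2) by fastforce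
    then have "v \<in> W" using e by (force simp: W_def)
    then show False using KW \<open>v \<in> K\<close> by blast
  qed
qed

end

subsection \<open>Products in the arc ring\<close>

lemma linear_map_saddles:
  "linear_map (saddles d a don es :: _ \<Rightarrow> (nat + nat) set set \<Rightarrow>\<^sub>0 'k::field poly poly)"
proof (induction es arbitrary: don)
  case Nil
  then show ?case by (simp add: poly_mapping_module.module_hom_ident)
next
  case (Cons e es)
  obtain i j where e: "e = (i, j)" by (cases e)
  have "\<exists>f. (saddles d a don (e # es) :: _ \<Rightarrow> (nat + nat) set set \<Rightarrow>\<^sub>0 'k poly poly)
      = (\<lambda>x. saddles d a (insert e don) es (linear_extension f x))"
    by (auto simp: fun_eq_iff e Let_def)
  moreover have "linear_map (\<lambda>x. saddles d a (insert e don) es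
      (linear_extension f x) :: (nat + nat) set set \<Rightarrow>\<^sub>0 'k poly poly)" for f :: "_ \<Rightarrow> (nat + nat) set set \<Rightarrow>\<^sub>0 'k poly poly"
    by (rule linear_map_compose[OF linear_map_extension Cons.IH])
  ultimately show ?case by metis
qed

text \<open>The factors collected from the splits remain valid through all later saddles, because
  they are polynomials in points.\<close>

lemma saddles_mirror:
  assumes a: "a \<in> crossingless_matchings n" and b: "b \<in> crossingless_matchings n"
    and "sorted_wrt (<) (map fst es)" "set es \<union> don = b"
    and "\<And>e e'. e \<in> don \<Longrightarrow> e' \<in> set es \<Longrightarrow> fst e < fst e'"
  shows "saddles a a don es (eval_dots (component (stacked a a (set es) don)) f)
    = eval_dots (component (stacked a a {} b))
        (f * (\<Prod>e\<in>{e \<in> set es. \<exists>v<fst e. v \<in> component (a \<union> b) (fst e)}.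
            dual (Inl (fst e)) (Inl (snd e))))"
  using assms(3-5)
proof (induction es arbitrary: don f)
  case (Cons e es)
  obtain i j where e: "e = (i, j)" by (cases e)
  have lt: "i < fst e'" if "e' \<in> set es" for e' using Cons.prems(1) that by (simp add: e)
  have notin: "(i, j) \<notin> set es" "(i, j) \<notin> don" using lt[of "(i, j)"] Cons.prems(3)[of "(i, j)" "(i, j)"] by (auto simp: e)
  interpret mirror_saddle n a b "set es" don i j
  proof
    show "b = insert (i, j) (set es \<union> don)" using Cons.prems(2) by (auto simp: e)
    show "(i, j) \<notin> set es \<union> don" using notin by simp
    show "set es \<inter> don = {}" using Cons.prems(3) by fastforce
  qed (fact a b)+
  let ?s = "\<lambda>e. \<exists>v<fst e. v \<in> component (a \<union> b) (fst e)"
  let ?g = "if ?s e then f * dual (Inl i) (Inl j) else f"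
  have iff: "\<kappa> (Inl i) = \<kappa> (Inr i) \<longleftrightarrow> ?s e"
    unfolding same_circle_iff e fst_conv
    by (rule split_iff) (use lt Cons.prems(3)[of _ "(i, j)"] in \<open>simp_all add: e\<close>)
  have "saddles a a don (e # es) (eval_dots (component (stacked a a (set (e # es)) don)) f)
      = saddles a a (insert (i, j) don) es (eval_dots \<kappa>' ?g)"
  proof (cases "?s e")
    case True
    then show ?thesis using split[of f] iff same_circle_iff by (simp add: e Let_def)
  next
    case False
    then have "\<kappa> (Inl i) \<noteq> \<kappa> (Inr i)" "K \<inter> W = {}" using iff same_circle_iff by auto
    moreover have g: "?g = f" using False by (rule if_not_P)
    ultimately show ?thesis unfolding g using merge[of f] by (simp add: e Let_def)
  qed
  also have "\<dots> = eval_dots (component (stacked a a {} b))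
      (?g * (\<Prod>e\<in>{e \<in> set es. ?s e}. dual (Inl (fst e)) (Inl (snd e))))"
    by (rule Cons.IH) (use Cons.prems lt in \<open>auto simp: e\<close>)
  also have "?g * (\<Prod>e\<in>{e \<in> set es. ?s e}. dual (Inl (fst e)) (Inl (snd e)))
      = f * (\<Prod>e'\<in>{e' \<in> set (e # es). ?s e'}. dual (Inl (fst e')) (Inl (snd e')))"
  proof (cases "?s e")
    case True
    then have "{e' \<in> set (e # es). ?s e'} = insert (i, j) {e \<in> set es. ?s e}" by (auto simp: e)
    with True show ?thesis using notin by (simp add: e mult.assoc)
  next
    case False
    then have "{e' \<in> set (e # es). ?s e'} = {e \<in> set es. ?s e}" by auto
    moreover have g: "?g = f" using False by (rule if_not_P)
    ultimately show ?thesis by (simp only:)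
  qed
  finally show ?case .
qed simp

text \<open>In W(a)a every arc closes up with its mirror image. As long as (i, j) is not surgered,
  \<open>Inl i\<close> and \<open>Inl j\<close> form a circle of their own, and the saddle absorbs
  it into the circle through \<open>Inr i\<close> and \<open>Inr j\<close>.\<close>

lemma saddle_on_unit:
  fixes a d rem don :: matching and i j :: nat
  assumes a: "a \<in> crossingless_matchings n" and sub: "insert (i, j) (rem \<union> don) \<subseteq> a"
    and notin: "(i, j) \<notin> don"
  defines "\<kappa> \<equiv> component (stacked d a (insert (i, j) rem) don)"
    and "\<kappa>' \<equiv> component (stacked d a rem (insert (i, j) don))"
  shows "\<kappa> (Inl i) \<noteq> \<kappa> (Inr i)"
    and "linear_extension (merge_map (\<kappa> (Inl i)) (\<kappa> (Inr i)) (\<kappa>' (Inl i))) (eval_dots \<kappa> f)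
      = eval_dots \<kappa>' f"
proof -
  define E where "E = stacked d a rem don"
  define P where "P = component E (Inl i)"
  define Q where "Q = component E (Inr i) \<union> component E (Inr j)"
  have ij: "mate a i j" "mate a j i" using sub by (auto simp: mate_def)
  have don: "i \<notin> endpoints don" "j \<notin> endpoints don"
  proof -
    have "(j, i) \<notin> don"
      using crossinglessD(1)[OF a, of i j] crossinglessD(1)[OF a, of j i] sub by auto
    then have "\<not> mate don i j" "\<not> mate don j i" using notin by (simp_all add: mate_def)
    moreover have "mate a x y" if "mate don x y" for x y using that sub by (auto simp: mate_def)
    ultimately have "\<not> mate don i y \<and> \<not> mate don j y" for y
      using ij crossinglessD(3)[OF a] by blast
    then show "i \<notin> endpoints don" "j \<notin> endpoints don" unfolding endpoints_iff_mate by blast+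
  qed
  \<comment> \<open>Both diagrams are compared with \<open>E\<close>. The saddle deletes only the
    copy of the arc on the upper line, since the arc on the lower line is still present as an arc of
    \<open>a\<close>.\<close>
  have E1: "stacked d a (insert (i, j) rem) don = insert (Inr i, Inr j) E"
    using sub by (auto simp: E_def stacked_def)
  have E2: "stacked d a rem (insert (i, j) don) = insert (Inl i, Inr i) (insert (Inl j, Inr j) E)"
    by (auto simp: E_def stacked_def)
  have "component E (Inl i) \<subseteq> {Inl i, Inl j}"
  proof (rule component_least)
    fix y z assume yz: "(y, z) \<in> E"
    show "y \<in> {Inl i, Inl j} \<longleftrightarrow> z \<in> {Inl i, Inl j}"
    proof (cases y)
      case (Inl y')
      show ?thesis
      proof (cases z)
        case (Inl z')
        then have "mate a y' z'" "mate a z' y'" using yz \<open>y = Inl y'\<close> sub by (auto simp: E_def mate_def)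
        then have "y' \<in> {i, j} \<longleftrightarrow> z' \<in> {i, j}" using ij crossinglessD(3)[OF a] by blast
        then show ?thesis using \<open>y = Inl y'\<close> Inl by simp
      next
        case (Inr z')
        then show ?thesis using yz \<open>y = Inl y'\<close> don by (auto simp: E_def)
      qed
    next
      case (Inr y')
      then show ?thesis using yz by (cases z) (auto simp: E_def)
    qed
  qed simp
  moreover have "(Inl i, Inl j) \<in> E" using sub by (simp add: E_def)
  then have P_j: "component E (Inl j) = P" unfolding P_def by (rule component_edge[symmetric])
  ultimately have P: "P = {Inl i, Inl j}"
    unfolding P_def using component_refl[of "Inl j" E] by auto
  have "Inl i \<notin> component E (Inr x)" for x
    using component_sym[of "Inl i" E "Inr x"] P unfolding P_def by auto
  then have "Inl i \<notin> Q" by (simp add: Q_def)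
  have \<kappa>: "\<kappa> v = (if v \<in> Q then Q else component E v)" for v
    unfolding \<kappa>_def E1 component_insert Q_def ..
  have \<kappa>': "\<kappa>' v = (if v \<in> P \<union> Q then P \<union> Q else component E v)" for v
  proof -
    let ?F = "insert (Inl j, Inr j) E"
    have F: "component ?F v = (if v \<in> P \<union> component E (Inr j) then P \<union> component E (Inr j) else component E v)" for v
      unfolding component_insert P_j ..
    then have "component ?F (Inl i) = P \<union> component E (Inr j)" using P by simp
    moreover have "P \<union> component E (Inr j) \<union> component ?F (Inr i) = P \<union> Q"
    proof (cases "Inr i \<in> component E (Inr j)")
      case True
      then have "component E (Inr i) = component E (Inr j)" by (rule component_eq)
      then show ?thesis using True by (simp add: F Q_def Un_assoc)
    next
      case False
      then show ?thesis using P by (simp add: F Q_def Un_ac)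
    qed
    ultimately have "component ?F (Inl i) \<union> component ?F (Inr i) = P \<union> Q" by simp
    then have "\<kappa>' v = (if v \<in> P \<union> Q then P \<union> Q else component ?F v)"
      unfolding \<kappa>'_def E2 component_insert[of "Inl i"] by simp
    moreover have "component ?F v = component E v" if "v \<notin> P \<union> Q"
      using that F[of v] by (simp add: Q_def)
    ultimately show ?thesis by simp
  qed
  have \<kappa>_i: "\<kappa> (Inl i) = P" "\<kappa> (Inr i) = Q"
    using \<open>Inl i \<notin> Q\<close> \<kappa>[of "Inl i"] \<kappa>[of "Inr i"] by (auto simp: P_def Q_def)
  then show "\<kappa> (Inl i) \<noteq> \<kappa> (Inr i)" using P \<open>Inl i \<notin> Q\<close> by auto
  have \<kappa>'_i: "\<kappa>' (Inl i) = P \<union> Q" using \<kappa>'[of "Inl i"] P by simp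
  show "linear_extension (merge_map (\<kappa> (Inl i)) (\<kappa> (Inr i)) (\<kappa>' (Inl i))) (eval_dots \<kappa> f)
      = eval_dots \<kappa>' f"
  proof (rule eval_dots_merge)
    show "\<kappa> (Inl i) \<noteq> \<kappa> (Inr i)" by fact
    show "\<kappa>' (Inl i) \<notin> range \<kappa>"
    proof
      assume "\<kappa>' (Inl i) \<in> range \<kappa>"
      then obtain v where v: "P \<union> Q = \<kappa> v" unfolding \<kappa>'_i by blast
      have "Inl i \<in> \<kappa> v" "Inr i \<in> \<kappa> v" unfolding v[symmetric] using P by (auto simp: Q_def)
      then have "\<kappa> (Inl i) = \<kappa> (Inr i)" unfolding \<kappa>_def using component_eq by metis
      then show False using \<open>\<kappa> (Inl i) \<noteq> \<kappa> (Inr i)\<close> by simp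
    qed
    have inside: "v \<in> P \<union> Q" if "\<kappa> v \<in> {P, Q}" for v
      using component_refl[of v] that unfolding \<kappa>_def by blast
    then show "\<kappa>' v = \<kappa>' (Inl i)" if "\<kappa> v \<in> {\<kappa> (Inl i), \<kappa> (Inr i)}" for v
      using that \<kappa>'[of v] unfolding \<kappa>_i \<kappa>'_i by simp
    show "\<kappa>' v = \<kappa> v" if "\<kappa> v \<notin> {\<kappa> (Inl i), \<kappa> (Inr i)}" for v
    proof -
      have vQ: "v \<notin> Q"
      proof
        assume "v \<in> Q"
        then have "\<kappa> v = Q" using \<kappa>[of v] by simp
        then show False using that \<kappa>_i by simp
      qed
      moreover have "v \<notin> P"
      proof
        assume "v \<in> P"
        then have "component E v = P" unfolding P_def by (rule component_eq)
        then have "\<kappa> v = P" using \<kappa>[of v] vQ by simp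
        then show False using that \<kappa>_i by simp
      qed
      ultimately show ?thesis using \<kappa>[of v] \<kappa>'[of v] by simp
    qed
  qed
qed

lemma saddles_unit:
  assumes a: "a \<in> crossingless_matchings n"
    and "sorted_wrt (<) (map fst es)" "set es \<union> don = a"
    and "\<And>e e'. e \<in> don \<Longrightarrow> e' \<in> set es \<Longrightarrow> fst e < fst e'"
  shows "saddles d a don es (eval_dots (component (stacked d a (set es) don)) f)
    = eval_dots (component (stacked d a {} a)) f"
  using assms(2-4)
proof (induction es arbitrary: don)
  case (Cons e es)
  obtain i j where e: "e = (i, j)" by (cases e)
  have "insert (i, j) (set es \<union> don) \<subseteq> a" "(i, j) \<notin> don"
    using Cons.prems(2) Cons.prems(3)[of "(i, j)" "(i, j)"] by (auto simp: e)
  note step = saddle_on_unit[OF a this]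
  have "saddles d a don (e # es) (eval_dots (component (stacked d a (set (e # es)) don)) f)
      = saddles d a (insert (i, j) don) es
          (eval_dots (component (stacked d a (set es) (insert (i, j) don))) f)"
    by (simp add: e Let_def step)
  also have "\<dots> = eval_dots (component (stacked d a {} a)) f"
    by (rule Cons.IH) (use Cons.prems in \<open>auto simp: e\<close>)
  finally show ?case .
qed simp

lemma component_stacked_start:
  "component (stacked d a b {}) (Inl x) = Inl ` component (a \<union> b) x"
  "component (stacked d a b {}) (Inr x) = Inr ` component (d \<union> b) x"
proof -
  have "Inl ` component (a \<union> b) x \<subseteq> component (stacked d a b {}) (Inl x)"
    "Inr ` component (d \<union> b) x \<subseteq> component (stacked d a b {}) (Inr x)"
    by (rule component_image; simp)+
  moreover have "component (stacked d a b {}) (Inl x) \<subseteq> Inl ` component (a \<union> b) x"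
  proof (rule component_least)
    fix y z assume "(y, z) \<in> stacked d a b {}"
    then show "y \<in> Inl ` component (a \<union> b) x \<longleftrightarrow> z \<in> Inl ` component (a \<union> b) x"
      using component_edge_iff[of _ _ "a \<union> b" x] by (cases y; cases z) (auto simp: image_iff)
  qed simp
  moreover have "component (stacked d a b {}) (Inr x) \<subseteq> Inr ` component (d \<union> b) x"
  proof (rule component_least)
    fix y z assume "(y, z) \<in> stacked d a b {}"
    then show "y \<in> Inr ` component (d \<union> b) x \<longleftrightarrow> z \<in> Inr ` component (d \<union> b) x"
      using component_edge_iff[of _ _ "d \<union> b" x] by (cases y; cases z) (auto simp: image_iff)
  qed simp
  ultimately show "component (stacked d a b {}) (Inl x) = Inl ` component (a \<union> b) x"
    "component (stacked d a b {}) (Inr x) = Inr ` component (d \<union> b) x" by blast+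
qed

lemma endpoints_crossingless:
  assumes "m \<in> crossingless_matchings n" shows "endpoints m = {1..2 * n}"
  using crossinglessD(2,6)[OF assms] unfolding set_eq_iff endpoints_iff_mate by blast

text \<open>After the last saddle every point is joined to its mirror image, so the two lines
  collapse to W(d)a.\<close>

lemma component_stacked_end:
  assumes "a \<in> crossingless_matchings n" "b \<in> crossingless_matchings n" "d \<in> crossingless_matchings n"
    and "x \<in> {1..2 * n}"
  shows "component (stacked d a {} b) (Inr x) = component (stacked d a {} b) (Inl x)"
    and "Inl -` component (stacked d a {} b) (Inl x) = component (a \<union> d) x"
proof -
  let ?E = "stacked d a {} b"
  have vert: "component ?E (Inr x) = component ?E (Inl x)" if "x \<in> {1..2 * n}" for x
    using component_edge[of "Inl x" "Inr x" ?E] that endpoints_crossingless[OF assms(2)] by simp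
  then show "component ?E (Inr x) = component ?E (Inl x)" using assms by simp
  have "case_sum id id ` component ?E (Inl x) \<subseteq> component (a \<union> d) (case_sum id id (Inl x))"
  proof (rule component_image)
    fix y z :: "nat + nat" assume "(y, z) \<in> ?E"
    then show "case_sum id id y = case_sum id id z \<or> (case_sum id id y, case_sum id id z) \<in> a \<union> d
        \<or> (case_sum id id z, case_sum id id y) \<in> a \<union> d"
      by (cases y; cases z) auto
  qed
  then have "Inl -` component ?E (Inl x) \<subseteq> component (a \<union> d) x" by force
  moreover have "component (a \<union> d) x \<subseteq> Inl -` component ?E (Inl x)"
  proof (rule component_least)
    fix y z assume yz: "(y, z) \<in> a \<union> d"
    then have range: "y \<in> {1..2 * n}" "z \<in> {1..2 * n}"
      using crossinglessD(1)[OF assms(1), of y z] crossinglessD(1)[OF assms(3), of y z] by auto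
    have "component ?E (Inl y) = component ?E (Inl z)"
    proof (cases "(y, z) \<in> a")
      case True
      then show ?thesis by (intro component_edge) simp
    next
      case False
      then have "component ?E (Inr y) = component ?E (Inr z)" using yz by (intro component_edge) simp
      then show ?thesis using vert range by simp
    qed
    then show "y \<in> Inl -` component ?E (Inl x) \<longleftrightarrow> z \<in> Inl -` component ?E (Inl x)"
      unfolding vimage_eq component_sym[of _ ?E "Inl x"] by simp
  qed simp
  ultimately show "Inl -` component ?E (Inl x) = component (a \<union> d) x" by blast
qed

section \<open>The product as a bilinear map on polynomials in dots\<close>

definition embed_hom :: "matching \<Rightarrow> matching \<Rightarrow> (nat set set \<Rightarrow>\<^sub>0 'k::field poly poly) \<Rightarrow> (arc_basis \<Rightarrow>\<^sub>0 'k poly poly)"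
  where "embed_hom b a = linear_extension (\<lambda>S. basis_vec (b, a, S))"

lemma linear_map_embed_hom [simp, intro]: "linear_map (embed_hom b a)"
  by (simp add: embed_hom_def)

lemma embed_hom_basis_vec [simp]: "embed_hom b a (basis_vec S) = basis_vec (b, a, S)"
  by (simp add: embed_hom_def)

text \<open>The shape of \<open>arc_mult\<close>, isolated so that identities linear in both
  arguments reduce to pairs of basis vectors.\<close>

definition bilinear_extension ::
  "('i \<Rightarrow> 'j \<Rightarrow> ('l \<Rightarrow>\<^sub>0 'r)) \<Rightarrow> ('i \<Rightarrow>\<^sub>0 'r::comm_ring_1) \<Rightarrow> ('j \<Rightarrow>\<^sub>0 'r) \<Rightarrow> ('l \<Rightarrow>\<^sub>0 'r)"
  where "bilinear_extension g y x = linear_extension (\<lambda>i. linear_extension (g i) x) y"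

lemma bilinear_extension_basis_vec [simp]:
  "bilinear_extension g (basis_vec i) (basis_vec j) = g i j"
  by (simp add: bilinear_extension_def)

lemma linear_map_bilinear_extension_left [intro]: "linear_map (\<lambda>y. bilinear_extension g y x)"
  by (simp add: bilinear_extension_def linear_map_extension)

lemma linear_map_bilinear_extension_right [intro]: "linear_map (bilinear_extension g y)"
  by (rule linear_mapI)
    (simp_all add: bilinear_extension_def linear_extension_def[of _ y]
      poly_mapping_module.scale_right_distrib sum.distrib poly_mapping_module.scale_sum_right mult.commute)

lemma arc_mult_eq: "arc_mult = bilinear_extension arc_mult_basis"
  by (simp add: fun_eq_iff arc_mult_def bilinear_extension_def)

lemma bilinear_eq:
  assumes "\<And>x. linear_map (\<lambda>y. B y x)" "\<And>y. linear_map (B y)"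
    and "\<And>x. linear_map (\<lambda>y. B' y x)" "\<And>y. linear_map (B' y)"
    and "\<And>i j. B (basis_vec i) (basis_vec j) = B' (basis_vec i) (basis_vec j)"
  shows "B y x = B' y x"
proof (rule linear_map_eq[of "\<lambda>y. B y x" "\<lambda>y. B' y x"])
  show "B (basis_vec i) x = B' (basis_vec i) x" for i
    by (rule linear_map_eq[of "B (basis_vec i)"]) (use assms in auto)
qed (use assms in auto)

text \<open>Dots on either line act independently of the other line. Empty circles are excluded
  because the empty set has the same image under \<open>Inl\<close> and \<open>Inr\<close>, which
  would identify circles of different lines.\<close>

lemma juxtapose_dots:
  fixes \<kappa> :: "'v \<Rightarrow> 'a set" and \<kappa>' :: "'w \<Rightarrow> 'b set"
  assumes "\<And>x. \<kappa> x \<noteq> {}" "\<And>x. \<kappa>' x \<noteq> {}"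
    and "\<And>x. \<kappa>'' (Inl x) = Inl ` \<kappa> x" "\<And>x. \<kappa>'' (Inr x) = Inr ` \<kappa>' x"
  shows "bilinear_extension (\<lambda>T S. basis_vec ((`) Inl ` S \<union> (`) Inr ` T)) (dots \<kappa>' m') (dots \<kappa> m)
    = (dots \<kappa>'' (image_mset Inl m + image_mset Inr m') :: ('a + 'b) set set \<Rightarrow>\<^sub>0 'k::field poly poly)"
proof -
  define J where "J = bilinear_extension (\<lambda>T S. basis_vec ((`) Inl ` S \<union> (`) Inr ` T) :: ('a + 'b) set set \<Rightarrow>\<^sub>0 'k poly poly)"
  have lin: "linear_map (\<lambda>y. J y x)" "linear_map (J y)" for x y
    unfolding J_def by (fact linear_map_bilinear_extension_left linear_map_bilinear_extension_right)+
  have J: "J (basis_vec T) (basis_vec S) = basis_vec ((`) Inl ` S \<union> (`) Inr ` T)" for T S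
    by (simp add: J_def)
  have inj: "Inl ` A = Inl ` B \<longleftrightarrow> A = B" "Inr ` C = Inr ` D \<longleftrightarrow> C = D" for A B :: "'a set" and C D :: "'b set"
    by (auto simp: inj_image_eq_iff)
  have right: "J y (dot_action C x) = dot_action (Inl ` C) (J y x)" if "C \<noteq> {}" for y x C
  proof (rule bilinear_eq[of "\<lambda>y x. J y (dot_action C x)" "\<lambda>y x. dot_action (Inl ` C) (J y x)"])
    fix T :: "'b set set" and S :: "'a set set"
    have "Inl ` C \<in> (`) Inl ` S \<union> (`) Inr ` T \<longleftrightarrow> C \<in> S" using that by (auto simp: inj)
    moreover have "(`) Inl ` (S - {C}) \<union> (`) Inr ` T = (`) Inl ` S \<union> (`) Inr ` T - {Inl ` C}"
      using that by (auto simp: inj)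
    ultimately show "J (basis_vec T) (dot_action C (basis_vec S)) = dot_action (Inl ` C) (J (basis_vec T) (basis_vec S))"
      by (cases "C \<in> S") (simp_all add: dot_action_basis J module_hom.add[OF lin(2)] module_hom.scale[OF lin(2)])
  qed (intro lin linear_map_dot_action_compose linear_map_compose[OF linear_map_dot_action])+
  have left: "J (dot_action C y) x = dot_action (Inr ` C) (J y x)" if "C \<noteq> {}" for y x C
  proof (rule bilinear_eq[of "\<lambda>y x. J (dot_action C y) x" "\<lambda>y x. dot_action (Inr ` C) (J y x)"])
    fix T :: "'b set set" and S :: "'a set set"
    have "Inr ` C \<in> (`) Inl ` S \<union> (`) Inr ` T \<longleftrightarrow> C \<in> T" using that by (auto simp: inj)
    moreover have "(`) Inl ` S \<union> (`) Inr ` (T - {C}) = (`) Inl ` S \<union> (`) Inr ` T - {Inr ` C}"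
      using that by (auto simp: inj)
    ultimately show "J (dot_action C (basis_vec T)) (basis_vec S) = dot_action (Inr ` C) (J (basis_vec T) (basis_vec S))"
      by (cases "C \<in> T") (simp_all add: dot_action_basis J module_hom.add[OF lin(1)] module_hom.scale[OF lin(1)])
  qed (intro lin linear_map_dot_action_compose linear_map_compose[OF linear_map_dot_action lin(1)])+
  have "J (basis_vec {}) (dots \<kappa> m) = dots \<kappa>'' (image_mset Inl m)"
    by (induction m) (simp_all add: J right assms)
  then have "J (dots \<kappa>' m') (dots \<kappa> m) = dots \<kappa>'' (image_mset Inl m + image_mset Inr m')"
    by (induction m') (simp_all add: left assms)
  then show ?thesis by (simp add: J_def)
qed

text \<open>The interpretation in \<open>sorted_arcs\<close> speaks about lists sorted by an
  explicit order, the product of the arc ring about those of the type class; the next two lemmas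
  identify them.\<close>

lemma linorder_insort_key_eq: "linorder.insort_key (\<le>) = (insort_key :: ('a \<Rightarrow> 'b::linorder) \<Rightarrow> _)"
proof (intro ext)
  fix f :: "'a \<Rightarrow> 'b" and x xs
  show "linorder.insort_key (\<le>) f x xs = insort_key f x xs"
    by (induction xs) (simp_all add: linorder.insort_key.simps[OF linorder_class.linorder_axioms])
qed

lemma linorder_sorted_key_list_of_set_eq:
  "linorder.sorted_key_list_of_set (\<le>) = (sorted_key_list_of_set :: ('a \<Rightarrow> 'b::linorder) \<Rightarrow> _)"
  by (intro ext) (simp add: sorted_key_list_of_set_def
      linorder.sorted_key_list_of_set_def[OF linorder_class.linorder_axioms] linorder_insort_key_eq)

lemma sorted_arcs:
  assumes "b \<in> crossingless_matchings n"
  shows "set (sorted_key_list_of_set fst b) = b"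
    and "sorted_wrt (<) (map fst (sorted_key_list_of_set fst b))"
proof -
  have "e = e'" if "e \<in> b" "e' \<in> b" "fst e = fst e'" for e e'
  proof -
    have "mate b (fst e) (snd e)" "mate b (fst e) (snd e')"
      using that unfolding mate_def by (metis prod.collapse)+
    then show ?thesis using crossinglessD(3)[OF assms] that(3) by (auto simp: prod_eq_iff)
  qed
  then interpret folding_insort_key "(\<le>)" "(<)" b fst
    by unfold_locales (auto intro: inj_onI)
  show "set (sorted_key_list_of_set fst b) = b"
    "sorted_wrt (<) (map fst (sorted_key_list_of_set fst b))"
    using set_sorted_key_list_of_set[of b] strict_sorted_key_list_of_set[of b]
      crossinglessD(5)[OF assms] unfolding linorder_sorted_key_list_of_set_eq by simp_all
qed

text \<open>The common frame for products with the mirror image and products with a unit.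
  \<open>I\<close> is the set of arcs whose saddles split. What remains is to place the factors side
  by side, apply the saddles, restrict the circles to one line and forget the line of each
  point.\<close>

lemma arc_mult_dots:
  fixes m m' :: "nat multiset"
  assumes a: "a \<in> crossingless_matchings n" and b: "b \<in> crossingless_matchings n"
    and d: "d \<in> crossingless_matchings n"
    and m: "set_mset m \<subseteq> {1..2 * n}" "set_mset m' \<subseteq> {1..2 * n}" and "I \<subseteq> b"
    and saddles: "\<And>f :: (nat + nat, 'k::field poly poly) dot_poly.
      saddles d a {} (sorted_key_list_of_set fst b) (eval_dots (component (stacked d a b {})) f)
      = eval_dots (component (stacked d a {} b)) (f * (\<Prod>e\<in>I. dual (Inl (fst e)) (Inl (snd e))))"
  shows "arc_mult (embed_hom d b (dots (component (d \<union> b)) m')) (embed_hom b a (dots (component (a \<union> b)) m))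
    = embed_hom d a (eval_dots (component (a \<union> d)) (basis_vec (m + m') * (\<Prod>e\<in>I. dual (fst e) (snd e)))
        :: nat set set \<Rightarrow>\<^sub>0 'k poly poly)"
proof -
  let ?es = "sorted_key_list_of_set fst b"
  let ?\<kappa> = "component (stacked d a {} b)"
  let ?\<pi> = "case_sum id id :: nat + nat \<Rightarrow> nat"
  define \<rho> where "\<rho> C = Inl -` C" for C :: "(nat + nat) set"
  define F :: "((nat + nat) set set \<Rightarrow>\<^sub>0 'k poly poly) \<Rightarrow> (arc_basis \<Rightarrow>\<^sub>0 'k poly poly)"
    where "F = (\<lambda>x. linear_extension (\<lambda>S. basis_vec (d, a, \<rho> ` S)) (saddles d a {} ?es x))"
  define J where "J = bilinear_extension (\<lambda>T S. basis_vec ((`) Inl ` S \<union> (`) Inr ` T)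
    :: (nat + nat) set set \<Rightarrow>\<^sub>0 'k poly poly)"
  have lin_F: "linear_map F"
    unfolding F_def by (rule linear_map_compose[OF linear_map_saddles linear_map_extension])
  have "arc_mult (embed_hom d b y) (embed_hom b a x) = F (J y x)" for x y
    unfolding arc_mult_eq
  proof (rule bilinear_eq[of "\<lambda>y x. bilinear_extension arc_mult_basis (embed_hom d b y) (embed_hom b a x)"
        "\<lambda>y x. F (J y x)"])
    show "bilinear_extension arc_mult_basis (embed_hom d b (basis_vec T)) (embed_hom b a (basis_vec S))
        = F (J (basis_vec T) (basis_vec S))" for S T
      by (simp add: J_def F_def \<rho>_def)
  qed (unfold J_def, auto intro: linear_map_compose[OF _ lin_F]
      linear_map_compose[OF linear_map_embed_hom linear_map_bilinear_extension_left]
      linear_map_compose[OF linear_map_embed_hom linear_map_bilinear_extension_right])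
  then have "arc_mult (embed_hom d b (dots (component (d \<union> b)) m')) (embed_hom b a (dots (component (a \<union> b)) m))
      = F (J (dots (component (d \<union> b)) m') (dots (component (a \<union> b)) m))" by simp
  also have "J (dots (component (d \<union> b)) m') (dots (component (a \<union> b)) m)
      = dots (component (stacked d a b {})) (image_mset Inl m + image_mset Inr m')"
    unfolding J_def using component_refl
    by (intro juxtapose_dots component_stacked_start) blast+
  also have "F \<dots> = linear_extension (\<lambda>S. basis_vec (d, a, \<rho> ` S))
      (eval_dots ?\<kappa> (basis_vec (image_mset Inl m + image_mset Inr m') * (\<Prod>e\<in>I. dual (Inl (fst e)) (Inl (snd e)))))"
    unfolding F_def using saddles[of "basis_vec (image_mset Inl m + image_mset Inr m')"] by simp
  also have "\<dots> = embed_hom d a (linear_extension (\<lambda>S. basis_vec (\<rho> ` S))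
      (eval_dots ?\<kappa> (basis_vec (image_mset Inl m + image_mset Inr m') * (\<Prod>e\<in>I. dual (Inl (fst e)) (Inl (snd e))))))"
    (is "_ = embed_hom d a (_ (eval_dots _ ?f))")
    by (rule linear_map_eq[of _ "\<lambda>x. embed_hom d a (linear_extension (\<lambda>S. basis_vec (\<rho> ` S)) x)"])
      (auto intro: linear_map_compose)
  also have "linear_extension (\<lambda>S. basis_vec (\<rho> ` S)) (eval_dots ?\<kappa> ?f)
      = eval_dots (component (a \<union> d)) (rename_points ?\<pi> ?f)"
  proof -
    let ?V = "?\<pi> -` {1..2 * n}"
    have "fst e \<in> {1..2 * n} \<and> snd e \<in> {1..2 * n}" if "e \<in> I" for e
      using \<open>I \<subseteq> b\<close> that crossinglessD(1)[OF b, of "fst e" "snd e"] by auto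
    then have f: "?f \<in> dot_polys ?V"
      using m by (intro dot_polys_times dot_polys_prod dot_polys_dual) auto
    have \<kappa>: "?\<kappa> v = ?\<kappa> (Inl (?\<pi> v))" "\<rho> (?\<kappa> v) = component (a \<union> d) (?\<pi> v)" if "v \<in> ?V" for v
      using component_stacked_end[OF a b d, of "?\<pi> v"] that by (cases v; simp add: \<rho>_def)+
    \<comment> \<open>A circle of the final diagram is determined by its points on the lower line,
      since both copies of a point lie on the same circle.\<close>
    have "inj_on \<rho> (?\<kappa> ` ?V)"
    proof (rule inj_onI)
      fix C C' assume C: "C \<in> ?\<kappa> ` ?V" "C' \<in> ?\<kappa> ` ?V" "\<rho> C = \<rho> C'"
      from C(1) obtain v where v: "v \<in> ?V" "C = ?\<kappa> v" by (rule imageE)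
      from C(2) obtain w where w: "w \<in> ?V" "C' = ?\<kappa> w" by (rule imageE)
      have vw: "v \<in> ?V" "\<rho> (?\<kappa> v) = \<rho> (?\<kappa> w)" using v w C(3) by simp_all
      have "?\<pi> v \<in> \<rho> (?\<kappa> w)" using \<kappa>(2)[OF vw(1)] vw(2) component_refl by metis
      then have "Inl (?\<pi> v) \<in> ?\<kappa> w" by (simp add: \<rho>_def)
      then show "C = C'" unfolding v(2) w(2) using \<kappa>(1)[OF vw(1)] component_eq by metis
    qed
    then have "linear_extension (\<lambda>S. basis_vec (\<rho> ` S)) (eval_dots ?\<kappa> ?f) = eval_dots (\<lambda>v. \<rho> (?\<kappa> v)) ?f"
      by (rule eval_dots_rename_circles[OF f])
    also have "\<dots> = eval_dots (\<lambda>v. component (a \<union> d) (?\<pi> v)) ?f"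
      using f \<kappa>(2) by (rule eval_dots_cong)
    finally show ?thesis by (simp add: eval_dots_rename_points)
  qed
  also have "rename_points ?\<pi> ?f = basis_vec (m + m') * (\<Prod>e\<in>I. dual (fst e) (snd e))"
    by (simp add: rename_points_times rename_points_prod) (simp add: rename_points_def multiset.map_comp comp_def)
  finally show ?thesis .
qed

text \<open>On each circle of W(b)a this omits one arc of \<open>b\<close>, the one that starts at
  the smallest point of the circle and whose saddle merges.\<close>

definition split_arcs :: "matching \<Rightarrow> matching \<Rightarrow> (nat \<times> nat) set"
  where "split_arcs a b = {e \<in> b. \<exists>v<fst e. v \<in> component (a \<union> b) (fst e)}"

definition split_product :: "matching \<Rightarrow> matching \<Rightarrow> 'k::field point_poly"
  where "split_product a b = (\<Prod>e\<in>split_arcs a b. dual (fst e) (snd e))"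

lemma arc_mult_mirror:
  assumes a: "a \<in> crossingless_matchings n" and b: "b \<in> crossingless_matchings n"
    and m: "set_mset m \<subseteq> {1..2 * n}" "set_mset m' \<subseteq> {1..2 * n}"
  shows "arc_mult (embed_hom a b (dots (component (a \<union> b)) m')) (embed_hom b a (dots (component (a \<union> b)) m))
    = (embed_hom a a (eval_dots (component a) (basis_vec (m + m') * split_product a b))
        :: arc_basis \<Rightarrow>\<^sub>0 'k::field poly poly)"
  unfolding split_product_def
proof (subst arc_mult_dots[OF a b a m])
  show "split_arcs a b \<subseteq> b" by (auto simp: split_arcs_def)
  show "saddles a a {} (sorted_key_list_of_set fst b) (eval_dots (component (stacked a a b {})) f)
      = eval_dots (component (stacked a a {} b)) (f * (\<Prod>e\<in>split_arcs a b. dual (Inl (fst e)) (Inl (snd e))))"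
    for f :: "(nat + nat, 'k poly poly) dot_poly"
    using saddles_mirror[OF a b sorted_arcs(2)[OF b], of "{}" f] sorted_arcs(1)[OF b]
    by (simp add: split_arcs_def)
qed simp

lemma arc_mult_unit:
  assumes a: "a \<in> crossingless_matchings n" and d: "d \<in> crossingless_matchings n"
    and m: "set_mset m \<subseteq> {1..2 * n}"
  shows "arc_mult (embed_hom d a (dots (component (d \<union> a)) m)) (basis_vec (a, a, {}))
    = (embed_hom d a (dots (component (d \<union> a)) m) :: arc_basis \<Rightarrow>\<^sub>0 'k::field poly poly)"
proof -
  have "arc_mult (embed_hom d a (dots (component (d \<union> a)) m)) (embed_hom a a (dots (component (a \<union> a)) {#}))
      = (embed_hom d a (eval_dots (component (a \<union> d)) (basis_vec ({#} + m) * (\<Prod>e\<in>{}. dual (fst e) (snd e))))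
        :: arc_basis \<Rightarrow>\<^sub>0 'k poly poly)"
  proof (rule arc_mult_dots[OF a a d _ m])
    show "saddles d a {} (sorted_key_list_of_set fst a) (eval_dots (component (stacked d a a {})) f)
        = eval_dots (component (stacked d a {} a)) (f * (\<Prod>e\<in>{}. dual (Inl (fst e)) (Inl (snd e))))"
      for f :: "(nat + nat, 'k poly poly) dot_poly"
      using saddles_unit[OF a sorted_arcs(2)[OF a], of "{}" d f] sorted_arcs(1)[OF a] by simp
  qed auto
  then show ?thesis by (simp add: Un_commute)
qed

subsection \<open>Dotted matchings as values of dot polynomials\<close>

text \<open>Formulated through the component, so that the arc can be recovered from the circle of
  W(m)m alone; see \<open>arc_at_eq\<close>.\<close>

definition arc_at :: "matching \<Rightarrow> nat \<Rightarrow> nat \<times> nat"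
  where "arc_at m v = (Min (component m v), Max (component m v))"

lemma arc_at_mate:
  assumes "m \<in> crossingless_matchings n" "mate m p q"
  shows "arc_at m p = (min p q, max p q)"
  using component_matching[OF assms] by (simp add: arc_at_def)

lemma arc_at_arc:
  assumes "m \<in> crossingless_matchings n" "(i, j) \<in> m"
  shows "arc_at m i = (i, j)" "arc_at m j = (i, j)"
proof -
  have "mate m i j" "mate m j i" "i < j"
    using assms crossinglessD(1)[OF assms] by (auto simp: mate_def)
  then show "arc_at m i = (i, j)" "arc_at m j = (i, j)"
    using arc_at_mate[OF assms(1)] by auto
qed

lemma arc_at_in:
  assumes "m \<in> crossingless_matchings n" "v \<in> {1..2 * n}"
  shows "arc_at m v \<in> m" "v = fst (arc_at m v) \<or> v = snd (arc_at m v)"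
proof -
  obtain q where "mate m v q" using crossinglessD(2)[OF assms] by blast
  then have "\<exists>e\<in>m. (e = (v, q) \<or> e = (q, v)) \<and> arc_at m v = e"
    using arc_at_arc[OF assms(1)] by (auto simp: mate_def)
  then show "arc_at m v \<in> m" "v = fst (arc_at m v) \<or> v = snd (arc_at m v)" by auto
qed

text \<open>The counterpart of \<open>eval_dots\<close> for dotted matchings. Repeated dots on an
  arc are kept here, and dot reduction appears as a relation.\<close>

definition dotted_value :: "matching \<Rightarrow> 'k::field point_poly \<Rightarrow> (dotted \<Rightarrow>\<^sub>0 'k poly poly)"
  where "dotted_value a = linear_extension (\<lambda>m. basis_vec (a, image_mset (arc_at a) m))"

lemma linear_map_dotted_value [simp, intro]: "linear_map (dotted_value a)"
  by (simp add: dotted_value_def)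

lemmas dotted_value_add [simp] = module_hom.add[OF linear_map_dotted_value]
lemmas dotted_value_scale [simp] = module_hom.scale[OF linear_map_dotted_value]
lemmas dotted_value_diff [simp] = module_hom.diff[OF linear_map_dotted_value]

lemma dotted_value_basis_vec: "dotted_value a (basis_vec m) = basis_vec (a, image_mset (arc_at a) m)"
  by (simp add: dotted_value_def)

lemma dotted_value_var_cong:
  assumes "arc_at a u = arc_at a v"
  shows "dotted_value a (var u * f) = dotted_value a (var v * f)"
proof -
  have lin: "linear_map (\<lambda>f. dotted_value a (var w * f))" for w
    using linear_map_compose[OF linear_map_times[OF poly_mapping_module.module_hom_ident] linear_map_dotted_value]
    by (simp add: mult.commute[of "var w"])
  show ?thesis
    by (rule linear_map_eq[OF lin lin])
      (simp add: single_add_mset[symmetric] dotted_value_basis_vec assms)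
qed

lemma dual_commute: "dual u v = dual v u"
  by (simp add: dual_def add.commute)

lemma dotted_value_dual_cong:
  assumes "arc_at a u = arc_at a u'" "arc_at a v = arc_at a v'"
  shows "dotted_value a (dual u v * f) = dotted_value a (dual u' v' * f)"
proof -
  have "dual x y * f = var x * f + var y * f - hh \<odot> f" for x y
    by (simp add: dual_def scale_eq_times algebra_simps)
  then show ?thesis using dotted_value_var_cong[OF assms(1), of f] dotted_value_var_cong[OF assms(2), of f] by simp
qed

section \<open>Relations of the graphical module in terms of polynomials\<close>

abbreviation graphical_relations :: "nat \<Rightarrow> (dotted \<Rightarrow>\<^sub>0 'k::field poly poly) set"
  where "graphical_relations n \<equiv>
    poly_mapping_module.span (dot_reductions n \<union> type_I_relations n \<union> type_II_relations n)"

lemma linear_map_times_left: "linear_map (\<lambda>f. (g :: ('v, 'r::comm_ring_1) dot_poly) * f)"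
  using linear_map_times[OF poly_mapping_module.module_hom_ident, of g] by (simp add: mult.commute[of g])

lemma dotted_value_dot_reduction:
  fixes f :: "'k::field point_poly"
  assumes "a \<in> crossingless_matchings n" "v \<in> {1..2 * n}" "f \<in> dot_polys {1..2 * n}"
  shows "dotted_value a ((var v * var v - (hh \<odot> var v + tt \<odot> 1)) * f) \<in> graphical_relations n"
proof -
  let ?r = "var v * var v - (hh \<odot> var v + tt \<odot> 1) :: 'k point_poly"
  show ?thesis
  proof (rule linear_map_in_submodule[of "\<lambda>f. dotted_value a (?r * f)"])
    show "linear_map (\<lambda>f. dotted_value a (?r * f))"
      by (rule linear_map_compose[OF linear_map_times_left linear_map_dotted_value])
    fix m assume "m \<in> Poly_Mapping.keys f"
    then have m: "set_mset m \<subseteq> {1..2 * n}" using assms(3) by (auto simp: free_module_def)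
    let ?m = "basis_vec m :: 'k point_poly"
    let ?D = "image_mset (arc_at a) m" and ?e = "arc_at a v"
    have "?r * ?m
        = basis_vec (add_mset v (add_mset v m)) - (hh \<odot> basis_vec (add_mset v m) + tt \<odot> basis_vec m)"
      by (simp add: single_add_mset scale_eq_times algebra_simps)
    then have "dotted_value a (?r * ?m)
        = basis_vec (a, ?D + {#?e, ?e#}) - (hh \<odot> basis_vec (a, ?D + {#?e#}) + tt \<odot> basis_vec (a, ?D))"
      by (simp add: dotted_value_basis_vec)
    moreover have "(a, ?D) \<in> dotted_matchings n" "?e \<in> a"
      using assms m arc_at_in(1)[OF assms(1)] by (auto simp: dotted_matchings_def)
    ultimately have "dotted_value a (?r * ?m) \<in> dot_reductions n"
      unfolding dot_reductions_def by blast
    then show "dotted_value a (?r * ?m) \<in> graphical_relations n"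
      by (intro poly_mapping_module.span_base) simp
  qed simp
qed

lemma replicate_mset_plus: "replicate_mset (k + l) x = replicate_mset k x + replicate_mset l x"
  by (induction k) simp_all

locale surgery_configuration =
  fixes n :: nat and C :: matching and a b c d :: nat
  assumes less: "a < b" "b < c" "c < d"
    and A: "C \<union> {(a, b), (c, d)} \<in> crossingless_matchings n"
    and A': "C \<union> {(a, d), (b, c)} \<in> crossingless_matchings n"
begin

abbreviation "A1 \<equiv> C \<union> {(a, b), (c, d)}"
abbreviation "A2 \<equiv> C \<union> {(a, d), (b, c)}"

lemma mates: "mate A1 a b" "mate A1 b a" "mate A1 c d" "mate A1 d c"
    "mate A2 a d" "mate A2 d a" "mate A2 b c" "mate A2 c b"
  by (auto simp: mate_def)

text \<open>An arc of \<open>C\<close> belongs to both matchings, but each of a, b, c, d has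
  different partners in them.\<close>

lemma not_in_C:
  assumes "mate C x y" shows "x \<notin> {a, b, c, d}"
proof -
  have xy: "mate A1 x y" "mate A2 x y" using assms by (auto simp: mate_def)
  have "y = z" if "mate A1 x z" for z using crossinglessD(3)[OF A] xy that by blast
  moreover have "y = z" if "mate A2 x z" for z using crossinglessD(3)[OF A'] xy that by blast
  ultimately show ?thesis using mates less by fastforce
qed

lemma in_range: "{a, b, c, d} \<subseteq> {1..2 * n}"
  using mates crossinglessD(6)[OF A] by blast

lemma mate_C_if:
  assumes "v \<in> {1..2 * n}" "v \<notin> {a, b, c, d}"
  obtains w where "mate C v w"
proof -
  obtain w where w: "mate A1 v w" using crossinglessD(2)[OF A assms(1)] by blast
  then have "mate C v w" using assms(2) by (auto simp: mate_def)
  then show ?thesis by (rule that)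
qed

lemma arc_at_A1: "arc_at A1 a = (a, b)" "arc_at A1 b = (a, b)" "arc_at A1 c = (c, d)" "arc_at A1 d = (c, d)"
  using arc_at_arc[OF A, of a b] arc_at_arc[OF A, of c d] by auto

lemma arc_at_A2: "arc_at A2 a = (a, d)" "arc_at A2 d = (a, d)" "arc_at A2 b = (b, c)" "arc_at A2 c = (b, c)"
  using arc_at_arc[OF A', of a d] arc_at_arc[OF A', of b c] by auto

lemma arc_at_rest:
  assumes "v \<in> {1..2 * n}" "v \<notin> {a, b, c, d}"
  shows "arc_at A2 v = arc_at A1 v" "arc_at A1 v \<in> C"
proof -
  obtain w where w: "mate C v w" using mate_C_if[OF assms] .
  then have "mate A1 v w" "mate A2 v w" by (auto simp: mate_def)
  then have eq: "arc_at A1 v = (min v w, max v w)" "arc_at A2 v = (min v w, max v w)"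
    using arc_at_mate A A' by blast+
  then show "arc_at A2 v = arc_at A1 v" by simp
  have "arc_at A1 v \<in> A1" using arc_at_in(1)[OF A assms(1)] .
  moreover have "arc_at A1 v \<noteq> (a, b)" "arc_at A1 v \<noteq> (c, d)"
    using arc_at_in(2)[OF A assms(1)] assms(2) by auto
  ultimately show "arc_at A1 v \<in> C" by auto
qed

text \<open>The dots of the monomial that lie on \<open>C\<close>. Its multiplicities at a, b, c, d
  are the numbers of extra dots near the endpoints.\<close>

definition rest :: "nat multiset \<Rightarrow> (nat \<times> nat) multiset"
  where "rest m = image_mset (arc_at A1) {#v \<in># m. v \<notin> {a, b, c, d}#}"

lemma decompose: "m = {#v \<in># m. v \<notin> {a, b, c, d}#} + replicate_mset (count m a) a
    + replicate_mset (count m b) b + replicate_mset (count m c) c + replicate_mset (count m d) d"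
  using less by (intro multiset_eqI) auto

lemma dotted_value_A1:
  "dotted_value A1 (basis_vec m)
    = with_arcs C (rest m) (a, b) (count m a + count m b) (c, d) (count m c + count m d)"
proof -
  have "image_mset (arc_at A1) m = rest m + replicate_mset (count m a + count m b) (a, b)
      + replicate_mset (count m c + count m d) (c, d)"
    by (subst decompose) (simp add: rest_def arc_at_A1 replicate_mset_plus del: Un_insert_right)
  then show ?thesis by (simp add: dotted_value_basis_vec with_arcs_def)
qed

lemma dotted_value_A2:
  assumes "set_mset m \<subseteq> {1..2 * n}"
  shows "dotted_value A2 (basis_vec m)
    = with_arcs C (rest m) (a, d) (count m a + count m d) (b, c) (count m b + count m c)"
proof -
  have "image_mset (arc_at A2) {#v \<in># m. v \<notin> {a, b, c, d}#} = rest m"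
    unfolding rest_def by (rule image_mset_cong) (use assms arc_at_rest(1) in auto)
  then have "image_mset (arc_at A2) m = rest m + replicate_mset (count m a + count m d) (a, d)
      + replicate_mset (count m b + count m c) (b, c)"
    by (subst decompose) (simp add: arc_at_A2 replicate_mset_plus del: Un_insert_right)
  then show ?thesis by (simp add: dotted_value_basis_vec with_arcs_def)
qed

lemma rest_add [simp]: "v \<in> {a, b, c, d} \<Longrightarrow> rest (add_mset v m) = rest m"
  by (auto simp: rest_def)

lemma dual_times_basis_vec:
  "dual u v * basis_vec m = basis_vec (add_mset u m) + basis_vec (add_mset v m) - hh \<odot> basis_vec m"
  by (simp add: dual_def single_add_mset scale_eq_times algebra_simps)

text \<open>In \<open>A1\<close> the points b and c mark the arcs ab and cd, in \<open>A2\<close>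
  the points a and b mark ad and bc. Thus each side of the type I relation is a multiple of
  \<Delta>(1).\<close>

lemma type_I_eq:
  assumes "set_mset m \<subseteq> {1..2 * n}"
  shows "dotted_value A1 (dual b c * basis_vec m) - dotted_value A2 (dual a b * basis_vec m)
    = (with_arcs C (rest m) (a, b) (count m a + count m b + 1) (c, d) (count m c + count m d)
        + with_arcs C (rest m) (a, b) (count m a + count m b) (c, d) (count m c + count m d + 1)
        - hh \<odot> with_arcs C (rest m) (a, b) (count m a + count m b) (c, d) (count m c + count m d))
     - (with_arcs C (rest m) (a, d) (count m a + count m d + 1) (b, c) (count m b + count m c)
        + with_arcs C (rest m) (a, d) (count m a + count m d) (b, c) (count m b + count m c + 1)
        - hh \<odot> with_arcs C (rest m) (a, d) (count m a + count m d) (b, c) (count m b + count m c))"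
proof -
  have "set_mset (add_mset v m) \<subseteq> {1..2 * n}" if "v \<in> {a, b, c, d}" for v
    using assms in_range that by auto
  then have A2: "dotted_value A2 (basis_vec (add_mset v m)) = with_arcs C (rest (add_mset v m)) (a, d)
      (count (add_mset v m) a + count (add_mset v m) d) (b, c) (count (add_mset v m) b + count (add_mset v m) c)"
    if "v \<in> {a, b, c, d}" for v using that by (intro dotted_value_A2)
  show ?thesis
    by (simp only: dual_times_basis_vec dotted_value_add dotted_value_diff dotted_value_scale
        dotted_value_A1 dotted_value_A2[OF assms] A2 insert_iff simp_thms) (use less in simp)
qed

lemma type_II_eq:
  assumes "set_mset m \<subseteq> {1..2 * n}"
  shows "dotted_value A1 ((var b * var c + tt \<odot> 1) * basis_vec m)
      - dotted_value A2 ((var a * var b + tt \<odot> 1) * basis_vec m)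
    = (with_arcs C (rest m) (a, b) (count m a + count m b + 1) (c, d) (count m c + count m d + 1)
        + tt \<odot> with_arcs C (rest m) (a, b) (count m a + count m b) (c, d) (count m c + count m d))
     - (with_arcs C (rest m) (a, d) (count m a + count m d + 1) (b, c) (count m b + count m c + 1)
        + tt \<odot> with_arcs C (rest m) (a, d) (count m a + count m d) (b, c) (count m b + count m c))"
proof -
  have "set_mset (add_mset v (add_mset w m)) \<subseteq> {1..2 * n}" if "v \<in> {a, b, c, d}" "w \<in> {a, b, c, d}" for v w
    using assms in_range that by auto
  then have A2: "dotted_value A2 (basis_vec (add_mset v (add_mset w m))) = with_arcs C (rest (add_mset v (add_mset w m))) (a, d)
      (count (add_mset v (add_mset w m)) a + count (add_mset v (add_mset w m)) d) (b, c)
      (count (add_mset v (add_mset w m)) b + count (add_mset v (add_mset w m)) c)"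
    if "v \<in> {a, b, c, d}" "w \<in> {a, b, c, d}" for v w using that by (intro dotted_value_A2)
  have mult: "(var u * var v + tt \<odot> 1) * basis_vec m = basis_vec (add_mset u (add_mset v m)) + tt \<odot> basis_vec m" for u v
    by (simp add: single_add_mset scale_eq_times algebra_simps)
  show ?thesis
    by (simp only: mult dotted_value_add dotted_value_scale
        dotted_value_A1 dotted_value_A2[OF assms] A2 insert_iff simp_thms) (use less in simp)
qed

lemma local_configuration:
  assumes "set_mset m \<subseteq> {1..2 * n}"
  shows "(C, rest m, a, b, c, d) \<in> local_configurations n"
proof -
  have "set_mset (rest m) \<subseteq> C" using assms arc_at_rest(2) by (auto simp: rest_def)
  then show ?thesis using less A A' by (simp add: local_configurations_def)
qed

lemma dotted_value_surgery:
  fixes f :: "'k::field point_poly"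
  assumes "f \<in> dot_polys {1..2 * n}"
  shows "dotted_value A1 (dual b c * f) - dotted_value A2 (dual a b * f) \<in> graphical_relations n"
proof (rule linear_map_in_submodule[of "\<lambda>f. dotted_value A1 (dual b c * f) - dotted_value A2 (dual a b * f)"])
  show "linear_map (\<lambda>f. dotted_value A1 (dual b c * f) - dotted_value A2 (dual a b * f))"
    by (intro linear_map_diff linear_map_compose[OF linear_map_times_left linear_map_dotted_value])
  fix m assume "m \<in> Poly_Mapping.keys f"
  then have m: "set_mset m \<subseteq> {1..2 * n}" using assms by (auto simp: free_module_def)
  have "dotted_value A1 (dual b c * basis_vec m) - dotted_value A2 (dual a b * (basis_vec m :: 'k point_poly)) \<in> type_I_relations n"
    unfolding type_I_eq[OF m] type_I_relations_def
    by (rule CollectI, rule exI[of _ C], rule exI[of _ "rest m"], rule exI[of _ a], rule exI[of _ b],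
        rule exI[of _ c], rule exI[of _ d], rule exI[of _ "count m a"], rule exI[of _ "count m b"],
        rule exI[of _ "count m c"], rule exI[of _ "count m d"])
      (intro conjI refl local_configuration[OF m])
  then show "dotted_value A1 (dual b c * basis_vec m) - dotted_value A2 (dual a b * (basis_vec m :: 'k point_poly)) \<in> graphical_relations n"
    by (intro poly_mapping_module.span_base) blast
qed simp

text \<open>Every decoration allowed in a relation comes from a monomial: a dot on an arc of
  \<open>C\<close> is put at its left endpoint. Hence \<open>type_I_eq\<close> and
  \<open>type_II_eq\<close> reach all generators.\<close>

lemma monomial_exists:
  assumes "set_mset D \<subseteq> C"
  obtains m where "set_mset m \<subseteq> {1..2 * n}" "rest m = D"
    "count m a = p" "count m b = q" "count m c = r" "count m d = s"
proof -
  define m0 where "m0 = image_mset fst D"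
  define m where "m = m0 + replicate_mset p a + replicate_mset q b + replicate_mset r c + replicate_mset s d"
  have D: "fst e \<in> {1..2 * n} \<and> fst e \<notin> {a, b, c, d} \<and> arc_at A1 (fst e) = e" if "e \<in># D" for e
  proof -
    have e: "(fst e, snd e) \<in> C" using assms that by auto
    then have "mate C (fst e) (snd e)" "mate A1 (fst e) (snd e)" by (auto simp: mate_def)
    then show ?thesis
      using not_in_C crossinglessD(6)[OF A] arc_at_arc(1)[OF A, of "fst e" "snd e"] e by auto
  qed
  have "set_mset m \<subseteq> {1..2 * n}" using D in_range by (auto simp: m_def m0_def split: if_splits)
  moreover have m0: "x \<notin># m0" if "x \<in> {a, b, c, d}" for x
    using D that by (auto simp: m0_def)
  then have "count m a = p" "count m b = q" "count m c = r" "count m d = s"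
    using less by (auto simp: m_def not_in_iff)
  moreover have "{#v \<in># m. v \<notin> {a, b, c, d}#} = {#v \<in># m0. v \<notin> {a, b, c, d}#}"
    by (simp add: m_def)
  moreover have "{#v \<in># m0. v \<notin> {a, b, c, d}#} = m0"
    using m0 by (auto simp: filter_mset_eq_conv)
  moreover have "image_mset (arc_at A1) m0 = D"
    unfolding m0_def multiset.map_comp comp_def using D by (simp cong: image_mset_cong)
  ultimately show ?thesis by (intro that[of m]) (simp_all add: rest_def)
qed

end

text \<open>The type I relation with the positions of p and q left open. Of the six possible orders
  three would make arcs of \<open>a\<close> cross. The others are instances of type I, two of them
  with the roles of \<open>a\<close> and \<open>a'\<close> exchanged; there, sliding dots along arcs
  gives the stated factors.\<close>

lemma dotted_value_surgery_arcs:
  fixes f :: "'k::field point_poly"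
  assumes a: "a \<in> crossingless_matchings n" and a': "a' \<in> crossingless_matchings n"
    and ai: "a = C \<union> {(min p i, max p i), (min j q, max j q)}"
    and a'i: "a' = C \<union> {(i, j), (min p q, max p q)}"
    and ij: "i < j" and p: "p < i \<or> j < p" and q: "q < i \<or> j < q" and "p \<noteq> q"
    and f: "f \<in> dot_polys {1..2 * n}"
  shows "dotted_value a (dual i j * f) - dotted_value a' (dual p i * f) \<in> graphical_relations n"
proof -
  have m: "mate a p i" "mate a j q" "mate a' i j" "mate a' p q"
    unfolding ai a'i by (auto simp: mate_def min_def max_def)
  then have arcs: "arc_at a p = arc_at a i" "arc_at a j = arc_at a q" "arc_at a' i = arc_at a' j" "arc_at a' p = arc_at a' q"
    using arc_at_mate[OF a] arc_at_mate[OF a'] mate_sym[of a] mate_sym[of a'] by (metis min.commute max.commute)+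
  have neg: "x - y \<in> graphical_relations n" if "y - x \<in> graphical_relations n" for x y :: "dotted \<Rightarrow>\<^sub>0 'k poly poly"
    using poly_mapping_module.span_neg[OF that] by simp
  have nocross: "\<not> (j < p \<and> q < i)"
  proof
    assume *: "j < p \<and> q < i"
    then have "(i, p) \<in> a" "(q, j) \<in> a" using ij unfolding ai by auto
    then show False using crossinglessD(4)[OF a, of q j i p] * ij by simp
  qed
  consider "p < i" "j < q" | "q < p" "p < i" | "p < q" "p < i" "q < i" | "j < p" "j < q" "q < p" | "j < p" "j < q" "p < q"
    using p q nocross \<open>p \<noteq> q\<close> by linarith
  then show ?thesis
  proof cases
    case 1
    then have eqs: "a = C \<union> {(p, i), (j, q)}" "a' = C \<union> {(p, q), (i, j)}"
      using ij unfolding ai a'i by auto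
    then interpret surgery_configuration n C p i j q
      by unfold_locales (use 1 ij a a' in auto)
    show ?thesis using dotted_value_surgery[OF f] by (simp add: eqs)
  next
    case 2
    then have eqs: "a' = C \<union> {(q, p), (i, j)}" "a = C \<union> {(q, j), (p, i)}"
      using ij unfolding ai a'i by auto
    then interpret surgery_configuration n C q p i j
      by unfold_locales (use 2 ij a a' in auto)
    have "dotted_value a' (dual p i * f) - dotted_value a (dual q p * f) \<in> graphical_relations n"
      using dotted_value_surgery[OF f] by (simp add: eqs)
    moreover have "dotted_value a (dual q p * f) = dotted_value a (dual j i * f)"
      by (rule dotted_value_dual_cong) (simp_all only: arcs)
    ultimately show ?thesis by - (rule neg, simp add: dual_commute[of j i])
  next
    case 3
    then have "(p, i) \<in> a" "(q, j) \<in> a" using ij unfolding ai by auto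
    then show ?thesis using crossinglessD(4)[OF a, of p i q j] 3 ij by simp
  next
    case 4
    then have eqs: "a' = C \<union> {(i, j), (q, p)}" "a = C \<union> {(i, p), (j, q)}"
      using ij unfolding ai a'i by auto
    then interpret surgery_configuration n C i j q p
      by unfold_locales (use 4 ij a a' in auto)
    have "dotted_value a' (dual j q * f) - dotted_value a (dual i j * f) \<in> graphical_relations n"
      using dotted_value_surgery[OF f] by (simp add: eqs)
    moreover have "dotted_value a' (dual j q * f) = dotted_value a' (dual i p * f)"
      by (rule dotted_value_dual_cong) (simp_all only: arcs)
    ultimately show ?thesis by - (rule neg, simp add: dual_commute[of i p])
  next
    case 5
    then have "(i, p) \<in> a" "(j, q) \<in> a" using ij unfolding ai by auto
    then show ?thesis using crossinglessD(4)[OF a, of i p j q] 5 ij by simp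
  qed
qed

subsection \<open>The relations between arbitrary pairs of matchings\<close>

lemma dual_min_max: "dual (min u v) (max u v) = dual u v"
  by (auto simp: min_def max_def dual_commute)

lemma mate_closed:
  assumes "m \<in> crossingless_matchings n" "mate m p q" "mate m x y"
  shows "x \<in> {p, q} \<longleftrightarrow> y \<in> {p, q}"
  unfolding component_matching[OF assms(1,2), symmetric]
  using assms(3) component_edge_iff[of x y m p] component_edge_iff[of y x m p]
  unfolding mate_def by blast

lemma graphical_relations_diff_trans:
  assumes "x - y \<in> graphical_relations n" "y - z \<in> graphical_relations n"
  shows "x - z \<in> graphical_relations n"
  using poly_mapping_module.span_add[OF assms] by simp

text \<open>On \<open>b\<close> a dot at j is a dot at i, so the difference is (X_p + X_i - h)(X_p -
  X_i) f. This equals (X_p^2 - h X_p - t) f - (X_i^2 - h X_i - t) f, a combination of dot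
  reductions.\<close>

lemma dotted_value_dual_path:
  fixes f :: "'k::field point_poly"
  assumes b: "b \<in> crossingless_matchings n" and ij: "mate b i j" and p: "p \<in> {1..2 * n}"
    and f: "f \<in> dot_polys {1..2 * n}"
  shows "dotted_value b (dual p i * (dual p q * f)) - dotted_value b (dual p i * (dual j q * f))
    \<in> graphical_relations n"
proof -
  let ?r = "\<lambda>v. var v * var v - (hh \<odot> var v + tt \<odot> 1) :: 'k point_poly"
  have "dotted_value b (dual j q * (dual p i * f)) = dotted_value b (dual i q * (dual p i * f))"
    by (rule dotted_value_dual_cong)
      (use arc_at_mate[OF b] ij mate_sym[of b i j] in \<open>auto simp: min.commute max.commute\<close>)
  then have "dotted_value b (dual p i * (dual p q * f)) - dotted_value b (dual p i * (dual j q * f))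
      = dotted_value b (dual p i * (dual p q * f) - dual p i * (dual i q * f))"
    by (simp add: mult.left_commute[of "dual p i"])
  also have "dual p i * (dual p q * f) - dual p i * (dual i q * f) = ?r p * f - ?r i * f"
    by (simp add: dual_def scale_eq_times algebra_simps)
  finally show ?thesis
    using dotted_value_dot_reduction[OF b _ f] p crossinglessD(6)[OF b ij]
    by (simp add: poly_mapping_module.span_diff)
qed

text \<open>An arc kl that separates p from q separates two neighbours on the path p, i, j, q, and
  so it already crosses pi, ij or jq.\<close>

lemma surgery_noncrossing:
  fixes i j k l p q :: nat
  assumes "i < j" "p < i \<or> j < p" "q < i \<or> j < q"
    and "k \<noteq> i" "k \<noteq> j" "k \<noteq> p" "k \<noteq> q" "l \<noteq> i" "l \<noteq> j" "l \<noteq> p" "l \<noteq> q" "k < l"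
    and "\<not> (k < i \<and> i < l \<and> l < j)" "\<not> (i < k \<and> k < j \<and> j < l)"
    and "\<not> (k < min p i \<and> min p i < l \<and> l < max p i)" "\<not> (min p i < k \<and> k < max p i \<and> max p i < l)"
    and "\<not> (k < min j q \<and> min j q < l \<and> l < max j q)" "\<not> (min j q < k \<and> k < max j q \<and> max j q < l)"
  shows "\<not> (k < min p q \<and> min p q < l \<and> l < max p q) \<and> \<not> (min p q < k \<and> k < max p q \<and> max p q < l)"
proof -
  consider "p < i" "q < i" | "p < i" "j < q" | "j < p" "q < i" | "j < p" "j < q" using assms(2,3) by blast
  then have "\<not> (k < p \<and> p < l \<and> l < q) \<and> \<not> (p < k \<and> k < q \<and> q < l) \<and>
      \<not> (k < q \<and> q < l \<and> l < p) \<and> \<not> (q < k \<and> k < p \<and> p < l)"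
  proof cases
    case 1
    then have eqs: "min p i = p" "max p i = i" "min j q = q" "max j q = j" using assms(1) by auto
    show ?thesis using assms(1,4-14) assms(15-18)[unfolded eqs] 1
      by (metis nat_neq_iff order_less_trans)
  next
    case 2
    then have eqs: "min p i = p" "max p i = i" "min j q = j" "max j q = q" using assms(1) by auto
    show ?thesis using assms(1,4-14) assms(15-18)[unfolded eqs] 2
      by (metis nat_neq_iff order_less_trans)
  next
    case 3
    then have eqs: "min p i = i" "max p i = p" "min j q = q" "max j q = j" using assms(1) by auto
    show ?thesis using assms(1,4-14) assms(15-18)[unfolded eqs] 3
      by (metis nat_neq_iff order_less_trans)
  next
    case 4
    then have eqs: "min p i = i" "max p i = p" "min j q = j" "max j q = q" using assms(1) by auto
    show ?thesis using assms(1,4-14) assms(15-18)[unfolded eqs] 4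
      by (metis nat_neq_iff order_less_trans)
  qed
  then show ?thesis by (simp add: min_def max_def)
qed

text \<open>An arc \<open>(i, j)\<close> of \<open>b\<close> with maximal left endpoint among those not in \<open>a\<close> only encloses
  arcs common to \<open>a\<close> and \<open>b\<close>. Surgery of \<open>a\<close> along it yields a crossingless matching \<open>a'\<close>, and
  splits the circle of \<open>a \<union> b\<close> through \<open>i\<close> into the circle \<open>{i, j}\<close> and its complement.\<close>

locale innermost_difference =
  fixes n :: nat and a b :: matching and i j p q :: nat
  assumes a: "a \<in> crossingless_matchings n" and b: "b \<in> crossingless_matchings n"
    and ij_b: "(i, j) \<in> b" and ij_a: "(i, j) \<notin> a"
    and maximal: "\<And>e. e \<in> b - a \<Longrightarrow> fst e \<le> i"
    and pi: "mate a p i" and jq: "mate a j q"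
begin

definition "C = {e \<in> a. fst e \<notin> {i, j, p, q} \<and> snd e \<notin> {i, j, p, q}}"
definition "a' = C \<union> {(i, j), (min p q, max p q)}"

lemma ij: "i < j" "mate b i j" "mate b j i"
  using crossinglessD(1)[OF b ij_b] ij_b by (auto simp: mate_def)

lemma in_range: "i \<in> {1..2 * n}" "j \<in> {1..2 * n}" "p \<in> {1..2 * n}" "q \<in> {1..2 * n}"
  using crossinglessD(6)[OF a pi] crossinglessD(6)[OF a jq] by auto

lemma a_mates: "mate a p i" "mate a i p" "mate a j q" "mate a q j"
  using pi jq mate_sym[of a] by auto

lemma a_unique: "mate a x y \<Longrightarrow> mate a x z \<Longrightarrow> y = z"
  by (rule crossinglessD(3)[OF a])

lemma b_unique: "mate b x y \<Longrightarrow> mate b x z \<Longrightarrow> y = z"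
  by (rule crossinglessD(3)[OF b])

lemma not_mate_a: "\<not> mate a i j" "\<not> mate a x x"
  using ij_a ij(1) crossinglessD(1)[OF a, of j i] crossinglessD(1)[OF a, of x x] by (auto simp: mate_def)

lemma distinct: "p \<noteq> j" "q \<noteq> i" "p \<noteq> i" "q \<noteq> j" "p \<noteq> q" "i \<noteq> j"
proof -
  show "i \<noteq> j" using ij by simp
  show "p \<noteq> j" "q \<noteq> i" "p \<noteq> i" "q \<noteq> j"
    using a_mates not_mate_a mate_sym[of a] by auto
  show "p \<noteq> q" using a_unique[of p i j] a_mates ij(1) by auto
qed

text \<open>The arc of \<open>b\<close> at x cannot cross (i, j) and therefore stays inside it. Its
  left endpoint exceeds i, so by maximality it is an arc of \<open>a\<close> as well.\<close>

lemma enclosed: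
  assumes "i < x" "x < j" "mate a x y" shows "i < y" "y < j"
proof -
  have "x \<in> {1..2 * n}" using assms in_range by auto
  then obtain z where z: "mate b x z" using crossinglessD(2)[OF b] by blast
  then have "z \<noteq> i" "z \<noteq> j" using ij b_unique mate_sym[of b] assms by (metis less_irrefl)+
  then have iz: "i < z" "z < j"
    using z assms crossinglessD(4)[OF b ij_b, of x z] crossinglessD(4)[OF b _ ij_b, of z x]
      crossinglessD(1)[OF b, of x z] crossinglessD(1)[OF b, of z x] unfolding mate_def by linarith+
  have "mate a x z"
  proof -
    obtain e where e: "e \<in> b" "e = (x, z) \<or> e = (z, x)" using z by (auto simp: mate_def)
    then have "i < fst e" using assms(1) iz by auto
    then have "e \<in> a" using maximal[of e] e(1) by auto
    then show ?thesis using e(2) by (auto simp: mate_def)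
  qed
  then have "z = y" using assms(3) by (rule a_unique)
  then show "i < y" "y < j" using iz by simp_all
qed

lemma outside: "p < i \<or> j < p" "q < i \<or> j < q"
  using enclosed[of p i] enclosed[of q j] a_mates distinct by (meson less_irrefl linorder_neqE_nat)+

lemma a_eq: "a = C \<union> {(min p i, max p i), (min j q, max j q)}"
proof -
  have "(min p i, max p i) \<in> a" "(min j q, max j q) \<in> a"
    using arc_at_in(1)[OF a in_range(1)] arc_at_in(1)[OF a in_range(2)]
      arc_at_mate[OF a a_mates(2)] arc_at_mate[OF a a_mates(3)] by (auto simp: min.commute max.commute)
  moreover have "e = (min p i, max p i) \<or> e = (min j q, max j q)" if e: "e \<in> a" "e \<notin> C" for e
  proof -
    have "fst e \<in> {i, j, p, q} \<or> snd e \<in> {i, j, p, q}" using e unfolding C_def by blast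
    moreover have "arc_at a (fst e) = e" "arc_at a (snd e) = e"
      using arc_at_arc[OF a, of "fst e" "snd e"] e(1) by simp_all
    ultimately have "e \<in> arc_at a ` {i, j, p, q}" by (metis imageI)
    then show ?thesis
      unfolding image_insert image_empty arc_at_mate[OF a a_mates(1)] arc_at_mate[OF a a_mates(2)]
        arc_at_mate[OF a a_mates(3)] arc_at_mate[OF a a_mates(4)]
      by (auto simp: min.commute max.commute)
  qed
  ultimately show ?thesis unfolding C_def by blast
qed

lemma mate_a':
  "mate a' x y \<longleftrightarrow> mate C x y \<or> {x, y} = {i, j} \<or> {x, y} = {p, q}"
  by (auto simp: a'_def mate_def min_def max_def doubleton_eq_iff)

lemma mate_C: "mate C x y \<longleftrightarrow> mate a x y \<and> x \<notin> {i, j, p, q}"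
proof -
  have "y \<notin> {i, j, p, q}" if "mate a x y" "x \<notin> {i, j, p, q}"
  proof -
    have "mate a y x" using that(1) mate_sym by blast
    then show ?thesis
      using a_unique[of i x p] a_unique[of j x q] a_unique[of p x i] a_unique[of q x j] a_mates that(2) by auto
  qed
  then show ?thesis by (auto simp: C_def mate_def)
qed

text \<open>Arcs of \<open>C\<close> do not cross ij by \<open>enclosed\<close> and do not cross pq
  by \<open>surgery_noncrossing\<close>; ij and pq do not cross each other because p and q lie
  outside the interval from i to j.\<close>

lemma a': "a' \<in> crossingless_matchings n"
proof (rule crossinglessI)
  have C: "e \<in> C \<Longrightarrow> e \<in> a" for e by (simp add: C_def)
  show "1 \<le> k \<and> k < l \<and> l \<le> 2 * n" if "(k, l) \<in> a'" for k l
    using that crossinglessD(1)[OF a] crossinglessD(1)[OF b ij_b] in_range distinct C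
    unfolding a'_def by (auto simp: min_def max_def)
  show "\<exists>y. mate a' x y" if "x \<in> {1..2 * n}" for x
    using crossinglessD(2)[OF a that] unfolding mate_a' mate_C by blast
  show "y = z" if "mate a' x y" "mate a' x z" for x y z
  proof (cases "x \<in> {i, j, p, q}")
    case True
    then show ?thesis using that distinct unfolding mate_a' mate_C by (auto simp: doubleton_eq_iff)
  next
    case False
    then have "mate a x y" "mate a x z" using that unfolding mate_a' mate_C by auto
    then show ?thesis by (rule a_unique)
  qed
  have C_ij: "\<not> (k < i \<and> i < l \<and> l < j)" "\<not> (i < k \<and> k < j \<and> j < l)" if "(k, l) \<in> C" for k l
  proof -
    have "mate a k l" "mate a l k" using C[OF that] by (auto simp: mate_def)
    then show "\<not> (k < i \<and> i < l \<and> l < j)" "\<not> (i < k \<and> k < j \<and> j < l)"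
      using enclosed(1)[of l k] enclosed(2)[of k l] by linarith+
  qed
  have C_pq: "\<not> (k < min p q \<and> min p q < l \<and> l < max p q) \<and> \<not> (min p q < k \<and> k < max p q \<and> max p q < l)"
    if kl: "(k, l) \<in> C" for k l
  proof -
    have ends: "k \<noteq> i" "k \<noteq> j" "k \<noteq> p" "k \<noteq> q" "l \<noteq> i" "l \<noteq> j" "l \<noteq> p" "l \<noteq> q" "k < l"
      using kl crossinglessD(1)[OF a, of k l] by (auto simp: C_def)
    have "(min p i, max p i) \<in> a" "(min j q, max j q) \<in> a" by (subst a_eq; blast)+
    then have nc: "\<not> (k < min p i \<and> min p i < l \<and> l < max p i)" "\<not> (min p i < k \<and> k < max p i \<and> max p i < l)"
      "\<not> (k < min j q \<and> min j q < l \<and> l < max j q)" "\<not> (min j q < k \<and> k < max j q \<and> max j q < l)"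
      using crossinglessD(4)[OF a] C[OF kl] by blast+
    show ?thesis
      by (rule surgery_noncrossing[OF ij(1) outside ends C_ij[OF kl] nc])
  qed
  have ij_pq: "\<not> (i < min p q \<and> min p q < j \<and> j < max p q)" "\<not> (min p q < i \<and> i < max p q \<and> max p q < j)"
    using outside by (auto simp: min_def max_def)
  show "\<not> (k < k' \<and> k' < l \<and> l < l')" if arcs: "(k, l) \<in> a'" "(k', l') \<in> a'" for k l k' l'
  proof -
    consider "(k, l) \<in> C" | "(k, l) = (i, j)" | "(k, l) = (min p q, max p q)"
      using arcs(1) unfolding a'_def by blast
    then show ?thesis
    proof cases
      case 1
      consider "(k', l') \<in> C" | "(k', l') = (i, j)" | "(k', l') = (min p q, max p q)"
        using arcs(2) unfolding a'_def by blast
      then show ?thesis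
        using C_ij(1)[OF 1] C_pq[OF 1] crossinglessD(4)[OF a C[OF 1] C] by cases blast+
    next
      case 2
      consider "(k', l') \<in> C" | "(k', l') = (i, j)" | "(k', l') = (min p q, max p q)"
        using arcs(2) unfolding a'_def by blast
      then show ?thesis using C_ij(2)[of k' l'] ij_pq(1) 2 by cases auto
    next
      case 3
      consider "(k', l') \<in> C" | "(k', l') = (i, j)" | "(k', l') = (min p q, max p q)"
        using arcs(2) unfolding a'_def by blast
      then show ?thesis using C_pq[of k' l'] ij_pq(2) 3 by cases auto
    qed
  qed
qed

abbreviation "R \<equiv> component (a \<union> b)"
abbreviation "R' \<equiv> component (a' \<union> b)"

lemma R_mate: "mate a x y \<or> mate b x y \<Longrightarrow> R x = R y"
  using component_edge[of x y "a \<union> b"] component_edge[of y x "a \<union> b"] by (auto simp: mate_def)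

lemma R_pq: "R p = R i" "R j = R i" "R q = R i"
  using R_mate[of p i] R_mate[of i j] R_mate[of j q] a_mates ij by auto

lemma R'_subset: "R' x \<subseteq> R x"
proof (rule component_least)
  fix y z assume "(y, z) \<in> a' \<union> b"
  then have "mate a' y z \<or> mate b y z" by (auto simp: mate_def)
  then have "R y = R z" using R_mate R_pq unfolding mate_a' mate_C by (auto simp: doubleton_eq_iff)
  then show "y \<in> R x \<longleftrightarrow> z \<in> R x" using component_sym[of _ "a \<union> b" x] by simp
qed simp

lemma R'_i: "R' i = {i, j}"
proof
  show "R' i \<subseteq> {i, j}"
  proof (rule component_least)
    fix y z assume "(y, z) \<in> a' \<union> b"
    then have "mate a' y z \<or> mate b y z" by (auto simp: mate_def)
    then show "y \<in> {i, j} \<longleftrightarrow> z \<in> {i, j}"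
      using mate_closed[OF a', of i j y z] mate_closed[OF b ij(2)] by (auto simp: mate_a')
  qed simp
  show "{i, j} \<subseteq> R' i"
    using component_edge_iff[of i j "a' \<union> b" i] ij_b by auto
qed

lemma R'_eq:
  assumes "x \<notin> {i, j}" shows "R' x = R x - {i, j}"
proof
  have "R' j = R' i" using R'_i component_eq[of j "a' \<union> b" i] by simp
  then have "i \<notin> R' x" "j \<notin> R' x"
    using component_sym[of i "a' \<union> b" x] component_sym[of j "a' \<union> b" x] R'_i assms by auto
  then show "R' x \<subseteq> R x - {i, j}" using R'_subset by blast
  \<comment> \<open>Moving i to p and j to q contracts the arcs pi and jq of \<open>a\<close> and
    turns the arc ij of \<open>b\<close> into the arc pq of \<open>a'\<close>. Paths of
    \<open>a \<union> b\<close> thus become paths of \<open>a' \<union> b\<close>.\<close>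
  define c where "c y = (if y = i then p else if y = j then q else y)" for y
  have "c ` R x \<subseteq> R' (c x)"
  proof (rule component_image)
    fix y z assume "(y, z) \<in> a \<union> b"
    then have "mate a y z \<or> mate b y z" by (auto simp: mate_def)
    then have "c y = c z \<or> mate a' (c y) (c z) \<or> mate b (c y) (c z)"
    proof
      assume yz: "mate a y z"
      show ?thesis
      proof (cases "y \<in> {i, j, p, q}")
        case True
        then consider "y = i" "z = p" | "y = j" "z = q" | "y = p" "z = i" | "y = q" "z = j"
          using a_unique[OF yz] a_mates by blast
        then have "c y = c z" using distinct by cases (simp_all add: c_def)
        then show ?thesis by simp
      next
        case False
        then have "mate C y z" using yz by (simp add: mate_C)
        moreover from this have "mate C z y" by (rule mate_sym[THEN iffD1])
        ultimately have "mate C y z" "mate C z y" by simp_all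
        then show ?thesis unfolding c_def mate_a' mate_C by auto
      qed
    next
      assume yz: "mate b y z"
      show ?thesis
      proof (cases "y \<in> {i, j}")
        case True
        then have "{y, z} = {i, j}" using yz ij b_unique[of i z j] b_unique[of j z i] by auto
        then have "{c y, c z} = {p, q}" using distinct by (auto simp: c_def doubleton_eq_iff)
        then show ?thesis by (auto simp: mate_a')
      next
        case False
        then have "z \<notin> {i, j}" using mate_closed[OF b ij(2) yz] by blast
        then show ?thesis using yz False by (simp add: c_def)
      qed
    qed
    then show "c y = c z \<or> (c y, c z) \<in> a' \<union> b \<or> (c z, c y) \<in> a' \<union> b" by (auto simp: mate_def)
  qed
  then have image: "c y \<in> R' (c x)" if "y \<in> R x" for y using that by (rule subsetD[OF _ imageI])
  show "R x - {i, j} \<subseteq> R' x"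
  proof
    fix y assume "y \<in> R x - {i, j}"
    then show "y \<in> R' x" using image[of y] assms by (simp add: c_def)
  qed
qed

text \<open>If the arc also belonged to \<open>a\<close>, it would be a circle by itself and could
  not lie on the circle of i. So it is in \<open>b - a\<close>, where i is maximal.\<close>

lemma arc_left:
  assumes "(k, l) \<in> b" "(k, l) \<noteq> (i, j)" "k \<in> R i" shows "k < i"
proof -
  have kl: "mate b k l" using assms(1) by (simp add: mate_def)
  have "(k, l) \<notin> a"
  proof
    assume "(k, l) \<in> a"
    have "R k \<subseteq> {k, l}"
    proof (rule component_least)
      fix y z assume "(y, z) \<in> a \<union> b"
      then have "mate a y z \<or> mate b y z" by (auto simp: mate_def)
      moreover have "mate a k l" using \<open>(k, l) \<in> a\<close> by (simp add: mate_def)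
      ultimately show "y \<in> {k, l} \<longleftrightarrow> z \<in> {k, l}" using mate_closed[OF a] mate_closed[OF b kl] by blast
    qed simp
    then have "i \<in> {k, l}" using assms(3) component_sym[of k "a \<union> b" i] by auto
    then have "l = j \<and> k = i \<or> k = j \<and> l = i"
      using b_unique[of i l j] b_unique[of i k j] kl mate_sym[of b k l] ij(2) by auto
    then show False using assms(2) crossinglessD(1)[OF b assms(1)] ij by auto
  qed
  then have "k \<le> i" using maximal[of "(k, l)"] assms(1) by simp
  moreover have "k \<noteq> i" using assms(2) kl ij(2) b_unique[of i l j] by auto
  ultimately show ?thesis by simp
qed

text \<open>The first point of the circle through i. The arcs starting here, one in either matching,
  are the ones that do not split.\<close>

definition "\<mu> = Min (R i)"

text \<open>The circle also passes through p, whose arc in \<open>b\<close> is not (i, j) and hence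
  starts to the left of i by \<open>arc_left\<close>.\<close>

lemma \<mu>: "\<mu> \<in> R i" "\<mu> < i" "x \<in> R i \<Longrightarrow> \<mu> \<le> x"
proof -
  have fin: "finite (R i)" using finite_subset[OF component_in_range[OF a b in_range(1)]] by simp
  then show "\<mu> \<in> R i" "x \<in> R i \<Longrightarrow> \<mu> \<le> x"
    unfolding \<mu>_def using Min_in[OF fin] component_refl[of i "a \<union> b"] fin by (blast intro: Min_le)+
  obtain r where r: "mate b p r" using crossinglessD(2)[OF b in_range(3)] by blast
  then obtain k l where kl: "(k, l) \<in> b" "(k, l) = (p, r) \<or> (k, l) = (r, p)" by (auto simp: mate_def)
  have "R k = R i" using kl r R_mate[of p r] R_pq by auto
  then have "k \<in> R i" by auto
  moreover have "(k, l) \<noteq> (i, j)" using kl distinct by auto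
  ultimately have "k < i" using arc_left kl by blast
  moreover have "\<mu> \<le> k" unfolding \<mu>_def using fin \<open>k \<in> R i\<close> by simp
  ultimately show "\<mu> < i" by simp
qed

lemma split_in_class:
  assumes "x \<in> R i" shows "(\<exists>v<x. v \<in> R x) \<longleftrightarrow> x \<noteq> \<mu>"
proof -
  have "R x = R i" using assms by (rule component_eq)
  then show ?thesis using \<mu>(1) \<mu>(3)[OF assms] \<mu>(3) by (metis le_neq_implies_less leD)
qed

lemma split'_in_class:
  assumes "x \<in> R i" "x \<notin> {i, j}" shows "(\<exists>v<x. v \<in> R' x) \<longleftrightarrow> x \<noteq> \<mu>"
proof -
  have "R x = R i" using assms(1) by (rule component_eq)
  then have R': "R' x = R i - {i, j}" using R'_eq[OF assms(2)] by simp
  have "\<mu> \<in> R' x" unfolding R' using \<mu>(1,2) ij(1) by auto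
  moreover have "\<mu> \<le> v" if "v \<in> R' x" for v using that \<mu>(3) unfolding R' by blast
  moreover have "\<mu> \<le> x" using \<mu>(3)[OF assms(1)] .
  ultimately show ?thesis by (metis le_neq_implies_less leD)
qed

text \<open>Taking i and j away from the circle does not remove its first point, so no other point
  changes its status.\<close>

lemma split'_iff:
  assumes "x \<notin> {i, j}"
  shows "(\<exists>v<x. v \<in> R' x) \<longleftrightarrow> (\<exists>v<x. v \<in> R x)"
proof (cases "x \<in> R i")
  case True
  then show ?thesis using split_in_class split'_in_class assms by simp
next
  case False
  then have "i \<notin> R x" "j \<notin> R x"
    using component_sym[of i "a \<union> b" x] component_sym[of j "a \<union> b" x] R_pq by auto
  then show ?thesis using R'_eq[OF assms] by simp
qed

text \<open>The surgery removes only pi and jq from \<open>a\<close>. Neither is in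
  \<open>b\<close>, where i and j are partners, and the arc ij is gained.\<close>

lemma card_less: "card (b - a') < card (b - a)"
proof (rule psubset_card_mono)
  show "finite (b - a)" using crossinglessD(5)[OF b] by simp
  have "e \<notin> b" if "e = (min p i, max p i) \<or> e = (min j q, max j q)" for e
  proof
    assume "e \<in> b"
    then have "mate b i p \<or> mate b j q"
      using that distinct by (cases "p < i"; cases "j < q") (auto simp: mate_def min_def max_def split: if_splits)
    then show False using b_unique[of i p j] b_unique[of j q i] ij distinct by auto
  qed
  then have "b - a' \<subseteq> b - a" by (subst a_eq) (auto simp: a'_def)
  moreover have "(i, j) \<in> (b - a) - (b - a')" using ij_a ij_b by (auto simp: a'_def)
  ultimately show "b - a' \<subset> b - a" by blast
qed

text \<open>The arc (i, j) splits with \<open>a\<close>, since \<mu> < i is on its circle, but not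
  with \<open>a'\<close>, where {i, j} is a circle of its own.\<close>

lemma split_product_left: "split_product a b = dual i j * split_product a' b"
proof -
  have "(i, j) \<notin> split_arcs a' b"
    using R'_i ij(1) by (auto simp: split_arcs_def)
  moreover have "split_arcs a b = insert (i, j) (split_arcs a' b)"
  proof -
    have "e \<in> split_arcs a b \<longleftrightarrow> e \<in> split_arcs a' b" if "e \<noteq> (i, j)" "e \<in> b" for e
    proof -
      have "mate b (fst e) (snd e)" using that by (simp add: mate_def)
      then have "fst e \<noteq> i" using that(1) ij(2) b_unique[of i "snd e" j] by (auto simp: prod_eq_iff)
      moreover have "fst e \<noteq> j"
        using \<open>mate b (fst e) (snd e)\<close> ij b_unique[of j "snd e" i]
          crossinglessD(1)[OF b, of "fst e" "snd e"] that(2) by auto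
      ultimately show ?thesis using split'_iff[of "fst e"] by (simp add: split_arcs_def)
    qed
    moreover have "(i, j) \<in> split_arcs a b"
      using split_in_class[of i] \<mu>(2) ij_b by (auto simp: split_arcs_def)
    moreover have "e \<in> b" if "e \<in> split_arcs a b \<or> e \<in> split_arcs a' b" for e
      using that by (auto simp: split_arcs_def)
    ultimately show ?thesis by (intro set_eqI) (metis insert_iff)
  qed
  moreover have "finite (split_arcs a' b)"
    using crossinglessD(5)[OF b] by (auto simp: split_arcs_def)
  ultimately show ?thesis by (simp add: split_product_def)
qed

text \<open>The split arcs of \<open>a\<close> away from the surgery; by \<open>split'_iff\<close>
  they are also those of \<open>a'\<close>.\<close>

definition "S = {e \<in> C. \<exists>v<fst e. v \<in> R (fst e)}"

lemma finite_S: "finite S"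
  using crossinglessD(5)[OF a] by (simp add: S_def C_def)

lemma notin_S: "fst e \<in> {i, j, p, q} \<Longrightarrow> e \<notin> S"
  unfolding S_def C_def by blast

text \<open>Neither i nor j is the first point of the circle, so pi and jq split unless p,
  respectively q, is \<mu>.\<close>

lemma split_product_right:
  "split_product b a = (\<Prod>e\<in>S. dual (fst e) (snd e))
    * (if p = \<mu> then 1 else dual p i) * (if q = \<mu> then 1 else dual j q)"
proof -
  let ?A = "if p = \<mu> then {} else {(min p i, max p i)}" and ?B = "if q = \<mu> then {} else {(min j q, max j q)}"
  have "p \<in> R i" "j \<in> R i" "q \<in> R i" using R_pq component_eq_iff by metis+
  then have "min p i \<in> R i" "min j q \<in> R i" by (auto simp: min_def)
  moreover have "min p i = \<mu> \<longleftrightarrow> p = \<mu>" "min j q = \<mu> \<longleftrightarrow> q = \<mu>"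
    using \<mu>(2) ij(1) by (auto simp: min_def)
  ultimately have split: "(\<exists>v<min p i. v \<in> R (min p i)) \<longleftrightarrow> p \<noteq> \<mu>" "(\<exists>v<min j q. v \<in> R (min j q)) \<longleftrightarrow> q \<noteq> \<mu>"
    using split_in_class by blast+
  have "e \<in> split_arcs b a \<longleftrightarrow> e \<in> S \<union> (?A \<union> ?B)" for e
  proof -
    define s where "s e \<longleftrightarrow> (\<exists>v<fst e. v \<in> R (fst e))" for e :: "nat \<times> nat"
    have "e \<in> a \<longleftrightarrow> e \<in> C \<or> e = (min p i, max p i) \<or> e = (min j q, max j q)"
      using a_eq by blast
    moreover have "s (min p i, max p i) \<longleftrightarrow> p \<noteq> \<mu>" "s (min j q, max j q) \<longleftrightarrow> q \<noteq> \<mu>"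
      unfolding s_def fst_conv by (fact split)+
    moreover have "split_arcs b a = {e \<in> a. s e}" "S = {e \<in> C. s e}"
      unfolding split_arcs_def S_def s_def Un_commute[of b a] by (rule refl)+
    ultimately show ?thesis by auto
  qed
  then have "split_arcs b a = S \<union> (?A \<union> ?B)" by blast
  moreover have "S \<inter> (?A \<union> ?B) = {}"
    using notin_S[of "(min p i, max p i)"] notin_S[of "(min j q, max j q)"] by (auto simp: min_def)
  moreover have "(min p i, max p i) \<noteq> (min j q, max j q)"
  proof
    have mm: "{min u v, max u v} = {u, v}" for u v :: nat by (auto simp: min_def max_def)
    assume "(min p i, max p i) = (min j q, max j q)"
    then have "{p, i} = {j, q}" using mm[of p i] mm[of j q] by simp
    then show False using distinct by (auto simp: doubleton_eq_iff)
  qed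
  then have "?A \<inter> ?B = {}" by (auto dest: sym)
  ultimately show ?thesis
    by (simp add: split_product_def prod.union_disjoint finite_S dual_min_max mult.assoc)
qed

text \<open>The arc ij is alone on its circle and does not split, and pq splits unless it starts at
  \<mu>.\<close>

lemma split_product_right':
  "split_product b a' = (\<Prod>e\<in>S. dual (fst e) (snd e)) * (if p = \<mu> \<or> q = \<mu> then 1 else dual p q)"
proof -
  let ?A = "if p = \<mu> \<or> q = \<mu> then {} else {(min p q, max p q)}"
  have pq: "p \<in> R i" "q \<in> R i" using R_pq component_eq_iff by metis+
  then have "min p q \<in> R i" "min p q \<notin> {i, j}" using distinct by (auto simp: min_def)
  moreover have "min p q = \<mu> \<longleftrightarrow> p = \<mu> \<or> q = \<mu>" using \<mu>(3)[OF pq(1)] \<mu>(3)[OF pq(2)] by (auto simp: min_def)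
  ultimately have split: "(\<exists>v<min p q. v \<in> R' (min p q)) \<longleftrightarrow> \<not> (p = \<mu> \<or> q = \<mu>)"
    using split'_in_class by blast
  have split_i: "\<not> (\<exists>v<i. v \<in> R' i)" using R'_i ij(1) by auto
  have split_C: "(\<exists>v<fst e. v \<in> R' (fst e)) \<longleftrightarrow> (\<exists>v<fst e. v \<in> R (fst e))" if "e \<in> C" for e
    using that by (intro split'_iff) (auto simp: C_def)
  have "e \<in> split_arcs b a' \<longleftrightarrow> e \<in> S \<union> ?A" for e
  proof -
    define s where "s e \<longleftrightarrow> (\<exists>v<fst e. v \<in> R' (fst e))" for e :: "nat \<times> nat"
    have "e \<in> a' \<longleftrightarrow> e \<in> C \<or> e = (i, j) \<or> e = (min p q, max p q)"
      unfolding a'_def by blast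
    moreover have "s (min p q, max p q) \<longleftrightarrow> \<not> (p = \<mu> \<or> q = \<mu>)" "\<not> s (i, j)"
      unfolding s_def fst_conv by (fact split split_i)+
    moreover have "split_arcs b a' = {e \<in> a'. s e}"
      unfolding split_arcs_def s_def Un_commute[of b a'] by (rule refl)
    moreover have "S = {e \<in> C. s e}"
      unfolding S_def s_def using split_C by blast
    ultimately show ?thesis by auto
  qed
  then have "split_arcs b a' = S \<union> ?A" by blast
  moreover have "S \<inter> ?A = {}" using notin_S[of "(min p q, max p q)"] by (auto simp: min_def)
  ultimately show ?thesis
    by (simp add: split_product_def prod.union_disjoint finite_S dual_min_max)
qed

text \<open>The factor \<open>dual i j\<close> pays for the passage from \<open>a\<close> to
  \<open>a'\<close> and leaves \<open>dual p i\<close> behind. The induction hypothesis is then used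
  for \<open>dual x i * f\<close>, which is why the polynomial varies.\<close>

lemma induction_step:
  fixes f :: "'k::field point_poly"
  assumes f: "f \<in> dot_polys {1..2 * n}"
    and IH: "\<And>f :: 'k point_poly. f \<in> dot_polys {1..2 * n} \<Longrightarrow>
      dotted_value a' (f * split_product a' b) - dotted_value b (f * split_product b a') \<in> graphical_relations n"
  shows "dotted_value a (f * split_product a b) - dotted_value b (f * split_product b a) \<in> graphical_relations n"
proof -
  \<comment> \<open>On \<open>a'\<close> a dot may sit at either end of the arc pq. The end
    different from \<mu> is the one that supplies a factor occurring in
    \<open>split_product b a\<close>.\<close>
  define x where "x = (if p = \<mu> then q else p)"
  define \<Pi> :: "'k point_poly" where "\<Pi> = (\<Prod>e\<in>S. dual (fst e) (snd e))"
  have arcs_in: "fst e \<in> {1..2 * n}" "snd e \<in> {1..2 * n}" if "e \<in> a \<union> b" for e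
    using that crossinglessD(1)[OF a, of "fst e" "snd e"] crossinglessD(1)[OF b, of "fst e" "snd e"] by auto
  have \<Pi>: "\<Pi> \<in> dot_polys {1..2 * n}"
    unfolding \<Pi>_def by (intro dot_polys_prod dot_polys_dual) (use arcs_in in \<open>auto simp: S_def C_def\<close>)
  have prod: "split_product a' b \<in> dot_polys {1..2 * n}"
    unfolding split_product_def
    by (intro dot_polys_prod dot_polys_dual) (use arcs_in in \<open>auto simp: split_arcs_def\<close>)
  have "mate a' p q" by (simp add: mate_a')
  then have "arc_at a' x = arc_at a' p"
    using arc_at_mate[OF a' \<open>mate a' p q\<close>] arc_at_mate[OF a', of q p] mate_sym[of a' p q]
    by (auto simp: x_def min.commute max.commute)
  then have eq: "dotted_value a' (dual p i * (f * split_product a' b)) = dotted_value a' (dual x i * (f * split_product a' b))"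
    by (intro dotted_value_dual_cong) simp_all
  have "dotted_value a (dual i j * (f * split_product a' b)) - dotted_value a' (dual p i * (f * split_product a' b))
      \<in> graphical_relations n"
    by (rule dotted_value_surgery_arcs[OF a a' a_eq a'_def ij(1) outside distinct(5)])
      (use f prod in blast)
  then have "dotted_value a (f * split_product a b) - dotted_value a' (dual x i * (f * split_product a' b))
      \<in> graphical_relations n"
    unfolding eq split_product_left mult.left_commute[of f] .
  moreover have "dual x i * f \<in> dot_polys {1..2 * n}"
    using in_range f by (intro dot_polys_times dot_polys_dual) (simp_all add: x_def)
  note IH[OF this, unfolded mult.assoc]
  ultimately have "dotted_value a (f * split_product a b) - dotted_value b (dual x i * (f * split_product b a'))
      \<in> graphical_relations n"
    by (rule graphical_relations_diff_trans)
  moreover have "dotted_value b (dual x i * (f * split_product b a')) - dotted_value b (f * split_product b a)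
      \<in> graphical_relations n"
  proof -
    \<comment> \<open>If p or q is \<mu>, then pq does not split and exactly one of pi, jq does,
      which is the factor carried along. Otherwise the factors \<open>dual p q\<close> and
      \<open>dual j q\<close> remain to be compared in the presence of
      \<open>dual p i\<close>.\<close>
    consider "p = \<mu>" "q \<noteq> \<mu>" | "p \<noteq> \<mu>" "q = \<mu>" | "p \<noteq> \<mu>" "q \<noteq> \<mu>" using distinct by metis
    then show ?thesis
    proof cases
      case 1
      have "dotted_value b (dual q i * (f * \<Pi>)) = dotted_value b (dual q j * (f * \<Pi>))"
        by (rule dotted_value_dual_cong) (use arc_at_arc[OF b ij_b] in auto)
      moreover have "dual x i * (f * split_product b a') = dual q i * (f * \<Pi>)"
        unfolding x_def split_product_right' \<Pi>_def if_P[OF 1(1)] if_P[OF disjI1[OF 1(1)]] by simp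
      moreover have "f * split_product b a = dual q j * (f * \<Pi>)"
        unfolding split_product_right \<Pi>_def if_P[OF 1(1)] if_not_P[OF 1(2)] dual_commute[of j q]
        by (simp add: mult_ac)
      ultimately show ?thesis by (simp add: poly_mapping_module.span_zero)
    next
      case 2
      have "dual x i * (f * split_product b a') = f * split_product b a"
        unfolding x_def split_product_right' split_product_right
          if_not_P[OF 2(1)] if_P[OF 2(2)] if_P[OF disjI2[OF 2(2)]] by (simp add: mult_ac)
      then show ?thesis by (simp add: poly_mapping_module.span_zero)
    next
      case 3
      then have "dual x i * (f * split_product b a') = dual p i * (dual p q * (f * \<Pi>))"
        "f * split_product b a = dual p i * (dual j q * (f * \<Pi>))"
        by (simp_all add: x_def split_product_right' split_product_right \<Pi>_def mult_ac)
      moreover have "f * \<Pi> \<in> dot_polys {1..2 * n}" using f \<Pi> by blast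
      ultimately show ?thesis
        using dotted_value_dual_path[OF b ij(2) in_range(3)] by metis
    qed
  qed
  ultimately show ?thesis by (rule graphical_relations_diff_trans)
qed

end

lemma dotted_value_exchange:
  fixes f :: "'k::field point_poly"
  assumes a: "a \<in> crossingless_matchings n" and b: "b \<in> crossingless_matchings n"
    and f: "f \<in> dot_polys {1..2 * n}"
  shows "dotted_value a (f * split_product a b) - dotted_value b (f * split_product b a) \<in> graphical_relations n"
  using a f
proof (induction "card (b - a)" arbitrary: a f rule: less_induct)
  case less
  have fin: "finite (b - a)" using crossinglessD(5)[OF b] by simp
  show ?case
  proof (cases "b \<subseteq> a")
    case True
    have "e \<in> b" if "e \<in> a" for e
    proof -
      have m: "mate a (fst e) (snd e)" "fst e < snd e" "fst e \<in> {1..2 * n}"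
        using that crossinglessD(1)[OF less.prems(1), of "fst e" "snd e"] by (auto simp: mate_def)
      obtain z where z: "mate b (fst e) z" using crossinglessD(2)[OF b m(3)] by blast
      then have "mate a (fst e) z" using True by (auto simp: mate_def)
      then have "z = snd e" using crossinglessD(3)[OF less.prems(1)] m(1) by blast
      then show ?thesis using z crossinglessD(1)[OF b, of "snd e" "fst e"] m(2) by (auto simp: mate_def)
    qed
    then have "a = b" using True by blast
    then show ?thesis by (simp add: poly_mapping_module.span_zero)
  next
    case False
    then have "fst ` (b - a) \<noteq> {}" by auto
    then have "Max (fst ` (b - a)) \<in> fst ` (b - a)" using fin by (intro Max_in) auto
    then obtain i j where ij: "(i, j) \<in> b - a" "i = Max (fst ` (b - a))" by force
    then have range: "i \<in> {1..2 * n}" "j \<in> {1..2 * n}" using crossinglessD(1)[OF b, of i j] by auto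
    obtain p q where pq: "mate a i p" "mate a j q" using crossinglessD(2)[OF less.prems(1)] range by metis
    interpret innermost_difference n a b i j p q
      using less.prems(1) b ij pq fin mate_sym[of a] by unfold_locales auto
    show ?thesis
      by (rule induction_step[OF less.prems(2)]) (rule less.hyps[OF card_less a'])
  qed
qed

subsection \<open>The isomorphism\<close>

text \<open>The circles of W(a)a are the arcs of \<open>a\<close>, viewed as two-element
  sets.\<close>

definition arc_of_circle :: "nat set \<Rightarrow> nat \<times> nat"
  where "arc_of_circle C = (Min C, Max C)"

lemma arc_at_eq: "arc_at a v = arc_of_circle (component a v)"
  by (simp add: arc_at_def arc_of_circle_def)

text \<open>Labels X become dots on the diagonal summands; the other summands vanish in the
  quotient.\<close>

definition to_dotted :: "(arc_basis \<Rightarrow>\<^sub>0 'k::field poly poly) \<Rightarrow> (dotted \<Rightarrow>\<^sub>0 'k poly poly)"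
  where "to_dotted = linear_extension (\<lambda>(b, a, S).
    if b = a then basis_vec (a, image_mset arc_of_circle (mset_set S)) else 0)"

text \<open>Repeated dots on an arc are multiplied in the algebra of its circle and thereby reduced.
  This is why \<open>to_dotted_of_dotted\<close> is a congruence and not an equality.\<close>

definition of_dotted :: "(dotted \<Rightarrow>\<^sub>0 'k::field poly poly) \<Rightarrow> (arc_basis \<Rightarrow>\<^sub>0 'k poly poly)"
  where "of_dotted = linear_extension (\<lambda>(a, D). embed_hom a a (dots (component a) (image_mset fst D)))"

lemma linear_map_to_dotted [simp, intro]: "linear_map to_dotted"
  by (simp add: to_dotted_def)

lemma linear_map_of_dotted [simp, intro]: "linear_map of_dotted"
  by (simp add: of_dotted_def)

lemma to_dotted_basis_vec [simp]:
  "to_dotted (basis_vec (b, a, S)) = (if b = a then basis_vec (a, image_mset arc_of_circle (mset_set S)) else 0)"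
  by (simp add: to_dotted_def)

lemma of_dotted_basis_vec [simp]:
  "of_dotted (basis_vec (a, D)) = embed_hom a a (dots (component a) (image_mset fst D))"
  by (simp add: of_dotted_def)

section \<open>Relations coming from commutators\<close>

abbreviation ring_relations :: "nat \<Rightarrow> (arc_basis \<Rightarrow>\<^sub>0 'k::field poly poly) set"
  where "ring_relations n \<equiv> poly_mapping_module.span (arc_commutators n)"

lemma linear_map_zero: "linear_map (\<lambda>x. 0)"
  by (rule linear_mapI) simp_all

lemma circle_Min:
  assumes "a \<in> crossingless_matchings n" "b \<in> crossingless_matchings n" "v \<in> {1..2 * n}"
  shows "Min (component (b \<union> a) v) \<in> {1..2 * n}"
    and "component (b \<union> a) (Min (component (b \<union> a) v)) = component (b \<union> a) v"
proof -
  have sub: "component (b \<union> a) v \<subseteq> {1..2 * n}" by (rule component_in_range[OF assms(2,1,3)])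
  then have "finite (component (b \<union> a) v)" by (rule finite_subset) simp
  then have M: "Min (component (b \<union> a) v) \<in> component (b \<union> a) v"
    using component_refl[of v "b \<union> a"] by (intro Min_in) auto
  then show "Min (component (b \<union> a) v) \<in> {1..2 * n}" using sub by blast
  show "component (b \<union> a) (Min (component (b \<union> a) v)) = component (b \<union> a) v"
    using M by (rule component_eq)
qed

lemma finite_circles:
  assumes "S \<subseteq> circles n b a" shows "finite S"
  by (rule finite_subset[OF assms]) (simp add: circles_def)

text \<open>The smallest point represents each circle. Every basis vector becomes the value of a
  monomial, as the product formulas require.\<close>

lemma dots_of_circles:
  assumes "a \<in> crossingless_matchings n" "b \<in> crossingless_matchings n" "S \<subseteq> circles n b a"
  shows "dots (component (b \<union> a)) (image_mset Min (mset_set S)) = basis_vec S"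
    and "set_mset (image_mset Min (mset_set S)) \<subseteq> {1..2 * n}"
proof -
  have C: "\<exists>v\<in>{1..2 * n}. C = component (b \<union> a) v" if "C \<in> S" for C
    using assms(3) that by (auto simp: circles_def Un_commute)
  show "dots (component (b \<union> a)) (image_mset Min (mset_set S)) = basis_vec S"
    by (rule dots_distinct[OF finite_circles[OF assms(3)]]) (use C circle_Min(2)[OF assms(1,2)] in metis)
  show "set_mset (image_mset Min (mset_set S)) \<subseteq> {1..2 * n}"
    using C circle_Min(1)[OF assms(1,2)] finite_circles[OF assms(3)] by fastforce
qed

lemma arc_ring_iff: "basis_vec (b, a, S) \<in> arc_ring n \<longleftrightarrow>
    b \<in> crossingless_matchings n \<and> a \<in> crossingless_matchings n \<and> S \<subseteq> circles n b a"
  by (simp add: arc_ring_def)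

lemma subspace_arc_ring: "poly_mapping_module.subspace (arc_ring n)"
  unfolding arc_ring_def by (rule subspace_free_module)

lemma embed_hom_in_arc_ring:
  assumes "a \<in> crossingless_matchings n" "b \<in> crossingless_matchings n" "set_mset m \<subseteq> {1..2 * n}"
  shows "embed_hom b a (dots (component (b \<union> a)) m) \<in> arc_ring n"
proof (rule linear_map_in_submodule[OF linear_map_embed_hom subspace_arc_ring])
  fix S assume "S \<in> Poly_Mapping.keys (dots (component (b \<union> a)) m)"
  then have "S \<subseteq> component (b \<union> a) ` {1..2 * n}" using keys_dots[OF assms(3)] by blast
  then show "embed_hom b a (basis_vec S) \<in> arc_ring n"
    using assms(1,2) by (simp add: arc_ring_iff circles_def Un_commute)
qed

lemma commutator_in_ring_relations:
  "x \<in> arc_ring n \<Longrightarrow> y \<in> arc_ring n \<Longrightarrow> arc_mult x y - arc_mult y x \<in> ring_relations n"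
  by (rule poly_mapping_module.span_base) (auto simp: arc_commutators_def)

text \<open>The commutator with the unit u of F(W(a)a) is the vector itself: x u = x, whereas u x =
  0 because the inner matchings a and b differ.\<close>

lemma off_diagonal_in_ring_relations:
  assumes "a \<in> crossingless_matchings n" "b \<in> crossingless_matchings n" "S \<subseteq> circles n b a" "b \<noteq> a"
  shows "(basis_vec (b, a, S) :: arc_basis \<Rightarrow>\<^sub>0 'k::field poly poly) \<in> ring_relations n"
proof -
  let ?x = "basis_vec (b, a, S) :: arc_basis \<Rightarrow>\<^sub>0 'k poly poly" and ?u = "basis_vec (a, a, {}) :: arc_basis \<Rightarrow>\<^sub>0 'k poly poly"
  have x: "?x = embed_hom b a (dots (component (b \<union> a)) (image_mset Min (mset_set S)))"
    by (simp add: dots_of_circles(1)[OF assms(1-3)])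
  have "arc_mult ?x ?u = ?x"
    unfolding x by (rule arc_mult_unit[OF assms(1,2) dots_of_circles(2)[OF assms(1-3)]])
  moreover have "arc_mult ?u ?x = 0" using assms(4) by (simp add: arc_mult_eq)
  moreover have "?x \<in> arc_ring n" "?u \<in> arc_ring n" using assms by (simp_all add: arc_ring_iff)
  ultimately show ?thesis using commutator_in_ring_relations[of ?x n ?u] by simp
qed

text \<open>\<open>eval_dots\<close> reduces repeated dots at once and \<open>dotted_value\<close>
  keeps them. The difference is accounted for by one dot reduction each time a dot lands on a circle
  already labelled X.\<close>

lemma to_dotted_eval_dots:
  fixes f :: "'k::field point_poly"
  assumes a: "a \<in> crossingless_matchings n" and f: "f \<in> dot_polys {1..2 * n}"
  shows "to_dotted (embed_hom a a (eval_dots (component a) f)) - dotted_value a f \<in> graphical_relations n"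
proof (rule linear_map_in_submodule[of "\<lambda>f. to_dotted (embed_hom a a (eval_dots (component a) f)) - dotted_value a f"])
  show "linear_map (\<lambda>f. to_dotted (embed_hom a a (eval_dots (component a) f)) - dotted_value a f)"
    by (intro linear_map_diff linear_map_dotted_value linear_map_compose[OF _ linear_map_to_dotted]
        linear_map_compose[OF linear_map_eval_dots linear_map_embed_hom])
  fix m assume "m \<in> Poly_Mapping.keys f"
  then have m: "set_mset m \<subseteq> {1..2 * n}" using f by (auto simp: free_module_def)
  \<comment> \<open>An intermediate form: the labels in S are reduced and the dots \<open>m'\<close>
    are drawn on top without reduction. Dots move from the first group to the second one at a
    time.\<close>
  define \<Gamma> :: "nat multiset \<Rightarrow> (nat set set \<Rightarrow>\<^sub>0 'k poly poly) \<Rightarrow> (dotted \<Rightarrow>\<^sub>0 'k poly poly)" where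
    "\<Gamma> m' = linear_extension (\<lambda>S. basis_vec (a, image_mset arc_of_circle (mset_set S) + image_mset (arc_at a) m'))" for m'
  have \<Gamma>_lin: "linear_map (\<Gamma> m')" for m' by (simp add: \<Gamma>_def)
  have \<Gamma>: "\<Gamma> m' (basis_vec S) = basis_vec (a, image_mset arc_of_circle (mset_set S) + image_mset (arc_at a) m')" for m' S
    by (simp add: \<Gamma>_def)
  have step: "\<Gamma> m' (dot_action (component a v) x) - \<Gamma> (add_mset v m') x \<in> graphical_relations n"
    if v: "v \<in> {1..2 * n}" and m': "set_mset m' \<subseteq> {1..2 * n}"
      and x: "Poly_Mapping.keys x \<subseteq> Pow (component a ` {1..2 * n})" for v m' x
  proof (rule linear_map_in_submodule[of "\<lambda>x. \<Gamma> m' (dot_action (component a v) x) - \<Gamma> (add_mset v m') x"])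
    show "linear_map (\<lambda>x. \<Gamma> m' (dot_action (component a v) x) - \<Gamma> (add_mset v m') x)"
      by (intro linear_map_diff \<Gamma>_lin linear_map_compose[OF linear_map_dot_action \<Gamma>_lin])
    fix S assume "S \<in> Poly_Mapping.keys x"
    then have S: "S \<subseteq> component a ` {1..2 * n}" using x by blast
    then have "finite S" by (rule finite_subset) simp
    let ?C = "component a v" and ?e = "arc_at a v"
    show "\<Gamma> m' (dot_action ?C (basis_vec S)) - \<Gamma> (add_mset v m') (basis_vec S) \<in> graphical_relations n"
    proof (cases "?C \<in> S")
      case False
      then have "\<Gamma> m' (dot_action ?C (basis_vec S)) = \<Gamma> (add_mset v m') (basis_vec S)"
        using \<open>finite S\<close> by (simp add: dot_action_basis \<Gamma> arc_at_eq)
      then show ?thesis by (simp add: poly_mapping_module.span_zero)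
    next
      case True
      let ?D = "image_mset arc_of_circle (mset_set (S - {?C})) + image_mset (arc_at a) m'"
      have "mset_set S = add_mset ?C (mset_set (S - {?C}))"
        using True \<open>finite S\<close> by (rule mset_set.remove[rotated])
      then have eq: "\<Gamma> m' (dot_action ?C (basis_vec S)) - \<Gamma> (add_mset v m') (basis_vec S)
          = - (basis_vec (a, ?D + {#?e, ?e#}) - (hh \<odot> basis_vec (a, ?D + {#?e#}) + tt \<odot> basis_vec (a, ?D)))"
        using True by (simp add: dot_action_basis_in module_hom.add[OF \<Gamma>_lin] module_hom.scale[OF \<Gamma>_lin] \<Gamma> arc_at_eq)
      have arcs: "arc_of_circle C \<in> a" if "C \<in> S" for C
        using S that arc_at_in(1)[OF a] by (auto simp: arc_at_eq)
      have "(a, ?D) \<in> dotted_matchings n" "?e \<in> a"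
        using a v m' arc_at_in(1)[OF a] arcs \<open>finite S\<close> by (auto simp: dotted_matchings_def)
      then have "basis_vec (a, ?D + {#?e, ?e#}) - (hh \<odot> basis_vec (a, ?D + {#?e#}) + tt \<odot> basis_vec (a, ?D))
          \<in> (dot_reductions n :: (dotted \<Rightarrow>\<^sub>0 'k poly poly) set)"
        unfolding dot_reductions_def by blast
      then show ?thesis unfolding eq by (intro poly_mapping_module.span_neg poly_mapping_module.span_base) blast
    qed
  qed (simp)
  have "\<Gamma> m' (dots (component a) m) - \<Gamma> (m + m') (basis_vec {}) \<in> graphical_relations n"
    if "set_mset m' \<subseteq> {1..2 * n}" for m'
    using m that
  proof (induction m arbitrary: m')
    case empty
    then show ?case by (simp add: poly_mapping_module.span_zero)
  next
    case (add v m)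
    have "\<Gamma> m' (dots (component a) (add_mset v m)) - \<Gamma> (add_mset v m') (dots (component a) m) \<in> graphical_relations n"
      unfolding dots_add_mset using add.prems by (intro step keys_dots) auto
    moreover have "\<Gamma> (add_mset v m') (dots (component a) m) - \<Gamma> (add_mset v m + m') (basis_vec {}) \<in> graphical_relations n"
      using add.IH[of "add_mset v m'"] add.prems by simp
    ultimately show ?case by (rule graphical_relations_diff_trans)
  qed
  from this[of "{#}"] have "\<Gamma> {#} (dots (component a) m) - \<Gamma> m (basis_vec {}) \<in> graphical_relations n"
    by simp
  moreover have "\<Gamma> {#} y = to_dotted (embed_hom a a y)" for y
    by (rule linear_map_eq[OF \<Gamma>_lin linear_map_compose[OF linear_map_embed_hom linear_map_to_dotted]]) (simp add: \<Gamma>)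
  ultimately show "to_dotted (embed_hom a a (eval_dots (component a) (basis_vec m :: 'k point_poly))) - dotted_value a (basis_vec m)
      \<in> graphical_relations n"
    by (simp add: \<Gamma> dotted_value_basis_vec)
qed simp

lemma to_dotted_off_diagonal:
  assumes "b \<noteq> a" shows "to_dotted (linear_extension (\<lambda>K. basis_vec (b, a, g K)) y) = 0"
  by (rule linear_map_eq[OF linear_map_compose[OF linear_map_extension linear_map_to_dotted] linear_map_zero])
    (use assms in simp)

lemma to_dotted_arc_mult_basis:
  assumes "\<not> (c = b \<and> d = a)"
  shows "to_dotted (arc_mult_basis (d, c, T) (b, a, S)) = 0"
proof (cases "c = b")
  case True
  then have "d \<noteq> a" using assms by simp
  then show ?thesis by (simp add: to_dotted_off_diagonal True)
next
  case False
  then show ?thesis by (simp add: module_hom.zero[OF linear_map_to_dotted])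
qed

lemma to_dotted_commutator_basis:
  fixes n :: nat
  defines "B \<equiv> {(b, a, S). b \<in> crossingless_matchings n \<and> a \<in> crossingless_matchings n \<and> S \<subseteq> circles n b a}"
  assumes "\<beta> \<in> B" "\<alpha> \<in> B"
  shows "to_dotted (arc_mult (basis_vec \<beta>) (basis_vec \<alpha>) - arc_mult (basis_vec \<alpha>) (basis_vec \<beta>)
    :: arc_basis \<Rightarrow>\<^sub>0 'k::field poly poly) \<in> graphical_relations n"
proof -
  obtain d c T where \<beta>: "\<beta> = (d, c, T)" by (cases \<beta>)
  obtain b a S where \<alpha>: "\<alpha> = (b, a, S)" by (cases \<alpha>)
  have diff: "to_dotted (x - y) = to_dotted x - to_dotted y" for x y :: "arc_basis \<Rightarrow>\<^sub>0 'k poly poly"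
    by (rule module_hom.diff[OF linear_map_to_dotted])
  \<comment> \<open>Both products have zero component in the diagonal summands unless c = b and d =
    a.\<close>
  show ?thesis
  proof (cases "c = b \<and> d = a")
    case True
    have a: "a \<in> crossingless_matchings n" and b: "b \<in> crossingless_matchings n"
      and S: "S \<subseteq> circles n b a" and T: "T \<subseteq> circles n a b"
      using assms True by (auto simp: \<alpha> \<beta>)
    define m where "m = image_mset Min (mset_set S)"
    define m' where "m' = image_mset Min (mset_set T)"
    note m = dots_of_circles[OF a b S, folded m_def] and m' = dots_of_circles[OF b a T, folded m'_def]
    let ?f = "basis_vec (m + m') :: 'k point_poly"
    have f: "?f \<in> dot_polys {1..2 * n}" using m(2) m'(2) by simp
    have split: "split_product x y \<in> (dot_polys {1..2 * n} :: 'k point_poly set)"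
      if "y \<in> crossingless_matchings n" for x y
    proof -
      have "fst e \<in> {1..2 * n} \<and> snd e \<in> {1..2 * n}" if "e \<in> y" for e
        using crossinglessD(1)[OF \<open>y \<in> crossingless_matchings n\<close>, of "fst e" "snd e"] that by auto
      then show ?thesis
        unfolding split_product_def by (intro dot_polys_prod dot_polys_dual) (auto simp: split_arcs_def)
    qed
    have \<alpha>\<beta>: "basis_vec \<alpha> = (embed_hom b a (dots (component (b \<union> a)) m) :: arc_basis \<Rightarrow>\<^sub>0 'k poly poly)"
      "basis_vec \<beta> = (embed_hom a b (dots (component (a \<union> b)) m') :: arc_basis \<Rightarrow>\<^sub>0 'k poly poly)"
      by (simp_all add: \<alpha> \<beta> m(1) m'(1) True)
    have "arc_mult (basis_vec \<beta>) (basis_vec \<alpha>) = embed_hom a a (eval_dots (component a) (?f * split_product a b))"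
      unfolding \<alpha>\<beta> Un_commute[of b a] by (rule arc_mult_mirror[OF a b m(2) m'(2)])
    moreover have "arc_mult (basis_vec \<alpha>) (basis_vec \<beta>) = embed_hom b b (eval_dots (component b) (?f * split_product b a))"
      unfolding \<alpha>\<beta> Un_commute[of a b] add.commute[of m m'] by (rule arc_mult_mirror[OF b a m'(2) m(2)])
    moreover have "to_dotted (embed_hom a a (eval_dots (component a) (?f * split_product a b)))
        - dotted_value a (?f * split_product a b) \<in> graphical_relations n"
      by (rule to_dotted_eval_dots[OF a dot_polys_times[OF f split[OF b]]])
    moreover have "dotted_value a (?f * split_product a b) - dotted_value b (?f * split_product b a) \<in> graphical_relations n"
      by (rule dotted_value_exchange[OF a b f])
    moreover have "dotted_value b (?f * split_product b a)
        - to_dotted (embed_hom b b (eval_dots (component b) (?f * split_product b a))) \<in> graphical_relations n"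
      using poly_mapping_module.span_neg[OF to_dotted_eval_dots[OF b dot_polys_times[OF f split[OF a]]]] by simp
    ultimately show ?thesis
      unfolding diff by (metis graphical_relations_diff_trans)
  next
    case False
    then have "\<not> (a = d \<and> b = c)" by auto
    with False show ?thesis
      by (simp add: diff arc_mult_eq \<alpha> \<beta> to_dotted_arc_mult_basis poly_mapping_module.span_zero del: arc_mult_basis.simps)
  qed
qed

lemma to_dotted_ring_relations:
  fixes x :: "arc_basis \<Rightarrow>\<^sub>0 'k::field poly poly"
  assumes "x \<in> ring_relations n" shows "to_dotted x \<in> graphical_relations n"
proof (rule linear_map_span[OF linear_map_to_dotted _ _ assms])
  fix z :: "arc_basis \<Rightarrow>\<^sub>0 'k poly poly" assume "z \<in> arc_commutators n"
  then obtain x y where z: "z = arc_mult x y - arc_mult y x" and xy: "x \<in> arc_ring n" "y \<in> arc_ring n"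
    unfolding arc_commutators_def by blast
  note lin = linear_map_bilinear_extension_left[of arc_mult_basis, folded arc_mult_eq]
    linear_map_bilinear_extension_right[of arc_mult_basis, folded arc_mult_eq]
  show "to_dotted z \<in> graphical_relations n"
    unfolding z
  proof (rule linear_map_in_submodule[of "\<lambda>x. to_dotted (arc_mult x y - arc_mult y x)"])
    fix \<beta> assume \<beta>: "\<beta> \<in> Poly_Mapping.keys x"
    show "to_dotted (arc_mult (basis_vec \<beta>) y - arc_mult y (basis_vec \<beta>)) \<in> graphical_relations n"
    proof (rule linear_map_in_submodule[of "\<lambda>y. to_dotted (arc_mult (basis_vec \<beta>) y - arc_mult y (basis_vec \<beta>))"])
      fix \<alpha> assume "\<alpha> \<in> Poly_Mapping.keys y"
      then show "to_dotted (arc_mult (basis_vec \<beta>) (basis_vec \<alpha>) - arc_mult (basis_vec \<alpha>) (basis_vec \<beta>)) \<in> graphical_relations n"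
        using xy \<beta> by (intro to_dotted_commutator_basis) (auto simp: arc_ring_def free_module_def)
    qed (intro linear_map_compose[OF _ linear_map_to_dotted] linear_map_diff lin, simp)
  qed (intro linear_map_compose[OF _ linear_map_to_dotted] linear_map_diff lin, simp)
qed simp

text \<open>The left endpoint of the arc through v lies on the same circle of W(a)a as v, so moving
  the dots there changes nothing and an equality results.\<close>

lemma of_dotted_dotted_value:
  fixes f :: "'k::field point_poly"
  assumes a: "a \<in> crossingless_matchings n" and f: "f \<in> dot_polys {1..2 * n}"
  shows "of_dotted (dotted_value a f) = embed_hom a a (eval_dots (component a) f)"
proof (rule linear_map_eq_on_keys[of "\<lambda>f. of_dotted (dotted_value a f)" "\<lambda>f. embed_hom a a (eval_dots (component a) f)"])
  fix m assume "m \<in> Poly_Mapping.keys f"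
  then have m: "set_mset m \<subseteq> {1..2 * n}" using f by (auto simp: free_module_def)
  have "component a (fst (arc_at a v)) = component a v" if "v \<in> {1..2 * n}" for v
    using circle_Min(2)[OF a a that] by (simp add: arc_at_def)
  then have "(dots (component a) (image_mset fst (image_mset (arc_at a) m)) :: nat set set \<Rightarrow>\<^sub>0 'k poly poly)
      = dots (component a) m"
    unfolding dots_image_mset using m by (intro dots_cong) auto
  then show "of_dotted (dotted_value a (basis_vec m :: 'k point_poly)) = embed_hom a a (eval_dots (component a) (basis_vec m))"
    by (simp add: dotted_value_basis_vec)
qed (intro linear_map_compose[OF linear_map_dotted_value linear_map_of_dotted]
    linear_map_compose[OF linear_map_eval_dots linear_map_embed_hom])+

section \<open>Type I and type II relations as commutators\<close>

context surgery_configuration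
begin

lemma component_a: "component (A1 \<union> A2) a = {a, b, c, d}"
proof
  show "component (A1 \<union> A2) a \<subseteq> {a, b, c, d}"
  proof (rule component_least)
    fix x y assume "(x, y) \<in> A1 \<union> A2"
    then consider "mate C x y" "mate C y x" | "(x, y) \<in> {(a, b), (c, d), (a, d), (b, c)}" by (auto simp: mate_def)
    then show "x \<in> {a, b, c, d} \<longleftrightarrow> y \<in> {a, b, c, d}" by cases (use not_in_C in blast)+
  qed simp
  have "component (A1 \<union> A2) a = component (A1 \<union> A2) b" "component (A1 \<union> A2) b = component (A1 \<union> A2) c"
    "component (A1 \<union> A2) a = component (A1 \<union> A2) d"
    by (rule component_edge; blast)+
  then show "{a, b, c, d} \<subseteq> component (A1 \<union> A2) a" by (metis component_refl empty_subsetI insert_subset)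
qed

lemma not_split_C:
  assumes "e \<in> C" shows "\<not> (\<exists>v<fst e. v \<in> component (A1 \<union> A2) (fst e))"
proof -
  have m: "mate A1 (fst e) (snd e)" "mate A2 (fst e) (snd e)" using assms by (auto simp: mate_def)
  have "component (A1 \<union> A2) (fst e) \<subseteq> {fst e, snd e}"
  proof (rule component_least)
    fix x y assume "(x, y) \<in> A1 \<union> A2"
    then have "mate A1 x y \<or> mate A2 x y" unfolding mate_def by blast
    then show "x \<in> {fst e, snd e} \<longleftrightarrow> y \<in> {fst e, snd e}"
      using mate_closed[OF A m(1), of x y] mate_closed[OF A' m(2), of x y] by blast
  qed simp
  moreover have "fst e < snd e" using crossinglessD(1)[OF A, of "fst e" "snd e"] assms by simp
  ultimately show ?thesis by auto
qed

lemma split_class: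
  assumes "x \<in> {a, b, c, d}"
  shows "(\<exists>v<x. v \<in> component (A1 \<union> A2) x) \<longleftrightarrow> x \<noteq> a"
proof -
  have "component (A1 \<union> A2) x = {a, b, c, d}"
    using component_eq[of x "A1 \<union> A2" a] assms component_a by simp
  then show ?thesis using assms less by auto
qed

text \<open>Apart from doubled arcs of \<open>C\<close> there is one circle, through a, b, c, d. Its
  first point is a, so the arcs at a are omitted, leaving bc in \<open>A2\<close> and cd in
  \<open>A1\<close>.\<close>

lemma split_products: "split_product A1 A2 = dual b c" "split_product A2 A1 = dual c d"
proof -
  have "split_arcs A1 A2 = {(b, c)}"
    unfolding split_arcs_def using not_split_C split_class[of a] split_class[of b] less by fastforce
  moreover have "split_arcs A2 A1 = {(c, d)}"
    unfolding split_arcs_def Un_commute[of A2 A1]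
    using not_split_C split_class[of a] split_class[of c] less by fastforce
  ultimately show "split_product A1 A2 = dual b c" "split_product A2 A1 = dual c d"
    by (simp_all add: split_product_def)
qed

text \<open>The commutator of the monomial m between the two matchings with the generator 1 in the
  opposite direction. In W(A2)A2 the points c and d lie on the circles of b and a, which turns
  \<open>dual c d\<close> into \<open>dual a b\<close>.\<close>

lemma ring_surgery:
  assumes m: "set_mset m \<subseteq> {1..2 * n}"
  shows "embed_hom A1 A1 (eval_dots (component A1) (dual b c * basis_vec m))
      - embed_hom A2 A2 (eval_dots (component A2) (dual a b * basis_vec m))
    \<in> (ring_relations n :: (arc_basis \<Rightarrow>\<^sub>0 'k::field poly poly) set)"
proof -
  let ?x = "embed_hom A1 A2 (dots (component (A1 \<union> A2)) m) :: arc_basis \<Rightarrow>\<^sub>0 'k poly poly"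
  let ?y = "embed_hom A2 A1 (dots (component (A2 \<union> A1)) {#}) :: arc_basis \<Rightarrow>\<^sub>0 'k poly poly"
  have prods: "(basis_vec ({#} + m) * split_product A1 A2 :: 'k point_poly) = dual b c * basis_vec m"
    "(basis_vec (m + {#}) * split_product A2 A1 :: 'k point_poly) = dual c d * basis_vec m"
    unfolding split_products by (simp_all only: add_0_left add_0_right mult.commute)
  have "arc_mult ?x ?y = embed_hom A1 A1 (eval_dots (component A1) (dual b c * basis_vec m))"
    unfolding prods[symmetric] Un_commute[of A2 A1] by (rule arc_mult_mirror[OF A A' _ m]) simp
  moreover have "component A2 c = component A2 b" "component A2 d = component A2 a"
    using component_edge[of b c A2] component_edge[of a d A2] by simp_all
  then have "eval_dots (component A2) (dual c d * basis_vec m :: 'k point_poly)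
      = eval_dots (component A2) (dual a b * basis_vec m)"
    by (simp add: eval_dots_dual add.commute)
  moreover have "arc_mult ?y ?x = embed_hom A2 A2 (eval_dots (component A2) (dual c d * basis_vec m))"
    unfolding prods[symmetric] Un_commute[of A1 A2] by (rule arc_mult_mirror[OF A' A m]) simp
  moreover have "?x \<in> arc_ring n" by (rule embed_hom_in_arc_ring[OF A' A m])
  moreover have "?y \<in> arc_ring n" by (rule embed_hom_in_arc_ring[OF A A']) simp
  ultimately show ?thesis
    using commutator_in_ring_relations[of ?x n ?y] by metis
qed

text \<open>Multiplying X_u + X_w - h by X_u gives X_u X_w + (X_u^2 - h X_u), and the bracket
  evaluates to t; the same holds with X_w.\<close>

lemma eval_dots_quadratic:
  assumes "v \<in> {u, w}"
  shows "eval_dots \<kappa> ((var u * var w + tt \<odot> 1) * f) = eval_dots \<kappa> (dual u w * (var v * f))"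
proof -
  have "dual u w * (var v * f) = (var u * var w + tt \<odot> 1) * f + (var v * (var v * f) - hh \<odot> (var v * f) - tt \<odot> f)"
    using assms by (auto simp: dual_def scale_eq_times algebra_simps)
  moreover have "eval_dots \<kappa> (var v * (var v * f) - hh \<odot> (var v * f) - tt \<odot> f) = 0"
    by (simp add: eval_dots_var dot_action_twice)
  ultimately show ?thesis by simp
qed

lemma of_dotted_type_I:
  assumes m: "set_mset m \<subseteq> {1..2 * n}"
  shows "of_dotted (dotted_value A1 (dual b c * basis_vec m) - dotted_value A2 (dual a b * basis_vec m))
    \<in> (ring_relations n :: (arc_basis \<Rightarrow>\<^sub>0 'k::field poly poly) set)"
proof -
  have "dual u v * basis_vec m \<in> (dot_polys {1..2 * n} :: 'k point_poly set)"
    if "u \<in> {a, b, c, d}" "v \<in> {a, b, c, d}" for u v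
    using in_range m that by (intro dot_polys_times dot_polys_dual) auto
  then have "of_dotted (dotted_value A1 (dual b c * basis_vec m :: 'k point_poly))
      = embed_hom A1 A1 (eval_dots (component A1) (dual b c * basis_vec m))"
    "of_dotted (dotted_value A2 (dual a b * basis_vec m :: 'k point_poly))
      = embed_hom A2 A2 (eval_dots (component A2) (dual a b * basis_vec m))"
    using of_dotted_dotted_value A A' by blast+
  note eqs = this
  show ?thesis
    unfolding module_hom.diff[OF linear_map_of_dotted] eqs by (rule ring_surgery[OF m])
qed

lemma of_dotted_type_II:
  assumes m: "set_mset m \<subseteq> {1..2 * n}"
  shows "of_dotted (dotted_value A1 ((var b * var c + tt \<odot> 1) * basis_vec m)
      - dotted_value A2 ((var a * var b + tt \<odot> 1) * basis_vec m))
    \<in> (ring_relations n :: (arc_basis \<Rightarrow>\<^sub>0 'k::field poly poly) set)"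
proof -
  have "(var u * var v + tt \<odot> 1) * basis_vec m \<in> (dot_polys {1..2 * n} :: 'k point_poly set)"
    if "u \<in> {a, b, c, d}" "v \<in> {a, b, c, d}" for u v
    using in_range m that
    by (intro dot_polys_times dot_polys_var dot_polys_one poly_mapping_module.subspace_add[OF subspace_free_module]
        poly_mapping_module.subspace_scale[OF subspace_free_module]) auto
  then have "of_dotted (dotted_value A1 ((var b * var c + tt \<odot> 1) * basis_vec m :: 'k point_poly))
      = embed_hom A1 A1 (eval_dots (component A1) ((var b * var c + tt \<odot> 1) * basis_vec m))"
    "of_dotted (dotted_value A2 ((var a * var b + tt \<odot> 1) * basis_vec m :: 'k point_poly))
      = embed_hom A2 A2 (eval_dots (component A2) ((var a * var b + tt \<odot> 1) * basis_vec m))"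
    using of_dotted_dotted_value A A' by blast+
  note eqs = this
  \<comment> \<open>The point b occurs in both pairs, so one additional dot at b serves both sides
    and type II becomes type I for the monomial with this dot.\<close>
  have quad: "eval_dots \<kappa> ((var b * var c + tt \<odot> 1) * basis_vec m) = eval_dots \<kappa> (dual b c * basis_vec (add_mset b m))"
    "eval_dots \<kappa> ((var a * var b + tt \<odot> 1) * basis_vec m) = eval_dots \<kappa> (dual a b * basis_vec (add_mset b m))"
    for \<kappa> :: "nat \<Rightarrow> nat set"
    unfolding single_add_mset by (rule eval_dots_quadratic, blast)+
  have "set_mset (add_mset b m) \<subseteq> {1..2 * n}" using in_range m by simp
  then show ?thesis
    unfolding module_hom.diff[OF linear_map_of_dotted] eqs quad by (rule ring_surgery)
qed

end

lemma surgery_configuration_iff: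
  "(C, D, a, b, c, d) \<in> local_configurations n \<longleftrightarrow> surgery_configuration n C a b c d \<and> set_mset D \<subseteq> C"
  by (auto simp: local_configurations_def surgery_configuration_def)

lemma of_dotted_graphical_relations:
  fixes x :: "dotted \<Rightarrow>\<^sub>0 'k::field poly poly"
  assumes "x \<in> graphical_relations n" shows "of_dotted x \<in> ring_relations n"
proof (rule linear_map_span[OF linear_map_of_dotted _ _ assms])
  fix z :: "dotted \<Rightarrow>\<^sub>0 'k poly poly" assume "z \<in> dot_reductions n \<union> type_I_relations n \<union> type_II_relations n"
  then consider "z \<in> dot_reductions n" | "z \<in> type_I_relations n" | "z \<in> type_II_relations n" by blast
  then show "of_dotted z \<in> ring_relations n"
  proof cases
    case 1
    then obtain m D e where z: "z = basis_vec (m, D + {#e, e#}) - (hh \<odot> basis_vec (m, D + {#e#}) + tt \<odot> basis_vec (m, D))"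
      unfolding dot_reductions_def by blast
    have "of_dotted z = 0"
      by (simp add: z module_hom.diff[OF linear_map_of_dotted] module_hom.add[OF linear_map_of_dotted]
          module_hom.scale[OF linear_map_of_dotted] dot_action_twice module_hom.add[OF linear_map_embed_hom]
          module_hom.scale[OF linear_map_embed_hom])
    then show ?thesis by (simp add: poly_mapping_module.span_zero)
  next
    case 2
    then obtain C D a b c d p q r s where conf: "(C, D, a, b, c, d) \<in> local_configurations n"
      and z: "z = (with_arcs C D (a, b) (p + q + 1) (c, d) (r + s)
        + with_arcs C D (a, b) (p + q) (c, d) (r + s + 1)
        - hh \<odot> with_arcs C D (a, b) (p + q) (c, d) (r + s))
     - (with_arcs C D (a, d) (p + s + 1) (b, c) (q + r)
        + with_arcs C D (a, d) (p + s) (b, c) (q + r + 1)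
        - hh \<odot> with_arcs C D (a, d) (p + s) (b, c) (q + r))"
      unfolding type_I_relations_def by blast
    interpret surgery_configuration n C a b c d using conf by (simp add: surgery_configuration_iff)
    have "set_mset D \<subseteq> C" using conf by (simp add: surgery_configuration_iff)
    then obtain m where m: "set_mset m \<subseteq> {1..2 * n}" "rest m = D" "count m a = p" "count m b = q" "count m c = r" "count m d = s"
      by (rule monomial_exists)
    show ?thesis
      using of_dotted_type_I[OF m(1)] unfolding type_I_eq[OF m(1)] z m(2-6) .
  next
    case 3
    then obtain C D a b c d p q r s where conf: "(C, D, a, b, c, d) \<in> local_configurations n"
      and z: "z = (with_arcs C D (a, b) (p + q + 1) (c, d) (r + s + 1)
        + tt \<odot> with_arcs C D (a, b) (p + q) (c, d) (r + s))
     - (with_arcs C D (a, d) (p + s + 1) (b, c) (q + r + 1)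
        + tt \<odot> with_arcs C D (a, d) (p + s) (b, c) (q + r))"
      unfolding type_II_relations_def by blast
    interpret surgery_configuration n C a b c d using conf by (simp add: surgery_configuration_iff)
    have "set_mset D \<subseteq> C" using conf by (simp add: surgery_configuration_iff)
    then obtain m where m: "set_mset m \<subseteq> {1..2 * n}" "rest m = D" "count m a = p" "count m b = q" "count m c = r" "count m d = s"
      by (rule monomial_exists)
    show ?thesis
      using of_dotted_type_II[OF m(1)] unfolding type_II_eq[OF m(1)] z m(2-6) .
  qed
qed simp

text \<open>Diagonal basis vectors return exactly; the others are sent to 0 and are relations
  themselves.\<close>

lemma of_dotted_to_dotted:
  fixes x :: "arc_basis \<Rightarrow>\<^sub>0 'k::field poly poly"
  assumes "x \<in> arc_ring n" shows "of_dotted (to_dotted x) - x \<in> ring_relations n"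
proof (rule linear_map_in_submodule[of "\<lambda>x. of_dotted (to_dotted x) - x"])
  show "linear_map (\<lambda>x. of_dotted (to_dotted x) - x)"
    by (intro linear_map_diff linear_map_compose[OF linear_map_to_dotted linear_map_of_dotted]
        poly_mapping_module.module_hom_ident)
  fix \<alpha> assume "\<alpha> \<in> Poly_Mapping.keys x"
  then obtain b a S where \<alpha>: "\<alpha> = (b, a, S)" and a: "a \<in> crossingless_matchings n"
    and b: "b \<in> crossingless_matchings n" and S: "S \<subseteq> circles n b a"
    using assms by (auto simp: arc_ring_def free_module_def)
  show "of_dotted (to_dotted (basis_vec \<alpha> :: arc_basis \<Rightarrow>\<^sub>0 'k poly poly)) - basis_vec \<alpha> \<in> ring_relations n"
  proof (cases "b = a")
    case True
    have "S \<subseteq> circles n a a" using S True by simp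
    note dots = dots_of_circles(1)[OF a a this, unfolded Un_absorb]
    have "image_mset fst (image_mset arc_of_circle (mset_set S)) = image_mset Min (mset_set S)"
      by (simp add: multiset.map_comp comp_def arc_of_circle_def)
    then have "of_dotted (to_dotted (basis_vec \<alpha> :: arc_basis \<Rightarrow>\<^sub>0 'k poly poly)) = basis_vec \<alpha>"
      using True by (simp add: \<alpha> dots)
    then show ?thesis by (simp add: poly_mapping_module.span_zero)
  next
    case False
    then show ?thesis
      using poly_mapping_module.span_neg[OF off_diagonal_in_ring_relations[OF a b S False]]
      by (simp add: \<alpha> module_hom.zero[OF linear_map_of_dotted])
  qed
qed simp

lemma dotted_matching_points:
  assumes "(a, D) \<in> dotted_matchings n"
  shows "set_mset (image_mset fst D) \<subseteq> {1..2 * n}" "image_mset (arc_at a) (image_mset fst D) = D"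
proof -
  have a: "a \<in> crossingless_matchings n" and D: "set_mset D \<subseteq> a"
    using assms by (auto simp: dotted_matchings_def)
  have e: "fst e \<in> {1..2 * n} \<and> arc_at a (fst e) = e" if "e \<in># D" for e
    using D that crossinglessD(1)[OF a, of "fst e" "snd e"] arc_at_arc(1)[OF a, of "fst e" "snd e"] by auto
  then show "set_mset (image_mset fst D) \<subseteq> {1..2 * n}" by auto
  show "image_mset (arc_at a) (image_mset fst D) = D"
    unfolding multiset.map_comp comp_def using e by (simp cong: image_mset_cong)
qed

lemma to_dotted_of_dotted:
  fixes y :: "dotted \<Rightarrow>\<^sub>0 'k::field poly poly"
  assumes "y \<in> free_module (dotted_matchings n)" shows "to_dotted (of_dotted y) - y \<in> graphical_relations n"
proof (rule linear_map_in_submodule[of "\<lambda>y. to_dotted (of_dotted y) - y"])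
  show "linear_map (\<lambda>y. to_dotted (of_dotted y) - y)"
    by (intro linear_map_diff linear_map_compose[OF linear_map_of_dotted linear_map_to_dotted]
        poly_mapping_module.module_hom_ident)
  fix \<delta> assume "\<delta> \<in> Poly_Mapping.keys y"
  moreover obtain a D where \<delta>: "\<delta> = (a, D)" by (cases \<delta>)
  ultimately have aD: "(a, D) \<in> dotted_matchings n" using assms by (auto simp: free_module_def)
  then have a: "a \<in> crossingless_matchings n" by (simp add: dotted_matchings_def)
  show "to_dotted (of_dotted (basis_vec \<delta>)) - basis_vec \<delta> \<in> graphical_relations n"
    using to_dotted_eval_dots[OF a, of "basis_vec (image_mset fst D)"] dotted_matching_points[OF aD]
    by (simp add: \<delta> dotted_value_basis_vec)
qed simp

lemma to_dotted_in:
  assumes "x \<in> arc_ring n" shows "to_dotted x \<in> free_module (dotted_matchings n)"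
proof (rule linear_map_in_submodule[OF linear_map_to_dotted subspace_free_module])
  fix \<alpha> assume "\<alpha> \<in> Poly_Mapping.keys x"
  then obtain b a S where \<alpha>: "\<alpha> = (b, a, S)" and a: "a \<in> crossingless_matchings n" and S: "S \<subseteq> circles n b a"
    using assms by (auto simp: arc_ring_def free_module_def)
  have "arc_of_circle C \<in> a" if "C \<in> S" "b = a" for C
    using S that arc_at_in(1)[OF a] by (auto simp: circles_def arc_at_eq)
  then have "(a, image_mset arc_of_circle (mset_set S)) \<in> dotted_matchings n" if "b = a"
    using a that finite_circles[OF S] by (auto simp: dotted_matchings_def)
  then show "to_dotted (basis_vec \<alpha>) \<in> free_module (dotted_matchings n)"
    by (simp add: \<alpha> poly_mapping_module.subspace_0[OF subspace_free_module])
qed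

lemma of_dotted_in:
  assumes "y \<in> free_module (dotted_matchings n)" shows "of_dotted y \<in> arc_ring n"
proof (rule linear_map_in_submodule[OF linear_map_of_dotted subspace_arc_ring])
  fix \<delta> assume "\<delta> \<in> Poly_Mapping.keys y"
  moreover obtain a D where \<delta>: "\<delta> = (a, D)" by (cases \<delta>)
  ultimately have aD: "(a, D) \<in> dotted_matchings n" using assms by (auto simp: free_module_def)
  then have a: "a \<in> crossingless_matchings n" by (simp add: dotted_matchings_def)
  show "of_dotted (basis_vec \<delta>) \<in> arc_ring n"
    using embed_hom_in_arc_ring[OF a a dotted_matching_points(1)[OF aD]] by (simp add: \<delta>)
qed

theorem proposition5p2p1:
  fixes n :: nat
  shows "rmodule_isomorphic
    (HH0_arc_ring n :: ('k::field poly poly, (arc_basis \<Rightarrow>\<^sub>0 'k poly poly) set) rmodule)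
    (graphical_module n)"
  unfolding HH0_arc_ring_def graphical_module_def
  by (rule quotient_module_isomorphicI[of to_dotted of_dotted])
    (simp_all add: subspace_arc_ring subspace_free_module to_dotted_in of_dotted_in
      to_dotted_ring_relations of_dotted_graphical_relations of_dotted_to_dotted to_dotted_of_dotted)

end
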